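(* Let $k$ be an algebraically closed field of characteristic $p>0$, let $G$ be a finite group, let $P$ be a $p$-subgroup of $G$, and let $M:=\mathrm{Sc}(G,P)$ be the Scott $kG$-module with vertex $P$. Suppose that $p\nmid |N_G(P)/P\,C_G(P)|$ and that there exists a normal subgroup $R\unlhd G$ with $R\leq P\cap\ker(M)$ and $|P/R|=p$. Then, for such an $R$, the following are equivalent: (1) $M$ is Brauer indecomposable. (2) $\mathrm{Res}^{G}_{C_G(R)}\,M$ is indecomposable.
   Context: All modules are finitely generated left modules; indecomposable modules are nonzero by convention. $k_G$ denotes the trivial $kG$-module, and $\mathrm{Res}^A_B$, $\mathrm{Ind}_B^A$ denote restriction and induction. Scott module: for a $p$-subgroup $P\leq G$, $\mathrm{Sc}(G,P)$ is the unique (up to isomorphism) indecomposable direct summand of $\mathrm{Ind}_P^G\,k_P$ which contains $k_G$ in its top (i.e. has $k_G$ as a quotient). It is a $p$-permutation module with vertex $P$. Kernel: $\ker(M):=\{g\in G \mid gm=m \text{ for all } m\in M\}$. Relative trace and Brauer construction: for $K\leq H\leq G$, $M^K:=\{m\in M\mid \kappa m=m\ \forall \kappa\in K\}$ and $\mathrm{tr}_K^H:M^K\to M^H$, $\mathrm{tr}_K^H(m)=\sum_{h\in[H/K]}hm$, the sum being over representatives of the left cosets of $K$ in $H$. For a $p$-subgroup $Q\leq G$, $M(Q):=M^Q/\sum_{K<Q}\mathrm{tr}_K^Q(M^K)$ (sum over proper subgroups $K$ of $Q$), which is a $kN_G(Q)$-module. Brauer indecomposability: $M=\mathrm{Sc}(G,P)$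 is called Brauer indecomposable if for every subgroup $Q\leq P$ the module $\mathrm{Res}^{N_G(Q)}_{Q\,C_G(Q)}\,M(Q)$ is indecomposable or zero as a $k(Q\,C_G(Q))$-module. *)

theory Defs
  imports "HOL-Algebra.Algebraic_Closure" "HOL-Algebra.Left_Coset" "HOL-Algebra.Group_Action"
    "HOL-Algebra.QuotRing" "HOL-Algebra.Module" "HOL-Computational_Algebra.Primes"
begin

definition has_characteristic :: "('k, 's) ring_scheme \<Rightarrow> nat \<Rightarrow> bool" where
  "has_characteristic k p \<longleftrightarrow> (\<forall>n::nat. [n] \<cdot>\<^bsub>k\<^esub> \<one>\<^bsub>k\<^esub> = \<zero>\<^bsub>k\<^esub> \<longleftrightarrow> p dvd n)"

definition p_subgroup :: "nat \<Rightarrow> 'g set \<Rightarrow> ('g, 'r) monoid_scheme \<Rightarrow> bool" where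
  "p_subgroup p P G \<longleftrightarrow> subgroup P G \<and> (\<exists>n. card P = p ^ n)"

definition centralizer :: "('g, 'r) monoid_scheme \<Rightarrow> 'g set \<Rightarrow> 'g set" where
  "centralizer G H = {g \<in> carrier G. \<forall>h\<in>H. g \<otimes>\<^bsub>G\<^esub> h = h \<otimes>\<^bsub>G\<^esub> g}"

section \<open>Modules over group algebras\<close>

text \<open>
  A left kG-module is a k-module with a k-linear action of G. The library's module record
  inherits the ring fields mult and one, which carry no meaning here.

  The acting group is an argument of every notion below and is not part of the record.
  Restricting to a subgroup H therefore leaves the record unchanged: the module Res M is M
  itself, viewed as a module for the group G with carrier H.
\<close>

record ('k, 'm, 'g) gmod = "('k, 'm) module" +
  gact :: "'g \<Rightarrow> 'm \<Rightarrow> 'm"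

definition gsubmodule ::
  "('k, 's) ring_scheme \<Rightarrow> ('g, 'r) monoid_scheme \<Rightarrow> ('k, 'm, 'g) gmod \<Rightarrow> 'm set \<Rightarrow> bool" where
  "gsubmodule k G M U \<longleftrightarrow>
     submodule U k M \<and> (\<forall>g\<in>carrier G. \<forall>u\<in>U. gact M g u \<in> U)"

definition gspan ::
  "('k, 's) ring_scheme \<Rightarrow> ('g, 'r) monoid_scheme \<Rightarrow> ('k, 'm, 'g) gmod \<Rightarrow> 'm set \<Rightarrow> 'm set" where
  "gspan k G M S = \<Inter>{U. gsubmodule k G M U \<and> S \<subseteq> U}"

locale fg_gmodule = G: group G + module k M
  for k :: "('k, 's) ring_scheme" (structure) and G :: "('g, 'r) monoid_scheme" (structure)
    and M :: "('k, 'm, 'g) gmod" (structure) +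
  assumes gact_closed:
      "\<lbrakk>g \<in> carrier G; x \<in> carrier M\<rbrakk> \<Longrightarrow> gact M g x \<in> carrier M"
    and gact_add:
      "\<lbrakk>g \<in> carrier G; x \<in> carrier M; y \<in> carrier M\<rbrakk> \<Longrightarrow>
        gact M g (x \<oplus>\<^bsub>M\<^esub> y) = gact M g x \<oplus>\<^bsub>M\<^esub> gact M g y"
    and gact_smult:
      "\<lbrakk>g \<in> carrier G; a \<in> carrier k; x \<in> carrier M\<rbrakk> \<Longrightarrow>
        gact M g (a \<odot>\<^bsub>M\<^esub> x) = a \<odot>\<^bsub>M\<^esub> gact M g x"
    and gact_one: "x \<in> carrier M \<Longrightarrow> gact M \<one>\<^bsub>G\<^esub> x = x"
    and gact_mult:
      "\<lbrakk>g \<in> carrier G; h \<in> carrier G; x \<in> carrier M\<rbrakk> \<Longrightarrow>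
        gact M (g \<otimes>\<^bsub>G\<^esub> h) x = gact M g (gact M h x)"
    and finitely_generated:
      "\<exists>S. finite S \<and> S \<subseteq> carrier M \<and> gspan k G M S = carrier M"

definition gmod_hom ::
  "('k, 's) ring_scheme \<Rightarrow> ('g, 'r) monoid_scheme \<Rightarrow> ('k, 'm, 'g) gmod \<Rightarrow> ('k, 'n, 'g) gmod
    \<Rightarrow> ('m \<Rightarrow> 'n) set" where
  "gmod_hom k G M N = {f \<in> carrier M \<rightarrow> carrier N.
     (\<forall>x\<in>carrier M. \<forall>y\<in>carrier M. f (x \<oplus>\<^bsub>M\<^esub> y) = f x \<oplus>\<^bsub>N\<^esub> f y) \<and>
     (\<forall>a\<in>carrier k. \<forall>x\<in>carrier M. f (a \<odot>\<^bsub>M\<^esub> x) = a \<odot>\<^bsub>N\<^esub> f x) \<and>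
     (\<forall>g\<in>carrier G. \<forall>x\<in>carrier M. f (gact M g x) = gact N g (f x))}"

definition gmod_iso ::
  "('k, 's) ring_scheme \<Rightarrow> ('g, 'r) monoid_scheme \<Rightarrow> ('k, 'm, 'g) gmod \<Rightarrow> ('k, 'n, 'g) gmod
    \<Rightarrow> bool" where
  "gmod_iso k G M N \<longleftrightarrow> (\<exists>f\<in>gmod_hom k G M N. bij_betw f (carrier M) (carrier N))"

definition direct_decomposition ::
  "('k, 's) ring_scheme \<Rightarrow> ('g, 'r) monoid_scheme \<Rightarrow> ('k, 'm, 'g) gmod \<Rightarrow> 'm set \<Rightarrow> 'm set
    \<Rightarrow> bool" where
  "direct_decomposition k G M A B \<longleftrightarrow>
     gsubmodule k G M A \<and> gsubmodule k G M B \<and>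
     A <+>\<^bsub>M\<^esub> B = carrier M \<and> A \<inter> B = {\<zero>\<^bsub>M\<^esub>}"

definition indecomposable ::
  "('k, 's) ring_scheme \<Rightarrow> ('g, 'r) monoid_scheme \<Rightarrow> ('k, 'm, 'g) gmod \<Rightarrow> bool" where
  "indecomposable k G M \<longleftrightarrow>
     carrier M \<noteq> {\<zero>\<^bsub>M\<^esub>} \<and>
     (\<forall>A B. direct_decomposition k G M A B \<longrightarrow> A = {\<zero>\<^bsub>M\<^esub>} \<or> B = {\<zero>\<^bsub>M\<^esub>})"

definition is_direct_summand ::
  "('k, 's) ring_scheme \<Rightarrow> ('g, 'r) monoid_scheme \<Rightarrow> ('k, 'm, 'g) gmod \<Rightarrow> ('k, 'n, 'g) gmod
    \<Rightarrow> bool" where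
  "is_direct_summand k G M N \<longleftrightarrow>
     (\<exists>A B. direct_decomposition k G N A B \<and> gmod_iso k G M (N\<lparr>carrier := A\<rparr>))"

text \<open>The quotient M/N on additive cosets; N is meant to be a submodule stable under the
  acting group. The operations follow the pattern of the library's quotient ring.\<close>

definition gmod_quot :: "('k, 'm, 'g) gmod \<Rightarrow> 'm set \<Rightarrow> ('k, 'm set, 'g) gmod" where
  "gmod_quot M N =
     \<lparr>carrier = a_rcosets\<^bsub>M\<^esub> N, monoid.mult = undefined, one = undefined,
      ring.zero = N, ring.add = set_add M,
      smult = (\<lambda>a C. \<Union>x\<in>C. N +>\<^bsub>M\<^esub> (a \<odot>\<^bsub>M\<^esub> x)),
      gact = (\<lambda>g C. \<Union>x\<in>C. N +>\<^bsub>M\<^esub> gact M g x)\<rparr>"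

definition trivial_gmod :: "('k, 's) ring_scheme \<Rightarrow> ('k, 'k, 'g) gmod" where
  "trivial_gmod k =
     \<lparr>carrier = carrier k, monoid.mult = monoid.mult k, one = \<one>\<^bsub>k\<^esub>,
      ring.zero = \<zero>\<^bsub>k\<^esub>, ring.add = ring.add k,
      smult = monoid.mult k, gact = (\<lambda>g x. x)\<rparr>"

definition gmod_kernel ::
  "('g, 'r) monoid_scheme \<Rightarrow> ('k, 'm, 'g) gmod \<Rightarrow> 'g set" where
  "gmod_kernel G M = {g \<in> carrier G. \<forall>m\<in>carrier M. gact M g m = m}"

section \<open>Induction\<close>

text \<open>
  For a finite group G, the tensor product of kG and N over k consists of the functions from
  G to N, the elementary tensor of x and n being the function with value n at x and 0
  elsewhere; G acts by left multiplication on the first factor. The induced module, the tensor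
  product of kG and N over kH, is the quotient by the balancing relations.
\<close>

definition kG_tensor :: "('g, 'r) monoid_scheme \<Rightarrow> ('k, 'n, 'g) gmod \<Rightarrow> ('k, 'g \<Rightarrow> 'n, 'g) gmod"
  where
  "kG_tensor G N =
     \<lparr>carrier = carrier G \<rightarrow>\<^sub>E carrier N, monoid.mult = undefined, one = undefined,
      ring.zero = (\<lambda>x\<in>carrier G. \<zero>\<^bsub>N\<^esub>),
      ring.add = (\<lambda>u v. \<lambda>x\<in>carrier G. u x \<oplus>\<^bsub>N\<^esub> v x),
      smult = (\<lambda>a u. \<lambda>x\<in>carrier G. a \<odot>\<^bsub>N\<^esub> u x),
      gact = (\<lambda>g u. \<lambda>x\<in>carrier G. u (inv\<^bsub>G\<^esub> g \<otimes>\<^bsub>G\<^esub> x))\<rparr>"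

definition elem_tensor ::
  "('g, 'r) monoid_scheme \<Rightarrow> ('k, 'n, 'g) gmod \<Rightarrow> 'g \<Rightarrow> 'n \<Rightarrow> 'g \<Rightarrow> 'n" where
  "elem_tensor G N x n = (\<lambda>y\<in>carrier G. if y = x then n else \<zero>\<^bsub>N\<^esub>)"

definition balancing_relations ::
  "('g, 'r) monoid_scheme \<Rightarrow> 'g set \<Rightarrow> ('k, 'n, 'g) gmod \<Rightarrow> ('g \<Rightarrow> 'n) set" where
  "balancing_relations G H N =
     {elem_tensor G N (x \<otimes>\<^bsub>G\<^esub> h) n \<ominus>\<^bsub>kG_tensor G N\<^esub> elem_tensor G N x (gact N h n) | x h n.
        x \<in> carrier G \<and> h \<in> H \<and> n \<in> carrier N}"

definition induced_gmod ::
  "('k, 's) ring_scheme \<Rightarrow> ('g, 'r) monoid_scheme \<Rightarrow> 'g set \<Rightarrow> ('k, 'n, 'g) gmod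
    \<Rightarrow> ('k, ('g \<Rightarrow> 'n) set, 'g) gmod" where
  "induced_gmod k G H N =
     gmod_quot (kG_tensor G N) (gspan k G (kG_tensor G N) (balancing_relations G H N))"

section \<open>Scott modules\<close>

text \<open>The Scott module is determined only up to isomorphism, so it is rendered as a predicate.\<close>

definition is_scott_module ::
  "('k, 's) ring_scheme \<Rightarrow> ('g, 'r) monoid_scheme \<Rightarrow> 'g set \<Rightarrow> ('k, 'm, 'g) gmod \<Rightarrow> bool" where
  "is_scott_module k G P M \<longleftrightarrow>
     fg_gmodule k G M \<and> indecomposable k G M \<and>
     is_direct_summand k G M (induced_gmod k G P (trivial_gmod k)) \<and>
     (\<exists>f\<in>gmod_hom k G M (trivial_gmod k). f ` carrier M = carrier k)"

section \<open>Brauer construction\<close>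

definition fixed_points :: "('k, 'm, 'g) gmod \<Rightarrow> 'g set \<Rightarrow> 'm set" where
  "fixed_points M K = {m \<in> carrier M. \<forall>x\<in>K. gact M x m = m}"

definition relative_trace ::
  "('g, 'r) monoid_scheme \<Rightarrow> ('k, 'm, 'g) gmod \<Rightarrow> 'g set \<Rightarrow> 'g set \<Rightarrow> 'm \<Rightarrow> 'm" where
  "relative_trace G M K H m =
     (\<Oplus>\<^bsub>M\<^esub>C\<in>lcosets\<^bsub>G\<lparr>carrier := H\<rparr>\<^esub> K. gact M (SOME h. h \<in> C) m)"

definition proper_traces ::
  "('g, 'r) monoid_scheme \<Rightarrow> ('k, 'm, 'g) gmod \<Rightarrow> 'g set \<Rightarrow> 'm set" where
  "proper_traces G M Q =
     {\<Oplus>\<^bsub>M\<^esub>K\<in>{K. subgroup K G \<and> K \<subset> Q}. t K | t.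
        t \<in> (\<Pi> K\<in>{K. subgroup K G \<and> K \<subset> Q}. relative_trace G M K Q ` fixed_points M K)}"

definition brauer_construction ::
  "('g, 'r) monoid_scheme \<Rightarrow> ('k, 'm, 'g) gmod \<Rightarrow> 'g set \<Rightarrow> ('k, 'm set, 'g) gmod" where
  "brauer_construction G M Q =
     gmod_quot (M\<lparr>carrier := fixed_points M Q\<rparr>) (proper_traces G M Q)"

definition brauer_indecomposable ::
  "('k, 's) ring_scheme \<Rightarrow> ('g, 'r) monoid_scheme \<Rightarrow> 'g set \<Rightarrow> ('k, 'm, 'g) gmod \<Rightarrow> bool" where
  "brauer_indecomposable k G P M \<longleftrightarrow>
     (\<forall>Q. subgroup Q G \<and> Q \<subseteq> P \<longrightarrow>
        indecomposable k (G\<lparr>carrier := Q <#>\<^bsub>G\<^esub> centralizer G Q\<rparr>) (brauer_construction G M Q) \<or>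
        carrier (brauer_construction G M Q) = {\<zero>\<^bsub>brauer_construction G M Q\<^esub>})"

end

theory Submission
  imports Defs "HOL-Algebra.Zassenhaus"
begin

text \<open>
  Being a direct summand of the permutation module on G/P means that m is the sum of
  l(g^-1 m) g b over the cosets gP, for a P-fixed vector b and a P-invariant functional l. The map
  f from M onto the trivial module does not vanish at b, so by Frobenius reciprocity and
  Fitting's lemma every P-fixed u with f(u) nonzero generates M^P, modulo the traces, as a module for N_G(P). Hence ker f is the unique maximal N_G(P)-submodule of M(P), and
  by averaging over the p'-group N_G(P)/P C_G(P) it is also the unique maximal C_G(P)-submodule:
  M(P) is always indecomposable over C_G(P).

  Since R acts trivially and |P/R| = p, the module M(Q) is M when Q is contained in R, and M(P)
  otherwise. The subgroups of the second kind therefore impose no condition, and those of the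
  first kind reduce to Q = R.
\<close>

text \<open>Two obstacles shape the proof. Generation is available only for N_G(P): a coset gP is
  fixed by P exactly when g normalises P, and the other P-orbits of cosets have stabiliser R,
  because only R and P lie between R and P; their terms add up to traces from R. A maximal
  C_G(P)-submodule B, on the other hand, need not be stable under N_G(P). Generation is therefore
  applied to the subspace of all x with x - f(x)e in D. Here D is the largest N_G(P)-stable subspace
  of B, and e is a vector with f(e) = 1 that N_G(P) fixes modulo D, obtained by averaging over the
  cosets of P C_G(P) in N_G(P). Indecomposability follows from a criterion on f alone: b cannot be a
  sum of two elements of ker f, so in any decomposition of M(P) one summand has a representative
  outside ker f, and that summand is everything. The chain conditions behind Fitting's lemma and
  behind the choice of B come from the presentation itself: the functionals l(g^-1 x), with g
  running over coset representatives, are finitely many coordinates that separate the points of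
  M.\<close>

abbreviation rep :: "'a set \<Rightarrow> 'a" where "rep C \<equiv> SOME g. g \<in> C"

text \<open>Kept apart from \<open>fg_gmodule\<close> so that submodules, quotients and
  \<open>kG_tensor\<close> become instances by checking the action laws alone. Bounds on chains of
  subspaces are supplied later by \<open>rank_exists\<close>.\<close>

locale gmodule = G: group G + module k M
  for k :: "('k, 's) ring_scheme" (structure) and G :: "('g, 'r) monoid_scheme" (structure)
    and M :: "('k, 'm, 'g) gmod" (structure) +
  assumes gact_closed [simp]:
      "\<lbrakk>g \<in> carrier G; x \<in> carrier M\<rbrakk> \<Longrightarrow> gact M g x \<in> carrier M"
    and gact_add:
      "\<lbrakk>g \<in> carrier G; x \<in> carrier M; y \<in> carrier M\<rbrakk> \<Longrightarrow>
        gact M g (x \<oplus>\<^bsub>M\<^esub> y) = gact M g x \<oplus>\<^bsub>M\<^esub> gact M g y"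
    and gact_smult:
      "\<lbrakk>g \<in> carrier G; a \<in> carrier k; x \<in> carrier M\<rbrakk> \<Longrightarrow>
        gact M g (a \<odot>\<^bsub>M\<^esub> x) = a \<odot>\<^bsub>M\<^esub> gact M g x"
    and gact_one [simp]: "x \<in> carrier M \<Longrightarrow> gact M \<one>\<^bsub>G\<^esub> x = x"
    and gact_mult:
      "\<lbrakk>g \<in> carrier G; h \<in> carrier G; x \<in> carrier M\<rbrakk> \<Longrightarrow>
        gact M (g \<otimes>\<^bsub>G\<^esub> h) x = gact M g (gact M h x)"

lemma fg_gmodule_imp_gmodule:
  assumes "fg_gmodule k G M"
  shows "gmodule k G M"
proof -
  interpret fg_gmodule k G M by fact
  show ?thesis
    by (intro gmodule.intro gmodule_axioms.intro G.is_group module_axioms gact_closed gact_add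
        gact_smult gact_one gact_mult)
qed

lemma gsubmodule_mono:
  assumes "gsubmodule k H M U" and "carrier H' \<subseteq> carrier H"
  shows "gsubmodule k H' M U"
  using assms unfolding gsubmodule_def by blast

text \<open>A larger group has fewer submodules, hence fewer decompositions. This carries
  indecomposability from C_G(P) or C_G(R) up to Q C_G(Q).\<close>

lemma indecomposable_mono:
  assumes "indecomposable k H' M" and "carrier H' \<subseteq> carrier H"
  shows "indecomposable k H M"
  using assms(1) gsubmodule_mono[OF _ assms(2)]
  unfolding indecomposable_def direct_decomposition_def by meson

lemma (in module) submoduleI':
  assumes "U \<subseteq> carrier M" "\<zero>\<^bsub>M\<^esub> \<in> U"
    and "\<And>a b. \<lbrakk>a \<in> U; b \<in> U\<rbrakk> \<Longrightarrow> a \<oplus>\<^bsub>M\<^esub> b \<in> U"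
    and s: "\<And>a x. \<lbrakk>a \<in> carrier R; x \<in> U\<rbrakk> \<Longrightarrow> a \<odot>\<^bsub>M\<^esub> x \<in> U"
  shows "submodule U R M"
proof (rule submoduleI)
  fix a assume a: "a \<in> U"
  have "(\<ominus> \<one>) \<odot>\<^bsub>M\<^esub> a \<in> U" using a s by simp
  moreover have "(\<ominus> \<one>) \<odot>\<^bsub>M\<^esub> a = \<ominus>\<^bsub>M\<^esub> a"
    using a assms(1) by (simp add: smult_l_minus subset_iff)
  ultimately show "\<ominus>\<^bsub>M\<^esub> a \<in> U" by simp
qed (use assms in auto)

lemma (in module) submodule_zero: "submodule U R M \<Longrightarrow> \<zero>\<^bsub>M\<^esub> \<in> U"
  using submodule.axioms(1) subgroup.one_closed by fastforce

lemma (in module) submodule_minus: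
  "\<lbrakk>submodule U R M; x \<in> U; y \<in> U\<rbrakk> \<Longrightarrow> x \<ominus>\<^bsub>M\<^esub> y \<in> U"
  unfolding a_minus_def using submoduleE(3,5) by blast

lemma (in module) submodule_finsum:
  assumes "submodule U R M" "\<And>i. i \<in> I \<Longrightarrow> F i \<in> U"
  shows "(\<Oplus>\<^bsub>M\<^esub>i\<in>I. F i) \<in> U"
  using assms(2)
proof (induction I rule: infinite_finite_induct)
  case (insert i I)
  have "F \<in> I \<rightarrow> carrier M" "F i \<in> carrier M"
    using insert.prems submoduleE(1)[OF assms(1)] by auto
  then show ?case using insert submoduleE(5)[OF assms(1)] by simp
qed (simp_all add: submodule_zero[OF assms(1)])

lemma (in module) submodule_subset_trans:
  assumes "submodule E R M" "submodule U R (M\<lparr>carrier := E\<rparr>)"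
  shows "submodule U R M"
proof (rule submoduleI')
  have m: "module R (M\<lparr>carrier := E\<rparr>)"
    using submodule.submodule_is_module[OF assms(1)] module_axioms by blast
  interpret E: module R "M\<lparr>carrier := E\<rparr>" by (rule m)
  show "U \<subseteq> carrier M" using E.submoduleE(1)[OF assms(2)] submoduleE(1)[OF assms(1)] by auto
  show "\<zero>\<^bsub>M\<^esub> \<in> U" using E.submodule_zero[OF assms(2)] by simp
  show "\<And>a b. \<lbrakk>a \<in> U; b \<in> U\<rbrakk> \<Longrightarrow> a \<oplus>\<^bsub>M\<^esub> b \<in> U"
    using E.submoduleE(5)[OF assms(2)] by simp
  show "\<And>a x. \<lbrakk>a \<in> carrier R; x \<in> U\<rbrakk> \<Longrightarrow> a \<odot>\<^bsub>M\<^esub> x \<in> U"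
    using E.submoduleE(4)[OF assms(2)] by simp
qed

section \<open>Group actions on modules: submodules, spans and restriction\<close>

context gmodule
begin

lemma gact_zero [simp]: "g \<in> carrier G \<Longrightarrow> gact M g \<zero>\<^bsub>M\<^esub> = \<zero>\<^bsub>M\<^esub>"
  using gact_smult[of g "\<zero>" "\<zero>\<^bsub>M\<^esub>"] by simp

lemma gact_neg:
  "\<lbrakk>g \<in> carrier G; x \<in> carrier M\<rbrakk> \<Longrightarrow> gact M g (\<ominus>\<^bsub>M\<^esub> x) = \<ominus>\<^bsub>M\<^esub> gact M g x"
  using gact_smult[of g "\<ominus> \<one>" x] by (simp add: smult_l_minus)

lemma gact_minus:
  "\<lbrakk>g \<in> carrier G; x \<in> carrier M; y \<in> carrier M\<rbrakk> \<Longrightarrow>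
    gact M g (x \<ominus>\<^bsub>M\<^esub> y) = gact M g x \<ominus>\<^bsub>M\<^esub> gact M g y"
  unfolding a_minus_def by (simp add: gact_add gact_neg)

lemma gact_inv_cancel [simp]:
  assumes "g \<in> carrier G" "x \<in> carrier M"
  shows "gact M (inv\<^bsub>G\<^esub> g) (gact M g x) = x" "gact M g (gact M (inv\<^bsub>G\<^esub> g) x) = x"
  using assms by (simp_all add: gact_mult[symmetric])

lemma gact_finsum:
  assumes "g \<in> carrier G" "F \<in> I \<rightarrow> carrier M"
  shows "gact M g (\<Oplus>\<^bsub>M\<^esub>i\<in>I. F i) = (\<Oplus>\<^bsub>M\<^esub>i\<in>I. gact M g (F i))"
  using assms(2)
proof (induction I rule: infinite_finite_induct)
  case (insert i I)
  have "F \<in> I \<rightarrow> carrier M" "F i \<in> carrier M" using insert.prems by auto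
  then show ?case using insert assms(1) by (simp add: gact_add Pi_def)
qed (use assms in simp_all)

lemma gsubmoduleI:
  assumes "U \<subseteq> carrier M" "\<zero>\<^bsub>M\<^esub> \<in> U"
    and "\<And>a b. \<lbrakk>a \<in> U; b \<in> U\<rbrakk> \<Longrightarrow> a \<oplus>\<^bsub>M\<^esub> b \<in> U"
    and "\<And>a x. \<lbrakk>a \<in> carrier k; x \<in> U\<rbrakk> \<Longrightarrow> a \<odot>\<^bsub>M\<^esub> x \<in> U"
    and "\<And>g x. \<lbrakk>g \<in> carrier G; x \<in> U\<rbrakk> \<Longrightarrow> gact M g x \<in> U"
  shows "gsubmodule k G M U"
  using assms submoduleI'[of U] unfolding gsubmodule_def by blast

lemma gsubmoduleD:
  assumes "gsubmodule k G M U"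
  shows "submodule U k M" "U \<subseteq> carrier M" "\<zero>\<^bsub>M\<^esub> \<in> U"
    and "\<And>a b. \<lbrakk>a \<in> U; b \<in> U\<rbrakk> \<Longrightarrow> a \<oplus>\<^bsub>M\<^esub> b \<in> U"
    and "\<And>a b. \<lbrakk>a \<in> U; b \<in> U\<rbrakk> \<Longrightarrow> a \<ominus>\<^bsub>M\<^esub> b \<in> U"
    and "\<And>a x. \<lbrakk>a \<in> carrier k; x \<in> U\<rbrakk> \<Longrightarrow> a \<odot>\<^bsub>M\<^esub> x \<in> U"
    and "\<And>g x. \<lbrakk>g \<in> carrier G; x \<in> U\<rbrakk> \<Longrightarrow> gact M g x \<in> U"
proof -
  have U: "submodule U k M" and g: "\<And>g x. \<lbrakk>g \<in> carrier G; x \<in> U\<rbrakk> \<Longrightarrow> gact M g x \<in> U"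
    using assms unfolding gsubmodule_def by auto
  show "submodule U k M" by (rule U)
  show "U \<subseteq> carrier M" by (rule submoduleE(1)[OF U])
  show "\<zero>\<^bsub>M\<^esub> \<in> U" by (rule submodule_zero[OF U])
  show "\<And>a b. \<lbrakk>a \<in> U; b \<in> U\<rbrakk> \<Longrightarrow> a \<oplus>\<^bsub>M\<^esub> b \<in> U" by (rule submoduleE(5)[OF U])
  show "\<And>a b. \<lbrakk>a \<in> U; b \<in> U\<rbrakk> \<Longrightarrow> a \<ominus>\<^bsub>M\<^esub> b \<in> U" by (rule submodule_minus[OF U])
  show "\<And>a x. \<lbrakk>a \<in> carrier k; x \<in> U\<rbrakk> \<Longrightarrow> a \<odot>\<^bsub>M\<^esub> x \<in> U" by (rule submoduleE(4)[OF U])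
  show "\<And>g x. \<lbrakk>g \<in> carrier G; x \<in> U\<rbrakk> \<Longrightarrow> gact M g x \<in> U" by (rule g)
qed

lemma gsubmodule_carrier: "gsubmodule k G M (carrier M)"
  by (rule gsubmoduleI) auto

lemma gsubmodule_gspan:
  assumes "S \<subseteq> carrier M"
  shows "gsubmodule k G M (gspan k G M S)"
proof (rule gsubmoduleI)
  show "gspan k G M S \<subseteq> carrier M"
    unfolding gspan_def using gsubmodule_carrier assms by blast
qed (auto simp: gspan_def dest: gsubmoduleD)

lemma gspan_superset: "S \<subseteq> gspan k G M S"
  unfolding gspan_def by blast

lemma gspan_least: "\<lbrakk>gsubmodule k G M U; S \<subseteq> U\<rbrakk> \<Longrightarrow> gspan k G M S \<subseteq> U"
  unfolding gspan_def by blast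

lemma gmodule_restrict_group:
  assumes "subgroup H G"
  shows "gmodule k (G\<lparr>carrier := H\<rparr>) M"
proof -
  have "group (G\<lparr>carrier := H\<rparr>)" using assms G.subgroup_imp_group by blast
  then interpret H: group "G\<lparr>carrier := H\<rparr>" .
  have "H \<subseteq> carrier G" using assms subgroup.subset by blast
  then show ?thesis
    by unfold_locales (auto simp: gact_add gact_smult gact_mult subset_iff)
qed

lemma gmodule_restrict_carrier:
  assumes "gsubmodule k G M U"
  shows "gmodule k G (M\<lparr>carrier := U\<rparr>)"
proof -
  have "module k (M\<lparr>carrier := U\<rparr>)"
    using submodule.submodule_is_module[OF gsubmoduleD(1)[OF assms]] module_axioms by blast
  then interpret U: module k "M\<lparr>carrier := U\<rparr>" .
  note D = gsubmoduleD[OF assms]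
  show ?thesis
    by unfold_locales (use D in \<open>auto simp: gact_add gact_smult gact_mult subset_iff\<close>)
qed

end

section \<open>Quotient modules\<close>

locale gmodule_quotient = gmodule k G M
  for k :: "('k, 's) ring_scheme" (structure) and G :: "('g, 'r) monoid_scheme" (structure)
    and M :: "('k, 'm, 'g) gmod" (structure) +
  fixes N
  assumes gsub: "gsubmodule k G M N"
begin

sublocale A: abelian_subgroup N M
  using gsubmoduleD(1)[OF gsub] submodule.axioms(1)
  by (intro abelian_subgroupI3) (auto simp: additive_subgroup_def M.abelian_group_axioms)

abbreviation cls :: "'m \<Rightarrow> 'm set" where "cls x \<equiv> N +>\<^bsub>M\<^esub> x"

lemma coset_eq_iff:
  assumes "x \<in> carrier M" "y \<in> carrier M"
  shows "cls x = cls y \<longleftrightarrow> x \<ominus>\<^bsub>M\<^esub> y \<in> N"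
proof
  assume "cls x = cls y"
  then have "x \<in> cls y" using A.a_rcos_self[OF assms(1)] by simp
  then show "x \<ominus>\<^bsub>M\<^esub> y \<in> N" using A.a_rcos_module[OF assms(2,1)] by (simp add: a_minus_def)
next
  assume "x \<ominus>\<^bsub>M\<^esub> y \<in> N"
  then have "x \<in> cls y" using A.a_rcos_module[OF assms(2,1)] by (simp add: a_minus_def)
  then show "cls x = cls y"
    using M.a_repr_independence[OF _ assms(2) A.a_subgroup] by blast
qed

lemma mem_coset_iff:
  assumes "x \<in> carrier M"
  shows "y \<in> cls x \<longleftrightarrow> y \<in> carrier M \<and> cls y = cls x"
  using M.a_repr_independence[OF _ assms A.a_subgroup, of y] A.a_rcos_self[of y]
    A.a_elemrcos_carrier[OF assms, of y] by blast

lemma quot_carrier: "carrier (gmod_quot M N) = cls ` carrier M"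
  unfolding gmod_quot_def A_RCOSETS_def' by auto

lemma coset_closed [simp]: "x \<in> carrier M \<Longrightarrow> cls x \<in> carrier (gmod_quot M N)"
  unfolding quot_carrier by blast

lemma quot_zero: "\<zero>\<^bsub>gmod_quot M N\<^esub> = cls \<zero>\<^bsub>M\<^esub>"
  using M.a_coset_add_zero A.a_subset unfolding gmod_quot_def by simp

lemma quot_add:
  "\<lbrakk>x \<in> carrier M; y \<in> carrier M\<rbrakk> \<Longrightarrow>
    cls x \<oplus>\<^bsub>gmod_quot M N\<^esub> cls y = cls (x \<oplus>\<^bsub>M\<^esub> y)"
  unfolding gmod_quot_def by (simp add: A.a_rcos_sum)

text \<open>The union in \<open>gmod_quot\<close> runs over a nonempty family of equal cosets,
  because representatives differ by elements of N; so it collapses to a single coset. The same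
  reason settles the action below.\<close>

lemma quot_smult:
  assumes "a \<in> carrier k" "x \<in> carrier M"
  shows "a \<odot>\<^bsub>gmod_quot M N\<^esub> cls x = cls (a \<odot>\<^bsub>M\<^esub> x)"
proof -
  have ne: "cls x \<noteq> {}" using A.a_rcos_self[OF assms(2)] by blast
  have "cls (a \<odot>\<^bsub>M\<^esub> y) = cls (a \<odot>\<^bsub>M\<^esub> x)" if y: "y \<in> cls x" for y
  proof -
    have yc: "y \<in> carrier M" and "y \<ominus>\<^bsub>M\<^esub> x \<in> N"
      using y mem_coset_iff coset_eq_iff assms by blast+
    then have "a \<odot>\<^bsub>M\<^esub> (y \<ominus>\<^bsub>M\<^esub> x) \<in> N" using gsubmoduleD(6)[OF gsub] assms by blast
    moreover have "a \<odot>\<^bsub>M\<^esub> (y \<ominus>\<^bsub>M\<^esub> x) = a \<odot>\<^bsub>M\<^esub> y \<ominus>\<^bsub>M\<^esub> a \<odot>\<^bsub>M\<^esub> x"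
      using assms yc unfolding a_minus_def by (simp add: smult_r_distr smult_r_minus)
    ultimately show ?thesis using coset_eq_iff assms yc by simp
  qed
  then have "(\<Union>y\<in>cls x. cls (a \<odot>\<^bsub>M\<^esub> y)) = cls (a \<odot>\<^bsub>M\<^esub> x)"
    by (rule SUP_eq_const[OF ne])
  then show ?thesis unfolding gmod_quot_def by simp
qed

lemma quot_gact:
  assumes "g \<in> carrier G" "x \<in> carrier M"
  shows "gact (gmod_quot M N) g (cls x) = cls (gact M g x)"
proof -
  have ne: "cls x \<noteq> {}" using A.a_rcos_self[OF assms(2)] by blast
  have "cls (gact M g y) = cls (gact M g x)" if y: "y \<in> cls x" for y
  proof -
    have yc: "y \<in> carrier M" and "y \<ominus>\<^bsub>M\<^esub> x \<in> N"
      using y mem_coset_iff coset_eq_iff assms by blast+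
    then have "gact M g (y \<ominus>\<^bsub>M\<^esub> x) \<in> N" using gsubmoduleD(7)[OF gsub] assms by blast
    then show ?thesis using coset_eq_iff assms yc by (simp add: gact_minus)
  qed
  then have "(\<Union>y\<in>cls x. cls (gact M g y)) = cls (gact M g x)"
    by (rule SUP_eq_const[OF ne])
  then show ?thesis unfolding gmod_quot_def by simp
qed

lemma gmodule_quot: "gmodule k G (gmod_quot M N)"
proof -
  have ab: "abelian_group (gmod_quot M N)"
  proof (rule abelian_groupI)
    fix C1 assume "C1 \<in> carrier (gmod_quot M N)"
    then obtain x where x: "x \<in> carrier M" "C1 = cls x" unfolding quot_carrier by blast
    then have "cls (\<ominus>\<^bsub>M\<^esub> x) \<oplus>\<^bsub>gmod_quot M N\<^esub> C1 = \<zero>\<^bsub>gmod_quot M N\<^esub>"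
      by (simp add: quot_add quot_zero M.l_neg)
    then show "\<exists>C2\<in>carrier (gmod_quot M N). C2 \<oplus>\<^bsub>gmod_quot M N\<^esub> C1 = \<zero>\<^bsub>gmod_quot M N\<^esub>"
      using x coset_closed M.a_inv_closed by blast
  qed (auto simp: quot_carrier quot_add quot_zero M.a_ac)
  have mod: "module k (gmod_quot M N)"
    by (rule moduleI[OF R.is_cring ab])
      (auto simp: quot_carrier quot_add quot_smult smult_l_distr smult_r_distr smult_assoc1)
  show ?thesis
    by (intro gmodule.intro[OF G.is_group mod] gmodule_axioms.intro)
      (auto simp: quot_carrier quot_add quot_smult quot_gact gact_add gact_smult gact_mult)
qed

lemma gsubmodule_preimage:
  assumes "gsubmodule k G (gmod_quot M N) A"
  shows "gsubmodule k G M {x \<in> carrier M. cls x \<in> A}" "N \<subseteq> {x \<in> carrier M. cls x \<in> A}"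
proof -
  let ?A = "{x \<in> carrier M. cls x \<in> A}"
  interpret Q: gmodule k G "gmod_quot M N" by (rule gmodule_quot)
  note D = Q.gsubmoduleD[OF assms]
  show "gsubmodule k G M ?A"
  proof (rule gsubmoduleI)
    show "\<zero>\<^bsub>M\<^esub> \<in> ?A" using D(3) quot_zero by simp
  next
    fix a b assume "a \<in> ?A" "b \<in> ?A"
    then show "a \<oplus>\<^bsub>M\<^esub> b \<in> ?A"
      using D(4)[of "cls a" "cls b"] by (simp add: quot_add)
  next
    fix a x assume "a \<in> carrier k" "x \<in> ?A"
    then show "a \<odot>\<^bsub>M\<^esub> x \<in> ?A"
      using D(6)[of a "cls x"] by (simp add: quot_smult)
  next
    fix g x assume "g \<in> carrier G" "x \<in> ?A"
    then show "gact M g x \<in> ?A"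
      using D(7)[of g "cls x"] by (simp add: quot_gact)
  qed auto
  have "cls x = N" if "x \<in> N" for x
    using A.a_rcos_const[OF that] .
  then show "N \<subseteq> ?A"
    using D(3) A.a_subset unfolding gmod_quot_def by auto
qed

text \<open>The lifted components add up to x itself and not only modulo N, so that f can be
  evaluated on the sum.\<close>

lemma decomposition_preimage:
  assumes "direct_decomposition k G (gmod_quot M N) A B" and x: "x \<in> carrier M"
  obtains a b where "a \<in> carrier M" "cls a \<in> A" "b \<in> carrier M" "cls b \<in> B"
    "x = a \<oplus>\<^bsub>M\<^esub> b"
proof -
  interpret Q: gmodule k G "gmod_quot M N" by (rule gmodule_quot)
  have A: "gsubmodule k G (gmod_quot M N) A" and B: "gsubmodule k G (gmod_quot M N) B"
    and sum: "A <+>\<^bsub>gmod_quot M N\<^esub> B = carrier (gmod_quot M N)"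
    using assms unfolding direct_decomposition_def by auto
  have "cls x \<in> A <+>\<^bsub>gmod_quot M N\<^esub> B" using x sum by simp
  then obtain C1 C2 where XY: "C1 \<in> A" "C2 \<in> B" "cls x = C1 \<oplus>\<^bsub>gmod_quot M N\<^esub> C2"
    unfolding set_add_def' by blast
  then obtain a b where ab: "a \<in> carrier M" "C1 = cls a" "b \<in> carrier M" "C2 = cls b"
    using Q.gsubmoduleD(2)[OF A] Q.gsubmoduleD(2)[OF B] unfolding quot_carrier by blast
  have d: "x \<ominus>\<^bsub>M\<^esub> (a \<oplus>\<^bsub>M\<^esub> b) \<in> N" using XY ab x coset_eq_iff by (simp add: quot_add)
  \<comment> \<open>Replacing a by x - b moves the error, an element of N, into the first component
    without changing its class.\<close>
  define c where "c = x \<ominus>\<^bsub>M\<^esub> b"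
  have c: "c \<in> carrier M" using x ab unfolding c_def by simp
  have e: "c \<ominus>\<^bsub>M\<^esub> a = x \<ominus>\<^bsub>M\<^esub> (a \<oplus>\<^bsub>M\<^esub> b)"
    using x ab unfolding c_def a_minus_def by (simp add: M.minus_add M.a_ac)
  have "cls c = C1" using d c ab coset_eq_iff e by simp
  moreover have "x = c \<oplus>\<^bsub>M\<^esub> b"
    using x ab unfolding c_def a_minus_def by (simp add: M.a_assoc M.l_neg)
  ultimately show ?thesis using that ab XY c by blast
qed

end

section \<open>Summands of permutation modules\<close>

lemma (in abelian_group) minus_eq_minusI:
  assumes "x \<oplus> u = y \<oplus> v" "x \<in> carrier G" "y \<in> carrier G" "u \<in> carrier G" "v \<in> carrier G"
  shows "x \<ominus> y = v \<ominus> u"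
proof -
  have "x = (y \<oplus> v) \<ominus> u" using assms unfolding a_minus_def by (simp add: add.inv_solve_right)
  then have "x = y \<oplus> (v \<ominus> u)" using assms unfolding a_minus_def by (simp add: a_assoc)
  then have "\<ominus> y \<oplus> x = v \<ominus> u" using assms r_neg1 by simp
  then show ?thesis using assms unfolding a_minus_def by (simp add: a_comm)
qed

lemma (in abelian_group) minus_eq_zero_iff:
  assumes "x \<in> carrier G" "y \<in> carrier G"
  shows "x \<ominus> y = \<zero> \<longleftrightarrow> x = y"
  using assms unfolding a_minus_def by (metis a_inv_closed minus_equality minus_minus r_neg)

lemma (in module) finsum_smult_rdistr:
  assumes "x \<in> carrier M" "F \<in> I \<rightarrow> carrier R"
  shows "(\<Oplus>i\<in>I. F i) \<odot>\<^bsub>M\<^esub> x = (\<Oplus>\<^bsub>M\<^esub>i\<in>I. F i \<odot>\<^bsub>M\<^esub> x)"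
  using assms(2)
proof (induction I rule: infinite_finite_induct)
  case (insert i I)
  have "F \<in> I \<rightarrow> carrier R" "F i \<in> carrier R" using insert.prems by auto
  then show ?case using insert assms(1) by (simp add: smult_l_distr Pi_def)
qed (use assms in simp_all)

section \<open>The tensor product of kG with a module, and the trivial module\<close>

lemma kG_tensor_apply_closed:
  "\<lbrakk>u \<in> carrier (kG_tensor G N); x \<in> carrier G\<rbrakk> \<Longrightarrow> u x \<in> carrier N"
  by (auto simp: kG_tensor_def)

lemma kG_tensor_eqI:
  assumes "u \<in> carrier (kG_tensor G N)" "v \<in> carrier (kG_tensor G N)"
    and "\<And>x. x \<in> carrier G \<Longrightarrow> u x = v x"
  shows "u = v"
  using assms by (auto simp: kG_tensor_def intro: PiE_ext)

lemma gmodule_kG_tensor: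
  assumes "group G" "module k N"
  shows "gmodule k G (kG_tensor G N)"
proof -
  interpret G: group G by fact
  interpret N: module k N by fact
  let ?V = "kG_tensor G N"
  note c [simp] = kG_tensor_apply_closed[where G = G and N = N]
  have restrict: "(\<lambda>x\<in>carrier G. u x) \<in> carrier ?V"
    if "\<And>x. x \<in> carrier G \<Longrightarrow> u x \<in> carrier N" for u
    using that by (simp add: kG_tensor_def)
  have zero: "\<zero>\<^bsub>?V\<^esub> = (\<lambda>x\<in>carrier G. \<zero>\<^bsub>N\<^esub>)"
    and add: "\<And>u v. u \<oplus>\<^bsub>?V\<^esub> v = (\<lambda>x\<in>carrier G. u x \<oplus>\<^bsub>N\<^esub> v x)"
    and smult: "\<And>a u. a \<odot>\<^bsub>?V\<^esub> u = (\<lambda>x\<in>carrier G. a \<odot>\<^bsub>N\<^esub> u x)"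
    and gact: "\<And>g u. gact ?V g u = (\<lambda>x\<in>carrier G. u (inv\<^bsub>G\<^esub> g \<otimes>\<^bsub>G\<^esub> x))"
    by (simp_all add: kG_tensor_def)
  have ab: "abelian_group ?V"
  proof (rule abelian_groupI)
    fix u assume u: "u \<in> carrier ?V"
    show "\<exists>v\<in>carrier ?V. v \<oplus>\<^bsub>?V\<^esub> u = \<zero>\<^bsub>?V\<^esub>"
    proof
      show "(\<lambda>x\<in>carrier G. \<ominus>\<^bsub>N\<^esub> u x) \<in> carrier ?V" using u by (intro restrict) simp
      show "(\<lambda>x\<in>carrier G. \<ominus>\<^bsub>N\<^esub> u x) \<oplus>\<^bsub>?V\<^esub> u = \<zero>\<^bsub>?V\<^esub>"
        using u by (simp add: add zero N.M.l_neg cong: restrict_cong)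
    qed
    show "\<zero>\<^bsub>?V\<^esub> \<oplus>\<^bsub>?V\<^esub> u = u"
      by (rule kG_tensor_eqI) (use u in \<open>auto simp: add zero restrict\<close>)
  next
    fix u v w assume "u \<in> carrier ?V" "v \<in> carrier ?V" "w \<in> carrier ?V"
    then show "u \<oplus>\<^bsub>?V\<^esub> v \<oplus>\<^bsub>?V\<^esub> w = u \<oplus>\<^bsub>?V\<^esub> (v \<oplus>\<^bsub>?V\<^esub> w)"
      by (simp add: add N.M.a_assoc cong: restrict_cong)
  next
    fix u v assume "u \<in> carrier ?V" "v \<in> carrier ?V"
    then show "u \<oplus>\<^bsub>?V\<^esub> v \<in> carrier ?V" "u \<oplus>\<^bsub>?V\<^esub> v = v \<oplus>\<^bsub>?V\<^esub> u"
      by (simp_all add: add restrict N.M.a_comm cong: restrict_cong)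
  qed (simp add: zero restrict)
  have mod: "module k ?V"
  proof (rule moduleI[OF N.R.is_cring ab])
    fix u assume u: "u \<in> carrier ?V"
    show "\<one>\<^bsub>k\<^esub> \<odot>\<^bsub>?V\<^esub> u = u"
      by (rule kG_tensor_eqI) (use u in \<open>auto simp: smult restrict\<close>)
    fix a assume a: "a \<in> carrier k"
    show "a \<odot>\<^bsub>?V\<^esub> u \<in> carrier ?V" using a u by (simp add: smult restrict)
    show "a \<odot>\<^bsub>?V\<^esub> (u \<oplus>\<^bsub>?V\<^esub> v) = a \<odot>\<^bsub>?V\<^esub> u \<oplus>\<^bsub>?V\<^esub> a \<odot>\<^bsub>?V\<^esub> v" if "v \<in> carrier ?V" for v
      using a u that by (simp add: smult add N.smult_r_distr cong: restrict_cong)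
    fix b assume b: "b \<in> carrier k"
    show "(a \<oplus>\<^bsub>k\<^esub> b) \<odot>\<^bsub>?V\<^esub> u = a \<odot>\<^bsub>?V\<^esub> u \<oplus>\<^bsub>?V\<^esub> b \<odot>\<^bsub>?V\<^esub> u"
      using a b u by (simp add: smult add N.smult_l_distr cong: restrict_cong)
    show "(a \<otimes>\<^bsub>k\<^esub> b) \<odot>\<^bsub>?V\<^esub> u = a \<odot>\<^bsub>?V\<^esub> (b \<odot>\<^bsub>?V\<^esub> u)"
      using a b u by (simp add: smult N.smult_assoc1 cong: restrict_cong)
  qed
  show ?thesis
  proof (intro gmodule.intro[OF G.is_group mod] gmodule_axioms.intro)
    fix u assume u: "u \<in> carrier ?V"
    show "gact ?V \<one>\<^bsub>G\<^esub> u = u"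
      by (rule kG_tensor_eqI) (use u in \<open>auto simp: gact restrict\<close>)
    fix g assume g: "g \<in> carrier G"
    show "gact ?V g u \<in> carrier ?V" using u g by (simp add: gact restrict)
    show "gact ?V g (u \<oplus>\<^bsub>?V\<^esub> v) = gact ?V g u \<oplus>\<^bsub>?V\<^esub> gact ?V g v" for v
      using g by (simp add: gact add cong: restrict_cong)
    show "gact ?V g (a \<odot>\<^bsub>?V\<^esub> u) = a \<odot>\<^bsub>?V\<^esub> gact ?V g u" for a
      using g by (simp add: gact smult cong: restrict_cong)
    show "gact ?V (g \<otimes>\<^bsub>G\<^esub> h) u = gact ?V g (gact ?V h u)" if "h \<in> carrier G" for h
      using g that by (simp add: gact G.inv_mult_group G.m_assoc cong: restrict_cong)
  qed
qed

lemma module_trivial_gmod: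
  assumes "cring k"
  shows "module k (trivial_gmod k)"
proof -
  interpret cring k by fact
  have "abelian_group (trivial_gmod k)"
  proof (rule abelian_groupI)
    fix x assume "x \<in> carrier (trivial_gmod k)"
    then show "\<exists>y\<in>carrier (trivial_gmod k). y \<oplus>\<^bsub>trivial_gmod k\<^esub> x = \<zero>\<^bsub>trivial_gmod k\<^esub>"
      by (intro bexI[of _ "\<ominus>\<^bsub>k\<^esub> x"]) (auto simp: trivial_gmod_def l_neg)
  qed (auto simp: trivial_gmod_def a_ac)
  then show ?thesis
    by (rule moduleI[OF is_cring]) (auto simp: trivial_gmod_def l_distr r_distr m_ac)
qed

text \<open>A G-module is a direct summand of the permutation module on G/P exactly when its identity
  is the relative trace from P to G of a P-endomorphism that factors through the trivial module:
  the vector b and the functional l below are the two halves of that factorisation.\<close>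

locale permutation_summand = K: field k + gmodule k G M + P: subgroup P G
  for k :: "('k, 's) ring_scheme" (structure) and G :: "('g, 'r) monoid_scheme" (structure)
    and M :: "('k, 'm, 'g) gmod" (structure) and P :: "'g set" +
  fixes b :: 'm and l :: "'m \<Rightarrow> 'k"
  assumes finite_G: "finite (carrier G)"
    and b_fixed: "b \<in> fixed_points M P"
    and l_closed [simp]: "x \<in> carrier M \<Longrightarrow> l x \<in> carrier k"
    and l_add: "\<lbrakk>x \<in> carrier M; y \<in> carrier M\<rbrakk> \<Longrightarrow> l (x \<oplus>\<^bsub>M\<^esub> y) = l x \<oplus> l y"
    and l_smult: "\<lbrakk>a \<in> carrier k; x \<in> carrier M\<rbrakk> \<Longrightarrow> l (a \<odot>\<^bsub>M\<^esub> x) = a \<otimes> l x"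
    and l_gact: "\<lbrakk>h \<in> P; x \<in> carrier M\<rbrakk> \<Longrightarrow> l (gact M h x) = l x"
    and reconstruct: "x \<in> carrier M \<Longrightarrow>
      x = (\<Oplus>\<^bsub>M\<^esub>C\<in>lcosets\<^bsub>G\<^esub> P. l (gact M (inv\<^bsub>G\<^esub> (rep C)) x)
            \<odot>\<^bsub>M\<^esub> gact M (rep C) b)"

lemma some_in_lcoset:
  assumes "group G" "subgroup H G" "C \<in> lcosets\<^bsub>G\<^esub> H"
  shows "rep C \<in> C" "rep C \<in> carrier G"
    "C = rep C <#\<^bsub>G\<^esub> H"
proof -
  interpret group G by fact
  interpret H: subgroup H G by fact
  obtain a where a: "a \<in> carrier G" "C = a <#\<^bsub>G\<^esub> H" using assms(3) by (auto simp: LCOSETS_def)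
  show m: "rep C \<in> C" using lcos_self[OF a(1) assms(2)] a(2) by (metis someI)
  then show "rep C \<in> carrier G"
    using H.lcosets_carrier[OF assms(1,3)] by blast
  show "C = rep C <#\<^bsub>G\<^esub> H"
    using l_repr_independence[OF _ a(1) assms(2)] m a(2) by metis
qed

text \<open>The class of 1 tensor 1 generates the induced module U. Its component in the summand A,
  pulled back to M, is b; the coefficient at the trivial coset P, restricted to M, is l. Expanding
  an element of M in the translates of the generator and projecting to A gives the reconstruction
  formula.\<close>

lemma scott_module_presentation:
  fixes k :: "('k, 's) ring_scheme" and G :: "('g, 'r) monoid_scheme"
    and M :: "('k, 'm, 'g) gmod"
  assumes "field k" and "finite (carrier G)" and "subgroup P G" and "is_scott_module k G P M"
  obtains b l where "permutation_summand k G M P b l"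
proof -
  interpret k: field k by fact
  have "fg_gmodule k G M" and
    summand: "is_direct_summand k G M (induced_gmod k G P (trivial_gmod k))"
    using assms(4) unfolding is_scott_module_def by auto
  then interpret M: gmodule k G M by (simp add: fg_gmodule_imp_gmodule)
  interpret P: subgroup P G by fact
  define N :: "('k, 'k, 'g) gmod" where "N = trivial_gmod k"
  have N: "module k N" unfolding N_def by (rule module_trivial_gmod[OF k.is_cring])
  define V where "V = kG_tensor G N"
  define Z where "Z = gspan k G V (balancing_relations G P N)"
  interpret V: gmodule k G V unfolding V_def by (rule gmodule_kG_tensor[OF M.G.is_group N])
  define e where "e = elem_tensor G N"
  have V_carrier: "carrier V = carrier G \<rightarrow>\<^sub>E carrier k"
    by (simp add: V_def N_def kG_tensor_def trivial_gmod_def)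
  have V_add: "(u \<oplus>\<^bsub>V\<^esub> v) x = u x \<oplus>\<^bsub>k\<^esub> v x" if "x \<in> carrier G" for u v x
    using that by (simp add: V_def N_def kG_tensor_def trivial_gmod_def)
  have V_smult: "(a \<odot>\<^bsub>V\<^esub> v) x = a \<otimes>\<^bsub>k\<^esub> v x" if "x \<in> carrier G" for a v x
    using that by (simp add: V_def N_def kG_tensor_def trivial_gmod_def)
  have V_gact: "(gact V g v) x = v (inv\<^bsub>G\<^esub> g \<otimes>\<^bsub>G\<^esub> x)" if "x \<in> carrier G" for g v x
    using that by (simp add: V_def N_def kG_tensor_def trivial_gmod_def)
  have V_zero: "\<zero>\<^bsub>V\<^esub> x = \<zero>\<^bsub>k\<^esub>" if "x \<in> carrier G" for x
    using that by (simp add: V_def N_def kG_tensor_def trivial_gmod_def)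
  have V_val [simp]: "v x \<in> carrier k" if "v \<in> carrier V" "x \<in> carrier G" for v x
    using that unfolding V_carrier by auto
  have V_eqI: "u = v" if "u \<in> carrier V" "v \<in> carrier V" "\<And>x. x \<in> carrier G \<Longrightarrow> u x = v x" for u v
    using that unfolding V_carrier by (auto intro: PiE_ext)
  have e_closed [simp]: "e x c \<in> carrier V" if "c \<in> carrier k" for x c
    using that unfolding V_carrier e_def elem_tensor_def N_def by (auto simp: trivial_gmod_def)
  have e_apply: "e x c y = (if y = x then c else \<zero>\<^bsub>k\<^esub>)" if "y \<in> carrier G" for x c y
    using that unfolding e_def elem_tensor_def N_def by (auto simp: trivial_gmod_def)
  have bal: "balancing_relations G P N =
      {e (x \<otimes>\<^bsub>G\<^esub> h) c \<ominus>\<^bsub>V\<^esub> e x c | x h c. x \<in> carrier G \<and> h \<in> P \<and> c \<in> carrier k}"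
    unfolding balancing_relations_def V_def[symmetric] e_def[symmetric]
    by (simp add: N_def trivial_gmod_def)
  have bal_sub: "balancing_relations G P N \<subseteq> carrier V" unfolding bal by auto
  have Z_sub: "gsubmodule k G V Z" unfolding Z_def by (rule V.gsubmodule_gspan[OF bal_sub])
  interpret Q: gmodule_quotient k G V Z
    by (intro gmodule_quotient.intro V.gmodule_axioms gmodule_quotient_axioms.intro Z_sub)
  define U where "U = gmod_quot V Z"
  interpret U: gmodule k G U unfolding U_def by (rule Q.gmodule_quot)
  have ind: "induced_gmod k G P (trivial_gmod k) = U"
    unfolding induced_gmod_def U_def Z_def V_def N_def ..
  define cl where "cl = (\<lambda>v. Z +>\<^bsub>V\<^esub> v)"
  have cl_closed [simp]: "cl v \<in> carrier U" if "v \<in> carrier V" for v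
    using that unfolding cl_def U_def by simp
  have cl_add: "cl (u \<oplus>\<^bsub>V\<^esub> v) = cl u \<oplus>\<^bsub>U\<^esub> cl v" if "u \<in> carrier V" "v \<in> carrier V" for u v
    using that unfolding cl_def U_def by (simp add: Q.quot_add)
  have cl_smult: "cl (a \<odot>\<^bsub>V\<^esub> v) = a \<odot>\<^bsub>U\<^esub> cl v" if "a \<in> carrier k" "v \<in> carrier V" for a v
    using that unfolding cl_def U_def by (simp add: Q.quot_smult)
  have cl_gact: "cl (gact V g v) = gact U g (cl v)" if "g \<in> carrier G" "v \<in> carrier V" for g v
    using that unfolding cl_def U_def by (simp add: Q.quot_gact)
  have cl_eq: "cl u = cl v \<longleftrightarrow> u \<ominus>\<^bsub>V\<^esub> v \<in> Z" if "u \<in> carrier V" "v \<in> carrier V" for u v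
    using that unfolding cl_def by (simp add: Q.coset_eq_iff)
  have cl_zero: "cl \<zero>\<^bsub>V\<^esub> = \<zero>\<^bsub>U\<^esub>" unfolding cl_def U_def by (simp add: Q.quot_zero)
  have cl_surj: "\<exists>v\<in>carrier V. D = cl v" if "D \<in> carrier U" for D :: "('g \<Rightarrow> 'k) set"
    using that unfolding U_def cl_def Q.quot_carrier by blast

  obtain A B where dec: "direct_decomposition k G U A B" and "gmod_iso k G M (U\<lparr>carrier := A\<rparr>)"
    using summand unfolding ind is_direct_summand_def by blast
  then obtain j where j: "j \<in> gmod_hom k G M (U\<lparr>carrier := A\<rparr>)" and "bij_betw j (carrier M) A"
    unfolding gmod_iso_def by auto
  then have j_inj: "inj_on j (carrier M)" and j_img: "j ` carrier M = A"
    unfolding bij_betw_def by auto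
  have A: "gsubmodule k G U A" and B: "gsubmodule k G U B"
    and AB: "A <+>\<^bsub>U\<^esub> B = carrier U" "A \<inter> B = {\<zero>\<^bsub>U\<^esub>}"
    using dec unfolding direct_decomposition_def by auto
  note DA = U.gsubmoduleD[OF A] and DB = U.gsubmoduleD[OF B]
  have j_add: "j (x \<oplus>\<^bsub>M\<^esub> y) = j x \<oplus>\<^bsub>U\<^esub> j y" if "x \<in> carrier M" "y \<in> carrier M" for x y
    using j that unfolding gmod_hom_def by simp
  have j_smult: "j (a \<odot>\<^bsub>M\<^esub> x) = a \<odot>\<^bsub>U\<^esub> j x" if "a \<in> carrier k" "x \<in> carrier M" for a x
    using j that unfolding gmod_hom_def by simp
  have j_gact: "j (gact M g x) = gact U g (j x)" if "g \<in> carrier G" "x \<in> carrier M" for g x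
    using j that unfolding gmod_hom_def by simp
  have j_A: "j x \<in> A" if "x \<in> carrier M" for x using that j_img by blast
  have j_closed [simp]: "j x \<in> carrier U" if "x \<in> carrier M" for x
    using that j_A DA(2) by blast
  have j_zero: "j \<zero>\<^bsub>M\<^esub> = \<zero>\<^bsub>U\<^esub>"
    using j_smult[of "\<zero>\<^bsub>k\<^esub>" "\<zero>\<^bsub>M\<^esub>"] by simp

  \<comment> \<open>Split the generator 1 tensor 1 along U = A + B; \<open>b\<close> is the preimage
    of its A-component.\<close>
  have "cl (e \<one>\<^bsub>G\<^esub> \<one>\<^bsub>k\<^esub>) \<in> A <+>\<^bsub>U\<^esub> B" using AB by simp
  then obtain \<alpha> \<beta> where \<alpha>: "\<alpha> \<in> A" and \<beta>: "\<beta> \<in> B" and \<alpha>\<beta>: "cl (e \<one>\<^bsub>G\<^esub> \<one>\<^bsub>k\<^esub>) = \<alpha> \<oplus>\<^bsub>U\<^esub> \<beta>"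
    unfolding set_add_def' by blast
  have \<alpha>c [simp]: "\<alpha> \<in> carrier U" and \<beta>c [simp]: "\<beta> \<in> carrier U" using \<alpha> \<beta> DA(2) DB(2) by auto
  obtain b where b [simp]: "b \<in> carrier M" and jb: "j b = \<alpha>" using \<alpha> j_img by blast

  have e_gact: "gact V g (e x c) = e (g \<otimes>\<^bsub>G\<^esub> x) c"
    if "g \<in> carrier G" "x \<in> carrier G" "c \<in> carrier k" for g x c
    by (rule V_eqI) (use that in \<open>auto simp: V_gact e_apply M.G.inv_solve_left'\<close>)
  have e_scale: "e x c = c \<odot>\<^bsub>V\<^esub> e x \<one>\<^bsub>k\<^esub>" if "c \<in> carrier k" for x c
    by (rule V_eqI) (use that in \<open>auto simp: V_smult e_apply\<close>)
  have cl_e: "cl (e x c) = c \<odot>\<^bsub>U\<^esub> (gact U x \<alpha> \<oplus>\<^bsub>U\<^esub> gact U x \<beta>)"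
    if "x \<in> carrier G" "c \<in> carrier k" for x c
  proof -
    have "cl (e x c) = c \<odot>\<^bsub>U\<^esub> gact U x (cl (e \<one>\<^bsub>G\<^esub> \<one>\<^bsub>k\<^esub>))"
      using that e_scale[of c x] e_gact[of x "\<one>\<^bsub>G\<^esub>" "\<one>\<^bsub>k\<^esub>"]
      by (simp add: cl_smult cl_gact[symmetric])
    then show ?thesis using that by (simp add: \<alpha>\<beta> U.gact_add)
  qed
  \<comment> \<open>A-components are unique: x - y = v - u lies in both A and B. All identities in M
    below are read off from identities in U in this way.\<close>
  have AB_eq: "x = y" if "x \<oplus>\<^bsub>U\<^esub> u = y \<oplus>\<^bsub>U\<^esub> v" "x \<in> A" "y \<in> A" "u \<in> B" "v \<in> B" for x y u v
  proof -
    have c: "x \<in> carrier U" "y \<in> carrier U" "u \<in> carrier U" "v \<in> carrier U"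
      using that DA(2) DB(2) by auto
    have "x \<ominus>\<^bsub>U\<^esub> y = v \<ominus>\<^bsub>U\<^esub> u" by (rule U.M.minus_eq_minusI[OF that(1) c])
    then have "x \<ominus>\<^bsub>U\<^esub> y \<in> A \<inter> B" using DA(5)[OF that(2,3)] DB(5)[OF that(5,4)] by simp
    then show ?thesis using AB(2) c by (simp add: U.M.minus_eq_zero_iff)
  qed
  \<comment> \<open>The balancing relation at x = 1 says that h fixes the class of 1 tensor 1;
    compare A-components.\<close>
  have b_fix: "gact M h b = b" if h: "h \<in> P" for h
  proof -
    have hG [simp]: "h \<in> carrier G" using h by (rule P.mem_carrier)
    have "e (\<one>\<^bsub>G\<^esub> \<otimes>\<^bsub>G\<^esub> h) \<one>\<^bsub>k\<^esub> \<ominus>\<^bsub>V\<^esub> e \<one>\<^bsub>G\<^esub> \<one>\<^bsub>k\<^esub> \<in> balancing_relations G P N"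
      unfolding bal using h by blast
    then have "e h \<one>\<^bsub>k\<^esub> \<ominus>\<^bsub>V\<^esub> e \<one>\<^bsub>G\<^esub> \<one>\<^bsub>k\<^esub> \<in> Z"
      using V.gspan_superset[of "balancing_relations G P N"] unfolding Z_def by auto
    then have "cl (e h \<one>\<^bsub>k\<^esub>) = cl (e \<one>\<^bsub>G\<^esub> \<one>\<^bsub>k\<^esub>)" by (simp add: cl_eq)
    then have "gact U h \<alpha> \<oplus>\<^bsub>U\<^esub> gact U h \<beta> = \<alpha> \<oplus>\<^bsub>U\<^esub> \<beta>" by (simp add: cl_e \<alpha>\<beta>)
    then have "gact U h \<alpha> = \<alpha>" using AB_eq DA(7) DB(7) \<alpha> \<beta> by simp
    then have "j (gact M h b) = j b" by (simp add: j_gact jb)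
    then show ?thesis using j_inj by (simp add: inj_on_eq_iff)
  qed

  have cl_expand: "\<exists>\<gamma>\<in>B. cl v = j (\<Oplus>\<^bsub>M\<^esub>x\<in>carrier G. v x \<odot>\<^bsub>M\<^esub> gact M x b) \<oplus>\<^bsub>U\<^esub> \<gamma>"
    if v: "v \<in> carrier V" for v
  proof -
    \<comment> \<open>\<open>r S\<close> is \<open>v\<close> cut off outside S, so the expansion can
      be built up one group element at a time. Only membership in B is recorded for the second
      component.\<close>
    define r where "r = (\<lambda>S. \<lambda>x\<in>carrier G. if x \<in> S then v x else \<zero>\<^bsub>k\<^esub>)"
    have r_closed [simp]: "r S \<in> carrier V" for S
      using v unfolding r_def V_carrier by auto
    have "\<exists>\<gamma>\<in>B. cl (r S) = j (\<Oplus>\<^bsub>M\<^esub>x\<in>S. v x \<odot>\<^bsub>M\<^esub> gact M x b) \<oplus>\<^bsub>U\<^esub> \<gamma>"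
      if "finite S" "S \<subseteq> carrier G" for S
      using that
    proof induction
      case empty
      have "r {} = \<zero>\<^bsub>V\<^esub>" by (rule V_eqI[OF r_closed V.M.zero_closed]) (auto simp: r_def V_zero)
      then show ?case
        using DB(3) by (intro bexI[of _ "\<zero>\<^bsub>U\<^esub>"]) (auto simp: cl_zero j_zero)
    next
      case (insert x S)
      then obtain \<gamma> where \<gamma>: "\<gamma> \<in> B" "cl (r S) = j (\<Oplus>\<^bsub>M\<^esub>x\<in>S. v x \<odot>\<^bsub>M\<^esub> gact M x b) \<oplus>\<^bsub>U\<^esub> \<gamma>"
        by auto
      have x [simp]: "x \<in> carrier G" and S: "S \<subseteq> carrier G" using insert by auto
      have vx [simp]: "v x \<in> carrier k" using v by simp
      have F: "(\<lambda>x. v x \<odot>\<^bsub>M\<^esub> gact M x b) \<in> S \<rightarrow> carrier M" using S v by auto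
      define y where "y = (\<Oplus>\<^bsub>M\<^esub>x\<in>S. v x \<odot>\<^bsub>M\<^esub> gact M x b)"
      have y [simp]: "y \<in> carrier M" unfolding y_def by (rule M.finsum_closed[OF F])
      have \<gamma>c [simp]: "\<gamma> \<in> carrier U" using \<gamma> DB(2) by blast
      have "r (insert x S) = r S \<oplus>\<^bsub>V\<^esub> e x (v x)"
        by (rule V_eqI) (use insert.hyps v in \<open>auto simp: V_add e_apply, auto simp: r_def\<close>)
      then have "cl (r (insert x S))
          = (j y \<oplus>\<^bsub>U\<^esub> \<gamma>) \<oplus>\<^bsub>U\<^esub> v x \<odot>\<^bsub>U\<^esub> (gact U x \<alpha> \<oplus>\<^bsub>U\<^esub> gact U x \<beta>)"
        using \<gamma>(2) by (simp add: cl_add cl_e y_def)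
      also have "\<dots> = j (v x \<odot>\<^bsub>M\<^esub> gact M x b \<oplus>\<^bsub>M\<^esub> y) \<oplus>\<^bsub>U\<^esub> (\<gamma> \<oplus>\<^bsub>U\<^esub> v x \<odot>\<^bsub>U\<^esub> gact U x \<beta>)"
        by (simp add: j_add j_smult j_gact jb U.smult_r_distr U.M.a_ac)
      also have "v x \<odot>\<^bsub>M\<^esub> gact M x b \<oplus>\<^bsub>M\<^esub> y = (\<Oplus>\<^bsub>M\<^esub>x\<in>insert x S. v x \<odot>\<^bsub>M\<^esub> gact M x b)"
        unfolding y_def using insert.hyps F by simp
      finally show ?case
        by (rule bexI) (intro DB(4) DB(6) DB(7) \<gamma>(1) \<beta> x vx)
    qed
    from this[OF assms(2) order_refl]
    have "\<exists>\<gamma>\<in>B. cl (r (carrier G)) = j (\<Oplus>\<^bsub>M\<^esub>x\<in>carrier G. v x \<odot>\<^bsub>M\<^esub> gact M x b) \<oplus>\<^bsub>U\<^esub> \<gamma>" .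
    moreover have "r (carrier G) = v" by (rule V_eqI[OF r_closed v]) (simp add: r_def)
    ultimately show ?thesis by simp
  qed
  \<comment> \<open>\<open>j m\<close> lies in A, so its B-component is zero and only the
    A-component of \<open>cl_expand\<close> remains.\<close>
  have expand: "m = (\<Oplus>\<^bsub>M\<^esub>x\<in>carrier G. v x \<odot>\<^bsub>M\<^esub> gact M x b)"
    if v: "v \<in> carrier V" and m: "m \<in> carrier M" and eq: "cl v = j m" for v m
  proof -
    let ?s = "\<Oplus>\<^bsub>M\<^esub>x\<in>carrier G. v x \<odot>\<^bsub>M\<^esub> gact M x b"
    have s: "?s \<in> carrier M" using v by (intro M.finsum_closed) auto
    obtain \<gamma> where \<gamma>: "\<gamma> \<in> B" "j m = j ?s \<oplus>\<^bsub>U\<^esub> \<gamma>"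
      using cl_expand[OF v] unfolding eq by blast
    then have "j m \<oplus>\<^bsub>U\<^esub> \<zero>\<^bsub>U\<^esub> = j ?s \<oplus>\<^bsub>U\<^esub> \<gamma>"
      using U.M.r_zero[OF j_closed[OF m]] by (blast intro: trans)
    then have "j m = j ?s" by (rule AB_eq) (intro j_A m s DB(3) \<gamma>(1))+
    then show ?thesis using j_inj m s by (simp add: inj_on_eq_iff)
  qed

  \<comment> \<open>The sum of v over the coset xP, that is, the coefficient at xP when the induced
    module is viewed as the permutation module on G/P.\<close>
  define \<nu> where "\<nu> = (\<lambda>x v. \<Oplus>\<^bsub>k\<^esub>h\<in>P. v (x \<otimes>\<^bsub>G\<^esub> h) :: 'k)"
  have \<nu>_fun: "(\<lambda>h. v (x \<otimes>\<^bsub>G\<^esub> h)) \<in> P \<rightarrow> carrier k" if "v \<in> carrier V" "x \<in> carrier G" for v x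
    using that P.mem_carrier by auto
  have \<nu>_closed [simp]: "\<nu> x v \<in> carrier k" if "v \<in> carrier V" "x \<in> carrier G" for v x
    unfolding \<nu>_def by (rule k.finsum_closed[OF \<nu>_fun[OF that]])
  have \<nu>_add: "\<nu> x (u \<oplus>\<^bsub>V\<^esub> v) = \<nu> x u \<oplus>\<^bsub>k\<^esub> \<nu> x v"
    if "u \<in> carrier V" "v \<in> carrier V" "x \<in> carrier G" for u v x
    unfolding \<nu>_def k.finsum_addf[OF \<nu>_fun[OF that(1,3)] \<nu>_fun[OF that(2,3)], symmetric]
    by (rule k.finsum_cong') (use that P.mem_carrier in \<open>auto simp: V_add\<close>)
  have \<nu>_smult: "\<nu> x (a \<odot>\<^bsub>V\<^esub> v) = a \<otimes>\<^bsub>k\<^esub> \<nu> x v"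
    if "a \<in> carrier k" "v \<in> carrier V" "x \<in> carrier G" for a v x
    unfolding \<nu>_def
    using k.finsum_rdistr[OF finite_subset[OF P.subset assms(2)] that(1) \<nu>_fun[OF that(2,3)]]
    by (simp, intro k.finsum_cong') (use that P.mem_carrier in \<open>auto simp: V_smult\<close>)
  have \<nu>_gact: "\<nu> x (gact V g v) = \<nu> (inv\<^bsub>G\<^esub> g \<otimes>\<^bsub>G\<^esub> x) v"
    if "g \<in> carrier G" "v \<in> carrier V" "x \<in> carrier G" for g v x
    unfolding \<nu>_def
    by (rule k.finsum_cong') (use that P.mem_carrier in \<open>auto simp: V_gact M.G.m_assoc\<close>)
  have \<nu>_zero: "\<nu> x \<zero>\<^bsub>V\<^esub> = \<zero>\<^bsub>k\<^esub>" if "x \<in> carrier G" for x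
    using \<nu>_smult[of "\<zero>\<^bsub>k\<^esub>" "\<zero>\<^bsub>V\<^esub>" x] that by simp
  have \<nu>_minus: "\<nu> x (u \<ominus>\<^bsub>V\<^esub> v) = \<nu> x u \<ominus>\<^bsub>k\<^esub> \<nu> x v"
    if "u \<in> carrier V" "v \<in> carrier V" "x \<in> carrier G" for u v x
  proof -
    have "\<ominus>\<^bsub>V\<^esub> v = (\<ominus>\<^bsub>k\<^esub> \<one>\<^bsub>k\<^esub>) \<odot>\<^bsub>V\<^esub> v" using that by (simp add: V.smult_l_minus)
    then have "\<nu> x (\<ominus>\<^bsub>V\<^esub> v) = \<ominus>\<^bsub>k\<^esub> \<nu> x v" using that by (simp add: \<nu>_smult k.l_minus)
    then show ?thesis using that unfolding a_minus_def by (simp add: \<nu>_add)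
  qed
  have \<nu>_e: "\<nu> x (e y c) = (if inv\<^bsub>G\<^esub> x \<otimes>\<^bsub>G\<^esub> y \<in> P then c else \<zero>\<^bsub>k\<^esub>)"
    if "x \<in> carrier G" "y \<in> carrier G" "c \<in> carrier k" for x y c
  proof -
    have eq: "\<nu> x (e y c) = (\<Oplus>\<^bsub>k\<^esub>h\<in>P. if inv\<^bsub>G\<^esub> x \<otimes>\<^bsub>G\<^esub> y = h then c else \<zero>\<^bsub>k\<^esub>)"
      unfolding \<nu>_def
      by (rule k.finsum_cong')
        (use that P.mem_carrier M.G.inv_solve_left' in \<open>auto simp: e_apply\<close>)
    show ?thesis
    proof (cases "inv\<^bsub>G\<^esub> x \<otimes>\<^bsub>G\<^esub> y \<in> P")
      case True
      then show ?thesis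
        using eq k.finsum_singleton[OF True finite_subset[OF P.subset assms(2)], of "\<lambda>_. c"] that
        by simp
    next
      case False
      then have "\<nu> x (e y c) = (\<Oplus>\<^bsub>k\<^esub>h\<in>P. \<zero>\<^bsub>k\<^esub>)"
        unfolding eq by (intro k.finsum_cong') auto
      then show ?thesis using False by simp
    qed
  qed
  have \<nu>_Z: "\<nu> x z = \<zero>\<^bsub>k\<^esub>" if "z \<in> Z" "x \<in> carrier G" for z x
  proof -
    \<comment> \<open>The vanishing is required for all x at once, since G permutes the functionals
      \<open>\<nu> x\<close>; their common kernel is then stable and contains the span Z of the
      relations.\<close>
    have "gsubmodule k G V {v \<in> carrier V. \<forall>x\<in>carrier G. \<nu> x v = \<zero>\<^bsub>k\<^esub>}" (is "gsubmodule k G V ?Z'")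
      by (rule V.gsubmoduleI) (auto simp: \<nu>_add \<nu>_smult \<nu>_gact \<nu>_zero)
    moreover have "balancing_relations G P N \<subseteq> ?Z'"
    proof -
      have "\<nu> y (e (x \<otimes>\<^bsub>G\<^esub> h) c \<ominus>\<^bsub>V\<^esub> e x c) = \<zero>\<^bsub>k\<^esub>"
        if x: "x \<in> carrier G" and h: "h \<in> P" and c: "c \<in> carrier k" and y: "y \<in> carrier G" for x y h c
      proof -
        have hG: "h \<in> carrier G" using h P.mem_carrier by blast
        have "inv\<^bsub>G\<^esub> y \<otimes>\<^bsub>G\<^esub> (x \<otimes>\<^bsub>G\<^esub> h) = (inv\<^bsub>G\<^esub> y \<otimes>\<^bsub>G\<^esub> x) \<otimes>\<^bsub>G\<^esub> h"
          using x y hG by (simp add: M.G.m_assoc)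
        moreover have "(inv\<^bsub>G\<^esub> y \<otimes>\<^bsub>G\<^esub> x) \<otimes>\<^bsub>G\<^esub> h \<in> P \<longleftrightarrow> inv\<^bsub>G\<^esub> y \<otimes>\<^bsub>G\<^esub> x \<in> P"
        proof
          assume "(inv\<^bsub>G\<^esub> y \<otimes>\<^bsub>G\<^esub> x) \<otimes>\<^bsub>G\<^esub> h \<in> P"
          then have "(inv\<^bsub>G\<^esub> y \<otimes>\<^bsub>G\<^esub> x) \<otimes>\<^bsub>G\<^esub> h \<otimes>\<^bsub>G\<^esub> inv\<^bsub>G\<^esub> h \<in> P" using h by blast
          then show "inv\<^bsub>G\<^esub> y \<otimes>\<^bsub>G\<^esub> x \<in> P" using x y hG by (simp add: M.G.m_assoc)
        qed (use h in blast)
        ultimately show ?thesis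
          using x y c hG by (simp add: \<nu>_minus \<nu>_e k.minus_eq k.r_neg)
      qed
      then show ?thesis unfolding bal by auto
    qed
    ultimately have "Z \<subseteq> ?Z'" unfolding Z_def by (rule V.gspan_least)
    then show ?thesis using that by blast
  qed
  \<comment> \<open>The coefficient at the trivial coset, computed on an arbitrary lift;
    \<open>l_eq\<close> shows independence of the lift, as \<open>\<nu>\<close> vanishes on
    Z.\<close>
  define l where "l = (\<lambda>m. \<nu> \<one>\<^bsub>G\<^esub> (SOME v. v \<in> carrier V \<and> cl v = j m))"
  have lift: "\<exists>v. v \<in> carrier V \<and> cl v = j m" if "m \<in> carrier M" for m
    using cl_surj[of "j m"] that by auto
  have l_eq: "l m = \<nu> \<one>\<^bsub>G\<^esub> v" if "m \<in> carrier M" "v \<in> carrier V" "cl v = j m" for m v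
  proof -
    let ?w = "SOME v. v \<in> carrier V \<and> cl v = j m"
    have w: "?w \<in> carrier V" "cl ?w = j m" using someI_ex[OF lift[OF that(1)]] by auto
    then have "?w \<ominus>\<^bsub>V\<^esub> v \<in> Z" using cl_eq[OF w(1) that(2)] that(3) by simp
    then have "\<nu> \<one>\<^bsub>G\<^esub> ?w \<ominus>\<^bsub>k\<^esub> \<nu> \<one>\<^bsub>G\<^esub> v = \<zero>\<^bsub>k\<^esub>"
      using \<nu>_Z[of "?w \<ominus>\<^bsub>V\<^esub> v" "\<one>\<^bsub>G\<^esub>"] \<nu>_minus[OF w(1) that(2)] by (simp del: k.r_right_minus_eq)
    then show ?thesis using w that unfolding l_def by simp
  qed
  have l_gact: "l (gact M g m) = \<nu> (inv\<^bsub>G\<^esub> g) v"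
    if "g \<in> carrier G" "m \<in> carrier M" "v \<in> carrier V" "cl v = j m" for g m v
    using that l_eq[of "gact M g m" "gact V g v"] by (simp add: cl_gact j_gact \<nu>_gact)

  have "permutation_summand k G M P b l"
  proof (intro permutation_summand.intro permutation_summand_axioms.intro assms(1-3) M.gmodule_axioms)
    show "b \<in> fixed_points M P" unfolding fixed_points_def using b_fix by simp
  next
    fix x assume x: "x \<in> carrier M"
    obtain v where v: "v \<in> carrier V" "cl v = j x" using lift[OF x] by blast
    show "l x \<in> carrier k" using l_eq[OF x v] v by simp
    show "l (a \<odot>\<^bsub>M\<^esub> x) = a \<otimes>\<^bsub>k\<^esub> l x" if "a \<in> carrier k" for a
      using l_eq[of "a \<odot>\<^bsub>M\<^esub> x" "a \<odot>\<^bsub>V\<^esub> v"] l_eq[OF x v] v x that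
      by (simp add: \<nu>_smult cl_smult j_smult)
    show "l (x \<oplus>\<^bsub>M\<^esub> y) = l x \<oplus>\<^bsub>k\<^esub> l y" if y: "y \<in> carrier M" for y
    proof -
      obtain w where w: "w \<in> carrier V" "cl w = j y" using lift[OF y] by blast
      show ?thesis
        using l_eq[of "x \<oplus>\<^bsub>M\<^esub> y" "v \<oplus>\<^bsub>V\<^esub> w"] l_eq[OF x v] l_eq[OF y w] v w x y
        by (simp add: \<nu>_add cl_add j_add)
    qed
    \<comment> \<open>Both sides are sums of v over P, the left one reindexed by multiplication with
      the inverse of h.\<close>
    show "l (gact M h x) = l x" if h: "h \<in> P" for h
    proof -
      have hG: "h \<in> carrier G" using h P.mem_carrier by blast
      have "inj_on (\<lambda>h'. inv\<^bsub>G\<^esub> h \<otimes>\<^bsub>G\<^esub> h') P"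
        using hG P.subset by (auto intro!: inj_onI simp: subset_iff)
      moreover have "(\<lambda>h'. inv\<^bsub>G\<^esub> h \<otimes>\<^bsub>G\<^esub> h') ` P = P"
      proof (intro equalityI subsetI)
        fix y assume y: "y \<in> P"
        then have "y = inv\<^bsub>G\<^esub> h \<otimes>\<^bsub>G\<^esub> (h \<otimes>\<^bsub>G\<^esub> y)" "h \<otimes>\<^bsub>G\<^esub> y \<in> P"
          using hG P.mem_carrier[OF y] h by (simp_all add: M.G.m_assoc[symmetric])
        then show "y \<in> (\<lambda>h'. inv\<^bsub>G\<^esub> h \<otimes>\<^bsub>G\<^esub> h') ` P" by (rule image_eqI)
      next
        fix y assume "y \<in> (\<lambda>h'. inv\<^bsub>G\<^esub> h \<otimes>\<^bsub>G\<^esub> h') ` P"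
        then obtain h' where "h' \<in> P" "y = inv\<^bsub>G\<^esub> h \<otimes>\<^bsub>G\<^esub> h'" by (rule imageE)
        then show "y \<in> P" using P.m_closed[OF P.m_inv_closed[OF h]] by simp
      qed
      moreover have "v \<in> P \<rightarrow> carrier k" by (intro funcsetI V_val v(1) P.mem_carrier)
      ultimately have "(\<Oplus>\<^bsub>k\<^esub>h'\<in>P. v h') = (\<Oplus>\<^bsub>k\<^esub>h'\<in>P. v (inv\<^bsub>G\<^esub> h \<otimes>\<^bsub>G\<^esub> h'))"
        using k.finsum_reindex[of v "\<lambda>h'. inv\<^bsub>G\<^esub> h \<otimes>\<^bsub>G\<^esub> h'" P] by metis
      moreover have "(\<Oplus>\<^bsub>k\<^esub>h'\<in>P. v h') = (\<Oplus>\<^bsub>k\<^esub>h'\<in>P. v (\<one>\<^bsub>G\<^esub> \<otimes>\<^bsub>G\<^esub> h'))"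
        by (rule k.finsum_cong') (simp_all add: v(1) P.mem_carrier)
      ultimately have "\<nu> \<one>\<^bsub>G\<^esub> v = \<nu> (inv\<^bsub>G\<^esub> h) v" unfolding \<nu>_def by simp
      then show ?thesis using l_eq[OF x v] l_gact[OF hG x v] by simp
    qed
    show "x = (\<Oplus>\<^bsub>M\<^esub>C\<in>lcosets\<^bsub>G\<^esub> P. l (gact M (inv\<^bsub>G\<^esub> (rep C)) x)
            \<odot>\<^bsub>M\<^esub> gact M (rep C) b)"
    proof -
      \<comment> \<open>Group the sum over G by left cosets. On gP the vector factor is constantly g
        b, as P fixes b, and the scalars add up to \<open>\<nu> g v\<close>, which is l at the
        translate of x by the inverse of g.\<close>
      let ?F = "\<lambda>x. v x \<odot>\<^bsub>M\<^esub> gact M x b"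
      have parts: "\<Union>(lcosets\<^bsub>G\<^esub> P) = carrier G" by (rule M.G.lcosets_part_G[OF assms(3)])
      have subG: "C \<subseteq> carrier G" if "C \<in> lcosets\<^bsub>G\<^esub> P" for C using that parts by blast
      have F: "?F \<in> C \<rightarrow> carrier M" if "C \<in> lcosets\<^bsub>G\<^esub> P" for C
        using subG[OF that] v by auto
      have fin: "finite (lcosets\<^bsub>G\<^esub> P)"
        using finite_subset[OF M.G.lcosets_subset_PowG[OF assms(3)]] assms(2) by simp
      have "x = (\<Oplus>\<^bsub>M\<^esub>x\<in>\<Union>(lcosets\<^bsub>G\<^esub> P). ?F x)" unfolding parts by (rule expand[OF v(1) x v(2)])
      also have "\<dots> = (\<Oplus>\<^bsub>M\<^esub>C\<in>lcosets\<^bsub>G\<^esub> P. \<Oplus>\<^bsub>M\<^esub>x\<in>C. ?F x)"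
      proof (rule M.M.add.finprod_Union_disjoint[OF fin])
        show "finite C \<and> (\<forall>x\<in>C. ?F x \<in> carrier M)" if "C \<in> lcosets\<^bsub>G\<^esub> P" for C
          using F[OF that] finite_subset[OF subG[OF that] assms(2)] by blast
        show "pairwise disjnt (lcosets\<^bsub>G\<^esub> P)"
          using M.G.lcos_disjoint[OF assms(3)] by (auto simp: pairwise_def disjnt_def)
      qed
      also have "\<dots> = (\<Oplus>\<^bsub>M\<^esub>C\<in>lcosets\<^bsub>G\<^esub> P. l (gact M (inv\<^bsub>G\<^esub> (rep C)) x)
            \<odot>\<^bsub>M\<^esub> gact M (rep C) b)"
      proof (rule M.M.finsum_cong')
        fix C assume C: "C \<in> lcosets\<^bsub>G\<^esub> P"
        define g where "g = rep C"
        have g [simp]: "g \<in> carrier G" and Cg: "C = g <#\<^bsub>G\<^esub> P"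
          using some_in_lcoset[OF M.G.is_group assms(3) C] unfolding g_def by auto
        have img: "C = (\<lambda>h. g \<otimes>\<^bsub>G\<^esub> h) ` P" unfolding Cg l_coset_def by auto
        have inj: "inj_on (\<lambda>h. g \<otimes>\<^bsub>G\<^esub> h) P"
          using P.subset by (auto intro!: inj_onI simp: subset_iff)
        have "(\<Oplus>\<^bsub>M\<^esub>x\<in>C. ?F x) = (\<Oplus>\<^bsub>M\<^esub>h\<in>P. ?F (g \<otimes>\<^bsub>G\<^esub> h))"
          unfolding img by (rule M.M.finsum_reindex[OF _ inj]) (use F[OF C] img in auto)
        also have "\<dots> = (\<Oplus>\<^bsub>M\<^esub>h\<in>P. v (g \<otimes>\<^bsub>G\<^esub> h) \<odot>\<^bsub>M\<^esub> gact M g b)"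
          by (rule M.M.finsum_cong')
            (use v P.mem_carrier in \<open>auto simp: M.gact_mult b_fix\<close>)
        also have "\<dots> = \<nu> g v \<odot>\<^bsub>M\<^esub> gact M g b"
          unfolding \<nu>_def by (rule M.finsum_smult_rdistr[symmetric]) (use \<nu>_fun v in auto)
        also have "\<nu> g v = l (gact M (inv\<^bsub>G\<^esub> g) x)" using l_gact[of "inv\<^bsub>G\<^esub> g" x v] x v by simp
        finally show "(\<Oplus>\<^bsub>M\<^esub>x\<in>C. ?F x) = l (gact M (inv\<^bsub>G\<^esub> (rep C)) x)
            \<odot>\<^bsub>M\<^esub> gact M (rep C) b" unfolding g_def .
      next
        show "(\<lambda>C. l (gact M (inv\<^bsub>G\<^esub> (rep C)) x) \<odot>\<^bsub>M\<^esub> gact M (rep C) b)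
            \<in> lcosets\<^bsub>G\<^esub> P \<rightarrow> carrier M"
        proof
          fix C assume C: "C \<in> lcosets\<^bsub>G\<^esub> P"
          define g where "g = rep C"
          have g [simp]: "g \<in> carrier G"
            using some_in_lcoset[OF M.G.is_group assms(3) C] unfolding g_def by auto
          have "l (gact M (inv\<^bsub>G\<^esub> g) x) \<in> carrier k"
            using l_gact[of "inv\<^bsub>G\<^esub> g" x v] x v by simp
          then show "l (gact M (inv\<^bsub>G\<^esub> (rep C)) x) \<odot>\<^bsub>M\<^esub> gact M (rep C) b \<in> carrier M"
            unfolding g_def[symmetric] by simp
        qed
      qed simp
      finally show ?thesis .
    qed
  qed
  then show thesis by (rule that)
qed

section \<open>Additive maps on finite sums, and a rank function for subspaces\<close>

lemma finsum_additive:
  fixes A (structure) and B (structure)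
  assumes "abelian_group A" "abelian_group B"
    and "\<And>x. x \<in> carrier A \<Longrightarrow> h x \<in> carrier B"
    and "\<And>x y. \<lbrakk>x \<in> carrier A; y \<in> carrier A\<rbrakk> \<Longrightarrow> h (x \<oplus>\<^bsub>A\<^esub> y) = h x \<oplus>\<^bsub>B\<^esub> h y"
    and "F \<in> I \<rightarrow> carrier A"
  shows "h (\<Oplus>\<^bsub>A\<^esub>i\<in>I. F i) = (\<Oplus>\<^bsub>B\<^esub>i\<in>I. h (F i))"
proof -
  interpret A: abelian_group A by fact
  interpret B: abelian_group B by fact
  have "h \<zero>\<^bsub>A\<^esub> \<oplus>\<^bsub>B\<^esub> h \<zero>\<^bsub>A\<^esub> = h \<zero>\<^bsub>A\<^esub>" using assms(4)[of "\<zero>\<^bsub>A\<^esub>" "\<zero>\<^bsub>A\<^esub>"] by simp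
  then have h0: "h \<zero>\<^bsub>A\<^esub> = \<zero>\<^bsub>B\<^esub>"
    using B.add.r_cancel_one'[of "h \<zero>\<^bsub>A\<^esub>" "h \<zero>\<^bsub>A\<^esub>"] assms(3)[of "\<zero>\<^bsub>A\<^esub>"] by simp
  show ?thesis using assms(5)
  proof (induction I rule: infinite_finite_induct)
    case (insert i I)
    have "F \<in> I \<rightarrow> carrier A" "F i \<in> carrier A" "(\<lambda>i. h (F i)) \<in> I \<rightarrow> carrier B"
      "h (F i) \<in> carrier B"
      using insert.prems assms(3) by auto
    then show ?case using insert assms(4) by simp
  qed (simp_all add: h0)
qed

text \<open>The rank of a subspace counts the possible positions of the leading coordinate of its
  elements.\<close>

lemma (in module) submodule_rank:
  fixes c :: "nat \<Rightarrow> 'c \<Rightarrow> 'a" and n :: nat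
  assumes "field R"
    and cc: "\<And>i x. x \<in> carrier M \<Longrightarrow> c i x \<in> carrier R"
    and cadd: "\<And>i x y. \<lbrakk>x \<in> carrier M; y \<in> carrier M\<rbrakk> \<Longrightarrow> c i (x \<oplus>\<^bsub>M\<^esub> y) = c i x \<oplus> c i y"
    and csm: "\<And>i a x. \<lbrakk>a \<in> carrier R; x \<in> carrier M\<rbrakk> \<Longrightarrow> c i (a \<odot>\<^bsub>M\<^esub> x) = a \<otimes> c i x"
    and inj: "\<And>x. \<lbrakk>x \<in> carrier M; \<And>i. i < n \<Longrightarrow> c i x = \<zero>\<rbrakk> \<Longrightarrow> x = \<zero>\<^bsub>M\<^esub>"
  shows "\<exists>rk :: 'c set \<Rightarrow> nat. (\<forall>A. rk A \<le> n) \<and>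
    (\<forall>A B. submodule A R M \<longrightarrow> submodule B R M \<longrightarrow> A \<subset> B \<longrightarrow> rk A < rk B)"
proof -
  interpret R: field R by fact
  \<comment> \<open>The pivot positions of an echelon form of A: i counts if A has an element whose
    first nonzero coordinate is at i, normalised to one.\<close>
  define lead where "lead = (\<lambda>A. {i. i < n \<and> (\<exists>a\<in>A. c i a = \<one> \<and> (\<forall>j<i. c j a = \<zero>))})"
  have fin: "finite (lead A)" and le: "card (lead A) \<le> n" for A
  proof -
    have "lead A \<subseteq> {..<n}" unfolding lead_def by auto
    then show "finite (lead A)" "card (lead A) \<le> n"
      using finite_subset card_mono[of "{..<n}" "lead A"] by auto
  qed
  have mono: "lead A \<subseteq> lead B" if "A \<subseteq> B" for A B using that unfolding lead_def by blast
  have eq: "B \<subseteq> A" if A: "submodule A R M" and B: "submodule B R M" and "A \<subseteq> B"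
    and leadeq: "lead A = lead B" for A B
  proof -
    note sA = submoduleE[OF A] and sB = submoduleE[OF B]
    \<comment> \<open>Downward induction on the number of vanishing leading coordinates. For i = n
      the element is zero because the coordinates separate points; i = 0 is the claim.\<close>
    have "\<forall>x\<in>B. (\<forall>j<i. c j x = \<zero>) \<longrightarrow> x \<in> A" if "i \<le> n" for i
      using that
    proof (induction rule: inc_induct)
      case base
      have "x = \<zero>\<^bsub>M\<^esub>" if "x \<in> B" "\<forall>j<n. c j x = \<zero>" for x using inj that sB(1) by blast
      then show ?case using submodule_zero[OF A] by blast
    next
      case (step i)
      show ?case
      proof (intro ballI impI)
        fix x assume x: "x \<in> B" and z: "\<forall>j<i. c j x = \<zero>"
        have xc: "x \<in> carrier M" using x sB(1) by blast
        show "x \<in> A"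
        proof (cases "c i x = \<zero>")
          case True
          then have "\<forall>j<Suc i. c j x = \<zero>" using z less_Suc_eq by auto
          then show ?thesis using step.IH x by blast
        next
          case False
          let ?d = "inv c i x"
          have u: "c i x \<in> Units R" using False cc[OF xc] R.field_Units by blast
          then have d: "?d \<in> carrier R" "?d \<otimes> c i x = \<one>" by auto
          have "?d \<odot>\<^bsub>M\<^esub> x \<in> B" using sB(4) d x by blast
          moreover have "c i (?d \<odot>\<^bsub>M\<^esub> x) = \<one>" using d xc by (simp add: csm)
          moreover have "\<forall>j<i. c j (?d \<odot>\<^bsub>M\<^esub> x) = \<zero>" using d xc z by (simp add: csm)
          ultimately have "i \<in> lead B" unfolding lead_def using step.hyps by blast
          then have "i \<in> lead A" using leadeq by simp
          then obtain a where a: "a \<in> A" "c i a = \<one>" "\<forall>j<i. c j a = \<zero>"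
            unfolding lead_def by blast
          have ac: "a \<in> carrier M" using a(1) sA(1) by blast
          let ?a = "c i x \<odot>\<^bsub>M\<^esub> a"
          have aA: "?a \<in> A" using sA(4) a(1) cc[OF xc] by blast
          have acc: "?a \<in> carrier M" using ac cc[OF xc] by simp
          \<comment> \<open>Gaussian elimination: subtracting a multiple of the pivot vector
            \<open>a\<close> of A clears coordinate i and keeps the earlier ones zero.\<close>
          let ?y = "x \<oplus>\<^bsub>M\<^esub> (\<ominus> \<one>) \<odot>\<^bsub>M\<^esub> ?a"
          have yB: "?y \<in> B" using sB(4,5) x aA \<open>A \<subseteq> B\<close> by blast
          have cy: "c j ?y = c j x \<oplus> (\<ominus> \<one>) \<otimes> (c i x \<otimes> c j a)" for j
            using xc ac acc cc[OF xc] by (simp add: cadd csm)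
          have "c j ?y = \<zero>" if "j < Suc i" for j
          proof (cases "j = i")
            case True
            then show ?thesis unfolding cy using a(2) cc[OF xc] by (simp add: R.l_minus R.r_neg)
          next
            case False
            then have "j < i" using that by simp
            then show ?thesis unfolding cy using a(3) z cc[OF xc] by simp
          qed
          then have "?y \<in> A" using step.IH yB by blast
          then have "?y \<oplus>\<^bsub>M\<^esub> ?a \<in> A" using aA sA(5) by blast
          moreover have "?y \<oplus>\<^bsub>M\<^esub> ?a = x"
            using xc acc by (simp add: smult_l_minus M.a_assoc M.l_neg)
          ultimately show ?thesis by simp
        qed
      qed
    qed
    from this[of 0] show ?thesis by auto
  qed
  have "card (lead A) < card (lead B)"
    if "submodule A R M" "submodule B R M" "A \<subset> B" for A B
    using that eq[of A B] mono[of A B] fin psubset_card_mono[of "lead B" "lead A"] by blast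
  then show ?thesis using le by (intro exI[of _ "\<lambda>A. card (lead A)"]) blast
qed

section \<open>Translation of left cosets\<close>

lemma (in group) lcoset_translate:
  assumes "subgroup H G" "C \<in> lcosets H" "g \<in> carrier G"
  shows "g <# C \<in> lcosets H"
proof -
  obtain a where a: "a \<in> carrier G" "C = a <# H" using assms(2) by (auto simp: LCOSETS_def)
  then have "g <# C = (g \<otimes> a) <# H"
    using assms(1,3) by (simp add: lcos_m_assoc subgroup.subset)
  then show ?thesis using a assms(3) by (auto simp: LCOSETS_def)
qed

lemma (in group) lcoset_subset:
  assumes "subgroup H G" "C \<in> lcosets H"
  shows "C \<subseteq> carrier G"
  using subgroup.lcosets_carrier[OF assms(1) _ assms(2)] is_group by blast

lemma (in group) bij_betw_lcoset_translate:
  assumes "subgroup H G" "g \<in> carrier G"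
  shows "bij_betw (\<lambda>C. g <# C) (lcosets H) (lcosets H)"
proof (rule bij_betwI[where g = "\<lambda>C. inv g <# C"])
  fix C assume C: "C \<in> lcosets H"
  have "C \<subseteq> carrier G" by (rule lcoset_subset[OF assms(1) C])
  then show "inv g <# (g <# C) = C" "g <# (inv g <# C) = C"
    using assms(2) by (simp_all add: lcos_m_assoc lcos_mult_one)
qed (use assms lcoset_translate in auto)

lemma (in group) lcoset_memD:
  assumes "subgroup H G" "C \<in> lcosets H" "g \<in> C" "g' \<in> C"
  obtains h where "h \<in> H" "g' = g \<otimes> h"
proof -
  interpret H: subgroup H G by fact
  obtain a where a: "a \<in> carrier G" "C = a <# H" using assms(2) by (auto simp: LCOSETS_def)
  obtain h h' where h: "h \<in> H" "g = a \<otimes> h" and h': "h' \<in> H" "g' = a \<otimes> h'"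
    using assms(3,4) a(2) unfolding l_coset_def by auto
  have "g' = g \<otimes> (inv h \<otimes> h')"
    using a(1) h h' by (simp add: m_assoc inv_solve_left' H.mem_carrier) (simp add: m_assoc[symmetric] H.mem_carrier)
  moreover have "inv h \<otimes> h' \<in> H" using h h' by blast
  ultimately show thesis using that by blast
qed

context permutation_summand
begin

abbreviation "cosets \<equiv> lcosets\<^bsub>G\<^esub> P"

lemma finite_cosets: "finite cosets"
  using finite_subset[OF G.lcosets_subset_PowG[OF P.subgroup_axioms]] finite_G by simp

lemma coset_rep:
  assumes "C \<in> cosets"
  shows "rep C \<in> C" "rep C \<in> carrier G"
  using some_in_lcoset[OF G.is_group P.subgroup_axioms assms] by auto

text \<open>The term of the reconstruction formula at C, with b replaced by a free vector u. It is
  independent of the representative only for P-fixed u.\<close>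

definition summand :: "'m \<Rightarrow> 'm \<Rightarrow> 'g set \<Rightarrow> 'm" where
  "summand u x C = l (gact M (inv\<^bsub>G\<^esub> (rep C)) x) \<odot>\<^bsub>M\<^esub> gact M (rep C) u"

text \<open>Passing from g to gh with h in P changes neither the scalar, by invariance of l, nor the
  vector, as h fixes u.\<close>

lemma summand_eq:
  assumes "u \<in> fixed_points M P" "x \<in> carrier M" "C \<in> cosets" "g \<in> C"
  shows "summand u x C = l (gact M (inv\<^bsub>G\<^esub> g) x) \<odot>\<^bsub>M\<^esub> gact M g u"
proof -
  define r where "r = rep C"
  have r: "r \<in> C" "r \<in> carrier G" using coset_rep[OF assms(3)] unfolding r_def by auto
  obtain h where h: "h \<in> P" "r = g \<otimes>\<^bsub>G\<^esub> h"
    using G.lcoset_memD[OF P.subgroup_axioms assms(3,4) r(1)] .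
  have g: "g \<in> carrier G" using G.lcoset_subset[OF P.subgroup_axioms assms(3)] assms(4) by blast
  have hG: "h \<in> carrier G" using h(1) by (rule P.mem_carrier)
  have u: "u \<in> carrier M" "gact M h u = u" using assms(1) h(1) unfolding fixed_points_def by auto
  have "gact M (inv\<^bsub>G\<^esub> r) x = gact M (inv\<^bsub>G\<^esub> h) (gact M (inv\<^bsub>G\<^esub> g) x)"
    unfolding h(2) using g hG assms(2) by (simp add: G.inv_mult_group gact_mult)
  then have "l (gact M (inv\<^bsub>G\<^esub> r) x) = l (gact M (inv\<^bsub>G\<^esub> g) x)"
    using l_gact[OF P.m_inv_closed[OF h(1)]] g assms(2) by simp
  moreover have "gact M r u = gact M g u" unfolding h(2) using g hG u by (simp add: gact_mult)
  ultimately show ?thesis unfolding summand_def r_def[symmetric] by simp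
qed

lemma summand_closed [simp]:
  "\<lbrakk>u \<in> carrier M; x \<in> carrier M; C \<in> cosets\<rbrakk> \<Longrightarrow> summand u x C \<in> carrier M"
  unfolding summand_def using coset_rep by simp

text \<open>G moves the terms along the cosets. This yields the equivariance of
  \<open>extend\<close>, and for P-fixed x it identifies the terms along a P-orbit as translates of
  one another.\<close>

lemma gact_summand:
  assumes "u \<in> fixed_points M P" "x \<in> carrier M" "C \<in> cosets" "g \<in> carrier G"
  shows "gact M g (summand u x C) = summand u (gact M g x) (g <#\<^bsub>G\<^esub> C)"
proof -
  define r where "r = rep C"
  have r: "r \<in> C" "r \<in> carrier G" using coset_rep[OF assms(3)] unfolding r_def by auto
  have u: "u \<in> carrier M" using assms(1) unfolding fixed_points_def by simp
  have gr: "g \<otimes>\<^bsub>G\<^esub> r \<in> g <#\<^bsub>G\<^esub> C" using r(1) unfolding l_coset_def by blast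
  have "gact M g (summand u x C) = l (gact M (inv\<^bsub>G\<^esub> r) x) \<odot>\<^bsub>M\<^esub> gact M (g \<otimes>\<^bsub>G\<^esub> r) u"
    unfolding summand_def r_def[symmetric] using r u assms by (simp add: gact_smult gact_mult)
  also have "gact M (inv\<^bsub>G\<^esub> r) x = gact M (inv\<^bsub>G\<^esub> (g \<otimes>\<^bsub>G\<^esub> r)) (gact M g x)"
    using r u assms by (simp add: G.inv_mult_group gact_mult)
  finally show ?thesis
    using summand_eq[OF assms(1) _ G.lcoset_translate[OF P.subgroup_axioms assms(3,4)] gr, of "gact M g x"]
      assms by simp
qed

lemma reconstruct': "x \<in> carrier M \<Longrightarrow> x = (\<Oplus>\<^bsub>M\<^esub>C\<in>cosets. summand b x C)"
  unfolding summand_def by (rule reconstruct)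

text \<open>The relative trace from P to G of x \<mapsto> l(x) u, or equivalently the inclusion of M
  into the permutation module on G/P followed by the homomorphism that sends the coset P to u. For u
  = b it is the identity.\<close>

definition extend :: "'m \<Rightarrow> 'm \<Rightarrow> 'm" where
  "extend u x = (\<Oplus>\<^bsub>M\<^esub>C\<in>cosets. summand u x C)"

lemma extend_hom:
  assumes "u \<in> fixed_points M P"
  shows "extend u \<in> gmod_hom k G M M"
proof -
  have u: "u \<in> carrier M" using assms unfolding fixed_points_def by simp
  have F: "summand u x \<in> cosets \<rightarrow> carrier M" if "x \<in> carrier M" for x using u that by simp
  have "extend u (x \<oplus>\<^bsub>M\<^esub> y) = extend u x \<oplus>\<^bsub>M\<^esub> extend u y"
    if "x \<in> carrier M" "y \<in> carrier M" for x y
    unfolding extend_def M.finsum_addf[OF F[OF that(1)] F[OF that(2)], symmetric]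
    by (rule M.finsum_cong')
      (use that u coset_rep in \<open>simp_all add: summand_def gact_add l_add smult_l_distr\<close>)
  moreover have "extend u (a \<odot>\<^bsub>M\<^esub> x) = a \<odot>\<^bsub>M\<^esub> extend u x"
    if "a \<in> carrier k" "x \<in> carrier M" for a x
    unfolding extend_def finsum_smult_ldistr[OF finite_cosets that(1) F[OF that(2)]]
    by (rule M.finsum_cong')
      (use that u coset_rep in \<open>simp_all add: summand_def gact_smult l_smult smult_assoc1\<close>)
  moreover have "extend u (gact M g x) = gact M g (extend u x)"
    if "g \<in> carrier G" "x \<in> carrier M" for g x
  proof -
    note bij = G.bij_betw_lcoset_translate[OF P.subgroup_axioms that(1)]
    have "gact M g (extend u x) = (\<Oplus>\<^bsub>M\<^esub>C\<in>cosets. gact M g (summand u x C))"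
      unfolding extend_def by (rule gact_finsum[OF that(1) F[OF that(2)]])
    also have "\<dots> = (\<Oplus>\<^bsub>M\<^esub>C\<in>cosets. summand u (gact M g x) (g <#\<^bsub>G\<^esub> C))"
      by (rule M.finsum_cong')
        (use that assms u G.lcoset_translate[OF P.subgroup_axioms] in \<open>simp_all add: gact_summand\<close>)
    also have "\<dots> = (\<Oplus>\<^bsub>M\<^esub>C\<in>(\<lambda>C. g <#\<^bsub>G\<^esub> C) ` cosets. summand u (gact M g x) C)"
      by (rule M.finsum_reindex[symmetric])
        (use bij F that in \<open>simp_all add: bij_betw_def\<close>)
    also have "(\<lambda>C. g <#\<^bsub>G\<^esub> C) ` cosets = cosets" using bij by (simp add: bij_betw_def)
    finally show ?thesis unfolding extend_def by simp
  qed
  moreover have "extend u \<in> carrier M \<rightarrow> carrier M"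
    unfolding extend_def using F by (auto intro: M.finsum_closed)
  ultimately show ?thesis unfolding gmod_hom_def by blast
qed

text \<open>If l vanishes on the translates of x by all inverse coset representatives, every term of
  the reconstruction of x is zero. These finitely many functionals are thus separating coordinates,
  as \<open>submodule_rank\<close> requires.\<close>

lemma rank_exists:
  "\<exists>(rk :: 'm set \<Rightarrow> nat) n. (\<forall>A. rk A \<le> n) \<and>
    (\<forall>A B. submodule A k M \<longrightarrow> submodule B k M \<longrightarrow> A \<subset> B \<longrightarrow> rk A < rk B)"
proof -
  obtain Cs where Cs: "set Cs = cosets" using finite_list[OF finite_cosets] by blast
  \<comment> \<open>\<open>submodule_rank\<close> takes coordinates indexed by all natural numbers;
    beyond the list any group element serves, and the unit is chosen.\<close>
  define r where "r = (\<lambda>i. if i < length Cs then (rep (Cs ! i)) else \<one>\<^bsub>G\<^esub>)"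
  have r [simp]: "r i \<in> carrier G" for i
    unfolding r_def using coset_rep(2) Cs nth_mem by auto
  have "x = \<zero>\<^bsub>M\<^esub>" if x: "x \<in> carrier M"
    and z: "\<And>i. i < length Cs \<Longrightarrow> l (gact M (inv\<^bsub>G\<^esub> (r i)) x) = \<zero>" for x
  proof -
    have "summand b x C = \<zero>\<^bsub>M\<^esub>" if C: "C \<in> cosets" for C
    proof -
      obtain i where "i < length Cs" "C = Cs ! i" using C Cs by (metis in_set_conv_nth)
      then show ?thesis
        using z coset_rep[OF C] b_fixed unfolding summand_def r_def fixed_points_def by auto
    qed
    then have "(\<Oplus>\<^bsub>M\<^esub>C\<in>cosets. summand b x C) = \<zero>\<^bsub>M\<^esub>" by (rule M.add.finprod_one_eqI)
    then show ?thesis using reconstruct'[OF x] by simp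
  qed
  then have "\<exists>rk :: 'm set \<Rightarrow> nat. (\<forall>A. rk A \<le> length Cs) \<and>
    (\<forall>A B. submodule A k M \<longrightarrow> submodule B k M \<longrightarrow> A \<subset> B \<longrightarrow> rk A < rk B)"
    by (intro submodule_rank[where c = "\<lambda>i x. l (gact M (inv\<^bsub>G\<^esub> (r i)) x)"] K.field_axioms)
      (simp_all add: gact_add l_add gact_smult l_smult)
  then show ?thesis by blast
qed

text \<open>Fitting's lemma: for large N the module is the direct sum of image and kernel of the
  N-th power. Indecomposability and a nonzero image leave no room for the kernel.\<close>

lemma fitting_bij:
  assumes indec: "indecomposable k G M"
    and \<phi>: "\<phi> \<in> gmod_hom k G M M"
    and nonnil: "\<And>n. \<exists>x\<in>carrier M. (\<phi> ^^ n) x \<noteq> \<zero>\<^bsub>M\<^esub>"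
  shows "bij_betw \<phi> (carrier M) (carrier M)"
proof -
  obtain rk :: "'m set \<Rightarrow> nat" and d where rk_le: "\<And>A. rk A \<le> d"
    and rk: "\<And>A B. \<lbrakk>submodule A k M; submodule B k M; A \<subset> B\<rbrakk> \<Longrightarrow> rk A < rk B"
    using rank_exists by blast
  have ph: "(\<phi> ^^ n) \<in> gmod_hom k G M M" for n
    using \<phi> by (induction n) (auto simp: gmod_hom_def Pi_def)
  have p_closed [simp]: "(\<phi> ^^ n) x \<in> carrier M" if "x \<in> carrier M" for n x
    using ph[of n] that unfolding gmod_hom_def by auto
  have p_add: "(\<phi> ^^ n) (x \<oplus>\<^bsub>M\<^esub> y) = (\<phi> ^^ n) x \<oplus>\<^bsub>M\<^esub> (\<phi> ^^ n) y"
    if "x \<in> carrier M" "y \<in> carrier M" for n x y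
    using ph[of n] that unfolding gmod_hom_def by simp
  have p_smult: "(\<phi> ^^ n) (a \<odot>\<^bsub>M\<^esub> x) = a \<odot>\<^bsub>M\<^esub> (\<phi> ^^ n) x"
    if "a \<in> carrier k" "x \<in> carrier M" for n a x
    using ph[of n] that unfolding gmod_hom_def by simp
  have p_gact: "(\<phi> ^^ n) (gact M g x) = gact M g ((\<phi> ^^ n) x)"
    if "g \<in> carrier G" "x \<in> carrier M" for n g x
    using ph[of n] that unfolding gmod_hom_def by simp
  have p_zero [simp]: "(\<phi> ^^ n) \<zero>\<^bsub>M\<^esub> = \<zero>\<^bsub>M\<^esub>" for n
    using p_smult[of "\<zero>" "\<zero>\<^bsub>M\<^esub>" n] by simp
  have p_minus: "(\<phi> ^^ n) (x \<ominus>\<^bsub>M\<^esub> y) = (\<phi> ^^ n) x \<ominus>\<^bsub>M\<^esub> (\<phi> ^^ n) y"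
    if "x \<in> carrier M" "y \<in> carrier M" for n x y
    using that p_smult[of "\<ominus> \<one>" y n] unfolding a_minus_def by (simp add: p_add smult_l_minus)
  define I where "I = (\<lambda>n. (\<phi> ^^ n) ` carrier M)"
  define K where "K = (\<lambda>n. {x \<in> carrier M. (\<phi> ^^ n) x = \<zero>\<^bsub>M\<^esub>})"
  have I: "gsubmodule k G M (I n)" for n
  proof (rule gsubmoduleI)
    show "\<zero>\<^bsub>M\<^esub> \<in> I n" unfolding I_def by (rule image_eqI[of _ _ "\<zero>\<^bsub>M\<^esub>"]) auto
  next
    fix x y assume "x \<in> I n" "y \<in> I n"
    then obtain x' y' where "x' \<in> carrier M" "y' \<in> carrier M" "x = (\<phi> ^^ n) x'" "y = (\<phi> ^^ n) y'"
      unfolding I_def by blast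
    then show "x \<oplus>\<^bsub>M\<^esub> y \<in> I n" unfolding I_def
      by (intro image_eqI[of _ _ "x' \<oplus>\<^bsub>M\<^esub> y'"]) (simp_all add: p_add)
  next
    fix a x assume a: "a \<in> carrier k" and "x \<in> I n"
    then obtain x' where "x' \<in> carrier M" "x = (\<phi> ^^ n) x'" unfolding I_def by blast
    then show "a \<odot>\<^bsub>M\<^esub> x \<in> I n" unfolding I_def
      using a by (intro image_eqI[of _ _ "a \<odot>\<^bsub>M\<^esub> x'"]) (simp_all add: p_smult)
  next
    fix g x assume g: "g \<in> carrier G" and "x \<in> I n"
    then obtain x' where "x' \<in> carrier M" "x = (\<phi> ^^ n) x'" unfolding I_def by blast
    then show "gact M g x \<in> I n" unfolding I_def
      using g by (intro image_eqI[of _ _ "gact M g x'"]) (simp_all add: p_gact)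
  qed (auto simp: I_def)
  have K: "gsubmodule k G M (K n)" for n
    by (rule gsubmoduleI) (auto simp: K_def p_add p_smult p_gact)
  have I_mono: "I (m + n) \<subseteq> I m" for m n
    unfolding I_def by (auto simp: funpow_add)
  have K_mono: "K m \<subseteq> K (n + m)" for m n
    unfolding K_def by (auto simp: funpow_add)
  \<comment> \<open>Images decrease and kernels increase, so an image of least rank and a kernel of
    greatest rank mark the points from which both chains are constant.\<close>
  obtain i where i: "\<And>n. rk (I i) \<le> rk (I n)"
    using ex_has_least_nat[of "\<lambda>_. True" _ "\<lambda>n. rk (I n)"] by blast
  have I_eq: "I (i + n) = I i" for n
    using I_mono[of i n] rk[OF gsubmoduleD(1)[OF I] gsubmoduleD(1)[OF I], of "i + n" i] i[of "i + n"]
    by (meson leD psubsetI)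
  obtain j where j: "\<And>n. rk (K n) \<le> rk (K j)"
    using ex_has_greatest_nat[of "\<lambda>_. True" _ "\<lambda>n. rk (K n)" "Suc d"] rk_le le_imp_less_Suc
    by blast
  have K_eq: "K (n + j) = K j" for n
    using K_mono[of j n] rk[OF gsubmoduleD(1)[OF K] gsubmoduleD(1)[OF K], of j "n + j"] j[of "n + j"]
    by (metis leD psubsetI)
  \<comment> \<open>Beyond both stabilisation points. The successor makes N positive, so that
    injectivity and surjectivity of the N-th power pass to \<open>\<phi>\<close> itself.\<close>
  define N where "N = Suc (i + j)"
  have I_N: "I (N + N) = I N" using I_eq[of "Suc j"] I_eq[of "Suc j + N"] unfolding N_def by (simp add: add.assoc)
  have K_N: "K (N + N) = K N" using K_eq[of "Suc i"] K_eq[of "N + Suc i"] unfolding N_def by (simp add: add.assoc)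
  have "I N <+>\<^bsub>M\<^esub> K N = carrier M"
  proof
    show "I N <+>\<^bsub>M\<^esub> K N \<subseteq> carrier M"
      unfolding set_add_def' using gsubmoduleD(2)[OF I] gsubmoduleD(2)[OF K] by blast
    show "carrier M \<subseteq> I N <+>\<^bsub>M\<^esub> K N"
    proof
      fix x assume x: "x \<in> carrier M"
      have "(\<phi> ^^ N) x \<in> I (N + N)" unfolding I_N unfolding I_def using x by blast
      then obtain y where y: "y \<in> carrier M" "(\<phi> ^^ N) x = (\<phi> ^^ N) ((\<phi> ^^ N) y)"
        unfolding I_def by (auto simp: funpow_add)
      let ?z = "x \<ominus>\<^bsub>M\<^esub> (\<phi> ^^ N) y"
      have "?z \<in> K N" unfolding K_def using x y by (simp add: p_minus M.minus_eq_zero_iff)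
      moreover have "(\<phi> ^^ N) y \<in> I N" unfolding I_def using y by blast
      moreover have "x = (\<phi> ^^ N) y \<oplus>\<^bsub>M\<^esub> ?z"
        using x y unfolding a_minus_def by (simp add: M.a_ac M.r_neg2 M.r_neg1 M.r_neg)
      ultimately show "x \<in> I N <+>\<^bsub>M\<^esub> K N" unfolding set_add_def' by blast
    qed
  qed
  moreover have "I N \<inter> K N = {\<zero>\<^bsub>M\<^esub>}"
  proof -
    have "x = \<zero>\<^bsub>M\<^esub>" if "x \<in> I N" "x \<in> K N" for x
    proof -
      obtain y where y: "y \<in> carrier M" "x = (\<phi> ^^ N) y" using \<open>x \<in> I N\<close> unfolding I_def by blast
      then have "y \<in> K (N + N)" using \<open>x \<in> K N\<close> unfolding K_def by (simp add: funpow_add)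
      then show ?thesis using y K_N unfolding K_def by blast
    qed
    then show ?thesis using gsubmoduleD(3)[OF I] gsubmoduleD(3)[OF K] by blast
  qed
  ultimately have dec: "direct_decomposition k G M (I N) (K N)"
    unfolding direct_decomposition_def using I K by blast
  have "I N \<noteq> {\<zero>\<^bsub>M\<^esub>}" using nonnil[of N] unfolding I_def by auto
  then have K0: "K N = {\<zero>\<^bsub>M\<^esub>}" using dec indec unfolding indecomposable_def by blast
  have "\<phi> x = \<zero>\<^bsub>M\<^esub> \<Longrightarrow> x = \<zero>\<^bsub>M\<^esub>" if "x \<in> carrier M" for x
  proof -
    assume "\<phi> x = \<zero>\<^bsub>M\<^esub>"
    then have "(\<phi> ^^ N) x = \<zero>\<^bsub>M\<^esub>" unfolding N_def by (simp only: funpow_Suc_right o_apply p_zero)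
    then show "x = \<zero>\<^bsub>M\<^esub>" using that K0 unfolding K_def by blast
  qed
  moreover have "\<phi> (x \<ominus>\<^bsub>M\<^esub> y) = \<phi> x \<ominus>\<^bsub>M\<^esub> \<phi> y" if "x \<in> carrier M" "y \<in> carrier M" for x y
    using p_minus[OF that, of 1] by simp
  moreover have "\<phi> x \<in> carrier M" if "x \<in> carrier M" for x
    using p_closed[OF that, of 1] by simp
  ultimately have "inj_on \<phi> (carrier M)"
    by (metis (no_types, lifting) M.minus_closed M.minus_eq_zero_iff inj_onI)
  moreover have "\<phi> ` carrier M = carrier M"
  proof
    show "\<phi> ` carrier M \<subseteq> carrier M" using p_closed[of _ 1] by auto
    have "x \<in> I N" if "x \<in> carrier M" for x
    proof -
      have "x \<in> I N <+>\<^bsub>M\<^esub> K N" using dec that unfolding direct_decomposition_def by blast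
      then obtain y where "y \<in> I N" "x = y \<oplus>\<^bsub>M\<^esub> \<zero>\<^bsub>M\<^esub>" unfolding K0 set_add_def' by blast
      then show ?thesis using gsubmoduleD(2)[OF I, of N] by (simp add: subset_iff)
    qed
    then show "carrier M \<subseteq> \<phi> ` carrier M"
      using I_mono[of 1 "i + j"] unfolding N_def I_def by auto
  qed
  ultimately show ?thesis unfolding bij_betw_def by blast
qed

end

section \<open>The homomorphism onto the trivial module\<close>

locale scott_summand = permutation_summand k G M P b l
  for k :: "('k, 's) ring_scheme" (structure) and G :: "('g, 'r) monoid_scheme" (structure)
    and M :: "('k, 'm, 'g) gmod" (structure) and P b l +
  fixes f :: "'m \<Rightarrow> 'k"
  assumes indecomposable: "indecomposable k G M"
    and f_closed [simp]: "x \<in> carrier M \<Longrightarrow> f x \<in> carrier k"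
    and f_add: "\<lbrakk>x \<in> carrier M; y \<in> carrier M\<rbrakk> \<Longrightarrow> f (x \<oplus>\<^bsub>M\<^esub> y) = f x \<oplus> f y"
    and f_smult: "\<lbrakk>a \<in> carrier k; x \<in> carrier M\<rbrakk> \<Longrightarrow> f (a \<odot>\<^bsub>M\<^esub> x) = a \<otimes> f x"
    and f_gact: "\<lbrakk>g \<in> carrier G; x \<in> carrier M\<rbrakk> \<Longrightarrow> f (gact M g x) = f x"
    and f_nonzero: "\<exists>x\<in>carrier M. f x \<noteq> \<zero>"
begin

lemma f_zero [simp]: "f \<zero>\<^bsub>M\<^esub> = \<zero>"
  using f_smult[of "\<zero>" "\<zero>\<^bsub>M\<^esub>"] by simp

lemma f_minus: "\<lbrakk>x \<in> carrier M; y \<in> carrier M\<rbrakk> \<Longrightarrow> f (x \<ominus>\<^bsub>M\<^esub> y) = f x \<ominus> f y"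
  using f_smult[of "\<ominus> \<one>" y] unfolding a_minus_def by (simp add: f_add smult_l_minus K.l_minus)

lemma f_finsum: "F \<in> I \<rightarrow> carrier M \<Longrightarrow> f (\<Oplus>\<^bsub>M\<^esub>i\<in>I. F i) = (\<Oplus>i\<in>I. f (F i))"
  by (intro finsum_additive M.abelian_group_axioms K.abelian_group_axioms) (auto simp: f_add)

text \<open>The scalar s is the sum of the coefficients of x and does not involve u, because f takes
  the value f(u) on every translate of u. The case u = b, where \<open>extend\<close> is the
  identity, evaluates f(x).\<close>

lemma f_extend:
  assumes x: "x \<in> carrier M"
  obtains s where "s \<in> carrier k" "f x = s \<otimes> f b"
    "\<And>u. u \<in> fixed_points M P \<Longrightarrow> f (extend u x) = s \<otimes> f u"
proof
  let ?c = "\<lambda>C. l (gact M (inv\<^bsub>G\<^esub> (rep C)) x)"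
  have c: "?c \<in> cosets \<rightarrow> carrier k" using x coset_rep by simp
  show "(\<Oplus>C\<in>cosets. ?c C) \<in> carrier k" by (rule K.finsum_closed[OF c])
  show ext: "f (extend u x) = (\<Oplus>C\<in>cosets. ?c C) \<otimes> f u" if "u \<in> fixed_points M P" for u
  proof -
    have u: "u \<in> carrier M" using that unfolding fixed_points_def by simp
    have "f (extend u x) = (\<Oplus>C\<in>cosets. f (summand u x C))"
      unfolding extend_def using u x by (intro f_finsum) simp
    also have "\<dots> = (\<Oplus>C\<in>cosets. ?c C \<otimes> f u)"
      by (rule K.finsum_cong')
        (use u x coset_rep in \<open>simp_all add: summand_def f_smult f_gact\<close>)
    also have "\<dots> = (\<Oplus>C\<in>cosets. ?c C) \<otimes> f u"
      by (rule K.finsum_ldistr[symmetric, OF finite_cosets f_closed[OF u] c])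
    finally show ?thesis .
  qed
  show "f x = (\<Oplus>C\<in>cosets. ?c C) \<otimes> f b"
    using ext[OF b_fixed] reconstruct'[OF x] unfolding extend_def by simp
qed

text \<open>By \<open>f_extend\<close> every value of f is a multiple of f(b), and f is not
  zero.\<close>

lemma f_b: "f b \<noteq> \<zero>"
proof
  assume z: "f b = \<zero>"
  obtain x where x: "x \<in> carrier M" "f x \<noteq> \<zero>" using f_nonzero by blast
  obtain s where "s \<in> carrier k" "f x = s \<otimes> f b" by (rule f_extend[OF x(1)])
  then show False using x(2) z by simp
qed

text \<open>By Frobenius reciprocity every P-fixed vector u with f u nonzero is the image of b under an
  endomorphism, which is not nilpotent because f is an eigenvector of its transpose.\<close>

lemma extend_bij:
  assumes u: "u \<in> fixed_points M P" and fu: "f u \<noteq> \<zero>"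
  shows "bij_betw (extend u) (carrier M) (carrier M)"
proof (rule fitting_bij[OF indecomposable extend_hom[OF u]])
  fix n
  have uc: "u \<in> carrier M" and bc: "b \<in> carrier M"
    using u b_fixed unfolding fixed_points_def by auto
  have e_closed [simp]: "extend u x \<in> carrier M" if "x \<in> carrier M" for x
    using extend_hom[OF u] that unfolding gmod_hom_def by auto
  \<comment> \<open>By \<open>f_extend\<close>, f(extend u x) is f(x) times the nonzero scalar
    f(u)/f(b), so \<open>extend u\<close> never leads into ker f from outside.\<close>
  have fx: "f (extend u x) \<noteq> \<zero>" if x: "x \<in> carrier M" "f x \<noteq> \<zero>" for x
  proof -
    obtain s where s: "s \<in> carrier k" "f x = s \<otimes> f b" "f (extend u x) = s \<otimes> f u"
      by (rule f_extend[OF x(1)]) (use u in blast)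
    then have "s \<noteq> \<zero>" using x(2) bc by auto
    then show ?thesis using s fu uc K.integral_iff by simp
  qed
  \<comment> \<open>The orbit of b under \<open>extend u\<close> stays outside ker f, so no power of
    the map is zero.\<close>
  have "(extend u ^^ n) b \<in> carrier M \<and> f ((extend u ^^ n) b) \<noteq> \<zero>"
    by (induction n) (use bc f_b fx in auto)
  then show "\<exists>x\<in>carrier M. (extend u ^^ n) x \<noteq> \<zero>\<^bsub>M\<^esub>"
    using bc f_smult[of "\<zero>" "\<zero>\<^bsub>M\<^esub>"] by force
qed

text \<open>The preimage of a P-fixed vector under an equivariant bijection is P-fixed. Having x
  fixed as well is what later makes the terms of \<open>extend u x\<close> constant up to
  translation along P-orbits.\<close>

lemma fixed_point_extend:
  assumes u: "u \<in> fixed_points M P" and fu: "f u \<noteq> \<zero>" and y: "y \<in> fixed_points M P"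
  obtains x where "x \<in> fixed_points M P" "extend u x = y"
proof -
  have bij: "bij_betw (extend u) (carrier M) (carrier M)" by (rule extend_bij[OF u fu])
  have yc: "y \<in> carrier M" using y unfolding fixed_points_def by simp
  then have "y \<in> extend u ` carrier M" using bij_betw_imp_surj_on[OF bij] by simp
  then obtain x where xc: "x \<in> carrier M" and "y = extend u x" by (rule imageE)
  then have x: "x \<in> carrier M" "extend u x = y" by simp_all
  have "gact M h x = x" if h: "h \<in> P" for h
  proof -
    have hG: "h \<in> carrier G" using h by (rule P.mem_carrier)
    have "extend u (gact M h x) = gact M h (extend u x)"
      using extend_hom[OF u] hG x(1) unfolding gmod_hom_def by simp
    also have "\<dots> = extend u x" using x(2) y h unfolding fixed_points_def by simp
    finally show ?thesis
      using inj_onD[OF bij_betw_imp_inj_on[OF bij]] x(1) hG by simp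
  qed
  then show thesis using that[of x] x unfolding fixed_points_def by blast
qed

end

section \<open>Fixed points of the vertex\<close>

lemma (in group) normalizer_conj:
  assumes "subgroup H G" "n \<in> normalizer G H"
  shows "n \<in> carrier G" "h \<in> H \<Longrightarrow> n \<otimes> h \<otimes> inv n \<in> H" "h \<in> H \<Longrightarrow> inv n \<otimes> h \<otimes> n \<in> H"
proof -
  let ?N = "G\<lparr>carrier := normalizer G H\<rparr>"
  have sub: "subgroup (normalizer G H) G"
    by (rule normalizer_imp_subgroup[OF subgroup.subset[OF assms(1)]])
  show "n \<in> carrier G" using subgroup.mem_carrier[OF sub assms(2)] .
  have nrm: "H \<lhd> ?N" by (rule subgroup_in_normalizer[OF assms(1)])
  have inv: "inv\<^bsub>?N\<^esub> n = inv n" using m_inv_consistent[OF sub assms(2)] .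
  show "h \<in> H \<Longrightarrow> n \<otimes> h \<otimes> inv n \<in> H"
    using normal.inv_op_closed2[OF nrm, of n h] assms(2) inv by simp
  show "h \<in> H \<Longrightarrow> inv n \<otimes> h \<otimes> n \<in> H"
    using normal.inv_op_closed1[OF nrm, of n h] assms(2) inv by simp
qed

text \<open>Conjugation is injective, so for finite H one inclusion already gives the equality of
  sets that the definition of the normaliser as a stabiliser asks for.\<close>

lemma (in group) normalizerI:
  assumes "finite H" "H \<subseteq> carrier G" "g \<in> carrier G" "\<And>h. h \<in> H \<Longrightarrow> inv g \<otimes> h \<otimes> g \<in> H"
  shows "g \<in> normalizer G H"
proof -
  let ?c = "\<lambda>h. inv g \<otimes> h \<otimes> g"
  have inj: "inj_on ?c H"
  proof (rule inj_onI)
    fix x y assume "x \<in> H" "y \<in> H" and eq: "?c x = ?c y"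
    then have "x \<in> carrier G" "y \<in> carrier G" using assms(2) by auto
    then show "x = y" using eq assms(3) by simp
  qed
  have surj: "?c ` H = H"
    by (rule endo_inj_surj[OF assms(1) _ inj]) (intro image_subsetI assms(4))
  have img: "\<exists>h'\<in>H. h = inv g \<otimes> h' \<otimes> g" if "h \<in> H" for h
  proof -
    have "h \<in> ?c ` H" using that unfolding surj .
    then show ?thesis by (rule imageE) (rule bexI)
  qed
  have *: "g \<otimes> (inv g \<otimes> h \<otimes> g) \<otimes> inv g = h" if "h \<in> H" for h
  proof -
    have "h \<in> carrier G" using that assms(2) by blast
    then show ?thesis using assms(3) by (simp add: m_assoc) (simp add: m_assoc[symmetric])
  qed
  have "g <# H #> inv g = H"
  proof (intro equalityI subsetI)
    fix y assume "y \<in> g <# H #> inv g"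
    then obtain h where h: "h \<in> H" "y = g \<otimes> h \<otimes> inv g" unfolding l_coset_def r_coset_def by auto
    then show "y \<in> H" using img[OF h(1)] * by auto
  next
    fix h assume h: "h \<in> H"
    then have "g \<otimes> (inv g \<otimes> h \<otimes> g) \<otimes> inv g \<in> g <# H #> inv g"
      unfolding l_coset_def r_coset_def using assms(4)[OF h] by auto
    then show "h \<in> g <# H #> inv g" unfolding *[OF h] .
  qed
  then show ?thesis using assms(2,3) unfolding normalizer_def stabilizer_def by simp
qed

lemma lcosets_carrier_update: "lcosets\<^bsub>G\<lparr>carrier := H\<rparr>\<^esub> K = (\<lambda>a. a <#\<^bsub>G\<^esub> K) ` H"
  by (auto simp: LCOSETS_def)

text \<open>The indices of R in S and of S in G multiply to p. Applied inside P, it leaves only R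
  and P as stabilisers of anything on which R acts trivially.\<close>

lemma (in group) subgroup_between_prime_index:
  assumes "finite (carrier G)" "subgroup S G" "subgroup R G" "R \<subseteq> S"
    and "order G = p * card R" "Factorial_Ring.prime p"
  shows "S = R \<or> S = carrier G"
proof -
  have fS: "finite S" using assms(1) subgroup.subset[OF assms(2)] finite_subset by blast
  interpret S: group "G\<lparr>carrier := S\<rparr>" by (rule subgroup_imp_group[OF assms(2)])
  have RS: "subgroup R (G\<lparr>carrier := S\<rparr>)" using subgroup_incl[OF assms(3,2,4)] .
  have "card S = card (rcosets\<^bsub>G\<lparr>carrier := S\<rparr>\<^esub> R) * card R"
    using S.lagrange[OF RS] by (simp add: order_def)
  then obtain i where i: "card S = i * card R" ..
  obtain j where j: "order G = j * card S" using lagrange[OF assms(2), symmetric] ..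
  have "card R > 0"
    using subgroup.one_closed[OF assms(3)] finite_subset[OF assms(4) fS] by (auto simp: card_gt_0_iff)
  then have "j * i = p" using i j assms(5) by (simp add: mult.assoc[symmetric])
  then have ji: "p = j * i" ..
  then have "i = 1 \<or> i = p" using assms(6) unfolding prime_nat_iff by (metis dvd_triv_right)
  then have "i = 1 \<or> j = 1" using ji prime_gt_0_nat[OF assms(6)] by auto
  then show ?thesis
  proof
    assume "i = 1"
    then have "S = R" using i card_subset_eq[OF fS assms(4)] by simp
    then show ?thesis ..
  next
    assume "j = 1"
    then have "S = carrier G"
      using j card_subset_eq[OF assms(1) subgroup.subset[OF assms(2)]] by (simp add: order_def)
    then show ?thesis ..
  qed
qed

section \<open>P-fixed vectors modulo traces, with R acting trivially\<close>

locale scott_trivial_normal = scott_summand k G M P b l f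
  for k :: "('k, 's) ring_scheme" (structure) and G :: "('g, 'r) monoid_scheme" (structure)
    and M :: "('k, 'm, 'g) gmod" (structure) and P b l f +
  fixes p :: nat and R :: "'g set"
  assumes prime_p: "Factorial_Ring.prime p"
    and char_p: "has_characteristic k p"
    and p_group: "p_subgroup p P G"
    and R_normal: "R \<lhd> G"
    and R_sub: "R \<subseteq> P \<inter> gmod_kernel G M"
    and R_index: "order (G\<lparr>carrier := P\<rparr> Mod R) = p"
begin

sublocale R: normal R G by (rule R_normal)

sublocale PG: group "G\<lparr>carrier := P\<rparr>" by (rule G.subgroup_imp_group[OF P.subgroup_axioms])

lemma R_act [simp]: "\<lbrakk>r \<in> R; x \<in> carrier M\<rbrakk> \<Longrightarrow> gact M r x = x"
  using R_sub unfolding gmod_kernel_def by auto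

lemma R_subset_P: "R \<subseteq> P" using R_sub by blast

lemma finite_P: "finite P" using finite_subset[OF P.subset finite_G] .

lemma R_subgroup_P: "subgroup R (G\<lparr>carrier := P\<rparr>)"
  using G.subgroup_incl[OF R.subgroup_axioms P.subgroup_axioms R_subset_P] .

lemma card_P: "card P = p * card R"
  using PG.lagrange[OF R_subgroup_P] R_index by (simp add: order_def FactGroup_def)

text \<open>Numerator of M(P); the denominator is \<open>T\<close> below. By
  \<open>fixed_points_eq_E\<close> and \<open>proper_traces_eq_T\<close> the same pair serves every
  subgroup of P not contained in R.\<close>

definition E :: "'m set" where "E = fixed_points M P"

lemma E_iff: "x \<in> E \<longleftrightarrow> x \<in> carrier M \<and> (\<forall>h\<in>P. gact M h x = x)"
  unfolding E_def fixed_points_def by simp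

text \<open>As R acts trivially, the domain of this relative trace is all of M.\<close>

definition tr :: "'m \<Rightarrow> 'm" where "tr = relative_trace G M R P"

abbreviation "PR \<equiv> lcosets\<^bsub>G\<lparr>carrier := P\<rparr>\<^esub> R"

lemma PR_rep:
  assumes "C \<in> PR"
  shows "rep C \<in> C" "rep C \<in> P" "C = rep C <#\<^bsub>G\<^esub> R"
  using some_in_lcoset[OF PG.is_group R_subgroup_P assms] by auto

lemma finite_PR: "finite PR"
  unfolding lcosets_carrier_update using finite_P by simp

text \<open>The action of P factors through P/R, so any element of the coset may replace the chosen
  representative.\<close>

lemma PR_act:
  assumes "C \<in> PR" "h \<in> C" "x \<in> carrier M"
  shows "gact M (rep C) x = gact M h x"
proof -
  obtain r where r: "r \<in> R" "(rep C) = h \<otimes>\<^bsub>G\<^esub> r"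
    using PG.lcoset_memD[OF R_subgroup_P assms(1,2) PR_rep(1)[OF assms(1)]] by auto
  have "h \<in> P" using PG.lcoset_subset[OF R_subgroup_P assms(1)] assms(2) by auto
  then show ?thesis using r assms(3) by (simp add: gact_mult P.mem_carrier R.mem_carrier)
qed

lemma tr_eq: "tr x = (\<Oplus>\<^bsub>M\<^esub>C\<in>PR. gact M (rep C) x)"
  unfolding tr_def relative_trace_def ..

lemma tr_fun: "x \<in> carrier M \<Longrightarrow> (\<lambda>C. gact M (rep C) x) \<in> PR \<rightarrow> carrier M"
  using PR_rep(2) P.mem_carrier by simp

lemma tr_closed [simp]: "x \<in> carrier M \<Longrightarrow> tr x \<in> carrier M"
  unfolding tr_eq by (rule M.finsum_closed[OF tr_fun])

text \<open>The image of the trace from R to P is the sum of all images of proper traces: R acts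
  trivially and has index p in P.\<close>

definition T :: "'m set" where "T = tr ` carrier M"

lemma submodule_T: "submodule T k M"
proof (rule submoduleI')
  have "tr \<zero>\<^bsub>M\<^esub> = \<zero>\<^bsub>M\<^esub>"
    unfolding tr_eq by (rule M.add.finprod_one_eqI) (use PR_rep(2) P.mem_carrier in simp)
  then show "\<zero>\<^bsub>M\<^esub> \<in> T" unfolding T_def by (metis M.zero_closed image_eqI)
next
  fix x y assume "x \<in> T" "y \<in> T"
  then obtain x' y' where xy: "x' \<in> carrier M" "y' \<in> carrier M" "x = tr x'" "y = tr y'"
    unfolding T_def by blast
  have "tr (x' \<oplus>\<^bsub>M\<^esub> y') = tr x' \<oplus>\<^bsub>M\<^esub> tr y'"
    unfolding tr_eq M.finsum_addf[OF tr_fun[OF xy(1)] tr_fun[OF xy(2)], symmetric]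
    by (rule M.finsum_cong') (use xy PR_rep(2) P.mem_carrier in \<open>simp_all add: gact_add\<close>)
  then show "x \<oplus>\<^bsub>M\<^esub> y \<in> T" unfolding T_def using xy by (metis M.a_closed image_eqI)
next
  fix a x assume a: "a \<in> carrier k" and "x \<in> T"
  then obtain x' where x: "x' \<in> carrier M" "x = tr x'" unfolding T_def by blast
  have "tr (a \<odot>\<^bsub>M\<^esub> x') = a \<odot>\<^bsub>M\<^esub> tr x'"
    unfolding tr_eq finsum_smult_ldistr[OF finite_PR a tr_fun[OF x(1)]]
    by (rule M.finsum_cong') (use x a PR_rep(2) P.mem_carrier in \<open>simp_all add: gact_smult\<close>)
  then show "a \<odot>\<^bsub>M\<^esub> x \<in> T" unfolding T_def using x a by (metis smult_closed image_eqI)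
qed (auto simp: T_def)

lemma l_coset_image: "a <#\<^bsub>G\<^esub> H = (\<lambda>h. a \<otimes>\<^bsub>G\<^esub> h) ` H"
  unfolding l_coset_def by auto

text \<open>Conjugation by n permutes the cosets of R in P, since n normalises P and R is normal in
  G. Hence T is stable under the normaliser of P.\<close>

lemma gact_tr:
  assumes n: "n \<in> normalizer G P" and x: "x \<in> carrier M"
  shows "gact M n (tr x) = tr (gact M n x)"
proof -
  note nc = G.normalizer_conj[OF P.subgroup_axioms n]
  have nG [simp]: "n \<in> carrier G" by (rule nc(1))
  let ?c = "\<lambda>h. n \<otimes>\<^bsub>G\<^esub> h \<otimes>\<^bsub>G\<^esub> inv\<^bsub>G\<^esub> n"
  let ?d = "\<lambda>h. inv\<^bsub>G\<^esub> n \<otimes>\<^bsub>G\<^esub> h \<otimes>\<^bsub>G\<^esub> n"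
  have dc: "?d (?c h) = h" and cd: "?c (?d h) = h" if "h \<in> carrier G" for h
    using that by (simp_all add: G.m_assoc) (simp_all add: G.m_assoc[symmetric])
  have cR: "?c ` (h <#\<^bsub>G\<^esub> R) = ?c h <#\<^bsub>G\<^esub> R" if h: "h \<in> carrier G" for h
  proof -
    have c_mult: "?c (h \<otimes>\<^bsub>G\<^esub> r) = ?c h \<otimes>\<^bsub>G\<^esub> ?c r" if "r \<in> carrier G" for r
      using h that by (simp add: G.m_assoc) (simp add: G.m_assoc[symmetric])
    have "?c ` R = R"
    proof (intro equalityI subsetI)
      fix r assume r: "r \<in> R"
      have "?d r \<in> R" using R.inv_op_closed1[OF nG r] .
      then show "r \<in> ?c ` R" using cd[OF R.mem_carrier[OF r], symmetric] by (rule rev_image_eqI)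
    qed (use R.inv_op_closed2[OF nG] in auto)
    then have "?c h <#\<^bsub>G\<^esub> R = (\<lambda>r. ?c h \<otimes>\<^bsub>G\<^esub> ?c r) ` R"
      unfolding l_coset_image by (metis (no_types) image_image)
    also have "\<dots> = ?c ` (h <#\<^bsub>G\<^esub> R)"
      unfolding l_coset_image image_image
      by (rule image_cong) (use c_mult R.mem_carrier in simp_all)
    finally show ?thesis by simp
  qed
  have cPR: "?c ` C \<in> PR" if "C \<in> PR" for C
  proof -
    obtain h where h: "h \<in> P" "C = h <#\<^bsub>G\<^esub> R" using \<open>C \<in> PR\<close> unfolding lcosets_carrier_update by blast
    then have "?c ` C = ?c h <#\<^bsub>G\<^esub> R" using cR P.mem_carrier by simp
    then show ?thesis unfolding lcosets_carrier_update using nc(2) h by blast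
  qed
  have subG: "C \<subseteq> carrier G" if "C \<in> PR" for C
    using PG.lcoset_subset[OF R_subgroup_P that] P.subset by auto
  have bij: "bij_betw (\<lambda>C. ?c ` C) PR PR"
  proof -
    have inj: "inj_on (\<lambda>C. ?c ` C) PR"
    proof (rule inj_on_inverseI)
      fix C assume "C \<in> PR"
      then have "C \<subseteq> carrier G" by (rule subG)
      then have "(\<lambda>h. ?d (?c h)) ` C = (\<lambda>h. h) ` C" by (intro image_cong) (use dc in auto)
      then show "?d ` ?c ` C = C" by (simp add: image_image)
    qed
    have "(\<lambda>C. ?c ` C) ` PR = PR"
      by (rule endo_inj_surj[OF finite_PR _ inj]) (intro image_subsetI cPR)
    then show ?thesis using inj unfolding bij_betw_def by simp
  qed
  have "gact M n (tr x) = (\<Oplus>\<^bsub>M\<^esub>C\<in>PR. gact M n (gact M (rep C) x))"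
    unfolding tr_eq by (rule gact_finsum[OF nG tr_fun[OF x]])
  also have "\<dots> = (\<Oplus>\<^bsub>M\<^esub>C\<in>PR. gact M (rep (?c ` C)) (gact M n x))"
  proof (rule M.finsum_cong')
    fix C assume C: "C \<in> PR"
    define h where "h = rep C"
    have h: "h \<in> C" and hP: "h \<in> P" using PR_rep[OF C] unfolding h_def by auto
    have "?c h \<in> ?c ` C" using h by blast
    then have "gact M (rep (?c ` C)) (gact M n x) = gact M (?c h) (gact M n x)"
      using PR_act[OF cPR[OF C]] x by simp
    also have "\<dots> = gact M n (gact M h x)" using x P.mem_carrier[OF hP] by (simp add: gact_mult)
    finally show "gact M n (gact M (rep C) x) = gact M (rep (?c ` C)) (gact M n x)"
      unfolding h_def by simp
  qed (use x tr_fun[of "gact M n x"] cPR in auto)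
  also have "\<dots> = (\<Oplus>\<^bsub>M\<^esub>C\<in>(\<lambda>C. ?c ` C) ` PR. gact M (rep C) (gact M n x))"
    by (rule M.finsum_reindex[symmetric])
      (use bij tr_fun[of "gact M n x"] x in \<open>simp_all add: bij_betw_def\<close>)
  also have "(\<lambda>C. ?c ` C) ` PR = PR" using bij by (simp add: bij_betw_def)
  finally show ?thesis unfolding tr_eq .
qed

text \<open>The P-orbit of a coset outside the normaliser of P is regular for P/R, since the stabiliser
  of the coset lies between R and P.\<close>

lemma sum_stable_in:
  assumes u: "u \<in> E" and x: "x \<in> E"
    and D: "submodule D k M" and TD: "T \<subseteq> D" and ND: "\<And>n. n \<in> normalizer G P \<Longrightarrow> gact M n u \<in> D"
    and "\<Omega> \<subseteq> cosets" and "\<And>q C. \<lbrakk>q \<in> P; C \<in> \<Omega>\<rbrakk> \<Longrightarrow> q <#\<^bsub>G\<^esub> C \<in> \<Omega>"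
  shows "(\<Oplus>\<^bsub>M\<^esub>C\<in>\<Omega>. summand u x C) \<in> D"
proof -
  have uF: "u \<in> fixed_points M P" and uc [simp]: "u \<in> carrier M" and xc [simp]: "x \<in> carrier M"
    using u x unfolding E_def fixed_points_def by auto
  have "finite \<Omega>" using finite_subset[OF assms(6) finite_cosets] .
  then show ?thesis using assms(6,7)
  \<comment> \<open>Split off the P-orbit of one coset; what remains is smaller and again stable
    under P.\<close>
  proof (induction \<Omega> rule: finite_psubset_induct)
    case (psubset \<Omega>)
    show ?case
    proof (cases "\<Omega> = {}")
      case True
      then show ?thesis using submodule_zero[OF D] by simp
    next
      case False
      then obtain C where C: "C \<in> \<Omega>" by blast
      then have Cc: "C \<in> cosets" using psubset.prems by blast
      have cG: "C' \<subseteq> carrier G" if "C' \<in> cosets" for C'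
        using G.lcoset_subset[OF P.subgroup_axioms that] .
      have assoc: "q <#\<^bsub>G\<^esub> (q' <#\<^bsub>G\<^esub> C') = (q \<otimes>\<^bsub>G\<^esub> q') <#\<^bsub>G\<^esub> C'"
        if "q \<in> carrier G" "q' \<in> carrier G" "C' \<in> cosets" for q q' C'
        using that cG by (simp add: G.lcos_m_assoc)
      define orb where "orb = (\<lambda>q. q <#\<^bsub>G\<^esub> C) ` P"
      have orb\<Omega>: "orb \<subseteq> \<Omega>" unfolding orb_def using psubset.prems(2) C by blast
      have "\<one>\<^bsub>G\<^esub> <#\<^bsub>G\<^esub> C = C" using G.lcos_mult_one[OF cG[OF Cc]] .
      then have Corb: "C \<in> orb" unfolding orb_def using P.one_closed by (metis image_eqI)
      have rest: "(\<Oplus>\<^bsub>M\<^esub>C\<in>\<Omega> - orb. summand u x C) \<in> D"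
      proof (rule psubset.IH)
        show "\<Omega> - orb \<subset> \<Omega>" using Corb C by blast
        show "\<Omega> - orb \<subseteq> cosets" using psubset.prems(1) by blast
        fix q C' assume q: "q \<in> P" and C': "C' \<in> \<Omega> - orb"
        have qG: "q \<in> carrier G" using q by (rule P.mem_carrier)
        have C'c: "C' \<in> cosets" using C' psubset.prems(1) by blast
        have "q <#\<^bsub>G\<^esub> C' \<notin> orb"
        proof
          assume "q <#\<^bsub>G\<^esub> C' \<in> orb"
          then obtain q' where q': "q' \<in> P" "q <#\<^bsub>G\<^esub> C' = q' <#\<^bsub>G\<^esub> C" unfolding orb_def by blast
          have "C' = inv\<^bsub>G\<^esub> q <#\<^bsub>G\<^esub> (q <#\<^bsub>G\<^esub> C')"
            using assoc[OF _ qG C'c, of "inv\<^bsub>G\<^esub> q"] qG G.lcos_mult_one[OF cG[OF C'c]] by simp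
          also have "\<dots> = (inv\<^bsub>G\<^esub> q \<otimes>\<^bsub>G\<^esub> q') <#\<^bsub>G\<^esub> C"
            unfolding q'(2) using assoc[OF _ P.mem_carrier[OF q'(1)] Cc] qG by simp
          finally show False using C' P.m_closed[OF P.m_inv_closed[OF q] q'(1)] unfolding orb_def by blast
        qed
        then show "q <#\<^bsub>G\<^esub> C' \<in> \<Omega> - orb" using psubset.prems(2) q C' by blast
      qed
      have orbit: "(\<Oplus>\<^bsub>M\<^esub>C\<in>orb. summand u x C) \<in> D"
      proof -
        define g where "g = rep C"
        have gG [simp]: "g \<in> carrier G" and gC: "g \<in> C" and Cg: "C = g <#\<^bsub>G\<^esub> P"
          using some_in_lcoset[OF G.is_group P.subgroup_axioms Cc] unfolding g_def by auto
        \<comment> \<open>The stabiliser in G of the coset gP is the conjugate of P by g.\<close>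
        have stab: "q <#\<^bsub>G\<^esub> C = C \<longleftrightarrow> inv\<^bsub>G\<^esub> g \<otimes>\<^bsub>G\<^esub> q \<otimes>\<^bsub>G\<^esub> g \<in> P" if qG: "q \<in> carrier G" for q
        proof -
          have "q <#\<^bsub>G\<^esub> C = (q \<otimes>\<^bsub>G\<^esub> g) <#\<^bsub>G\<^esub> P"
            unfolding Cg using qG P.subset by (simp add: G.lcos_m_assoc)
          also have "\<dots> = C \<longleftrightarrow> q \<otimes>\<^bsub>G\<^esub> g \<in> g <#\<^bsub>G\<^esub> P"
            unfolding Cg
            using G.l_repr_independence[OF _ gG P.subgroup_axioms, of "q \<otimes>\<^bsub>G\<^esub> g"]
              G.lcos_self[OF _ P.subgroup_axioms, of "q \<otimes>\<^bsub>G\<^esub> g"] qG by auto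
          also have "\<dots> \<longleftrightarrow> inv\<^bsub>G\<^esub> g \<otimes>\<^bsub>G\<^esub> (q \<otimes>\<^bsub>G\<^esub> g) \<in> P"
            using P.lcos_module_imp[OF G.is_group gG] P.lcos_module_rev[OF G.is_group gG, of "q \<otimes>\<^bsub>G\<^esub> g"] qG
            by auto
          finally show ?thesis using qG by (simp add: G.m_assoc)
        qed
        show ?thesis
        \<comment> \<open>If g normalises P, the orbit is a single coset and its term is a scalar
          multiple of g u, which D contains by assumption.\<close>
        proof (cases "g \<in> normalizer G P")
          case True
          have "q <#\<^bsub>G\<^esub> C = C" if "q \<in> P" for q
            using stab[OF P.mem_carrier[OF that]] G.normalizer_conj(3)[OF P.subgroup_axioms True that] by simp
          then have "orb = {C}" using Corb unfolding orb_def by auto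
          moreover have "summand u x C = l (gact M (inv\<^bsub>G\<^esub> g) x) \<odot>\<^bsub>M\<^esub> gact M g u"
            by (rule summand_eq[OF uF xc Cc gC])
          moreover have "\<dots> \<in> D" using submoduleE(4)[OF D] ND[OF True] by simp
          moreover have "(\<Oplus>\<^bsub>M\<^esub>C\<in>{C}. summand u x C) = summand u x C" using Cc by simp
          ultimately show ?thesis by simp
        next
          case False
          \<comment> \<open>S contains R, as R is normal in G and lies in P, so S is R or P; the
            second case would put g into the normaliser.\<close>
          define S where "S = {q \<in> P. q <#\<^bsub>G\<^esub> C = C}"
          have S: "subgroup S (G\<lparr>carrier := P\<rparr>)"
          proof (rule PG.subgroupI)
            show "S \<subseteq> carrier (G\<lparr>carrier := P\<rparr>)" unfolding S_def by auto
            show "S \<noteq> {}"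
              unfolding S_def using P.one_closed \<open>\<one>\<^bsub>G\<^esub> <#\<^bsub>G\<^esub> C = C\<close> by blast
          next
            fix a assume "a \<in> S"
            then have a: "a \<in> P" "a <#\<^bsub>G\<^esub> C = C" and aG: "a \<in> carrier G"
              unfolding S_def using P.mem_carrier by auto
            have "inv\<^bsub>G\<^esub> a <#\<^bsub>G\<^esub> C = inv\<^bsub>G\<^esub> a <#\<^bsub>G\<^esub> (a <#\<^bsub>G\<^esub> C)" unfolding a(2) ..
            also have "\<dots> = C" using assoc[OF _ aG Cc] aG \<open>\<one>\<^bsub>G\<^esub> <#\<^bsub>G\<^esub> C = C\<close> by simp
            finally show "inv\<^bsub>G\<lparr>carrier := P\<rparr>\<^esub> a \<in> S"
              unfolding S_def G.m_inv_consistent[OF P.subgroup_axioms a(1)]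
              using P.m_inv_closed[OF a(1)] by simp
          next
            fix a c assume "a \<in> S" "c \<in> S"
            then show "a \<otimes>\<^bsub>G\<lparr>carrier := P\<rparr>\<^esub> c \<in> S"
              unfolding S_def using assoc[OF _ _ Cc, symmetric] P.m_closed by (simp add: P.mem_carrier)
          qed
          have "R \<subseteq> S"
            unfolding S_def using R.inv_op_closed1[OF gG] R_subset_P stab[OF R.mem_carrier] by blast
          then have "S = R \<or> S = P"
            using PG.subgroup_between_prime_index[OF _ S R_subgroup_P, of p] finite_P card_P prime_p
            by (simp add: order_def)
          moreover have "S \<noteq> P"
          proof
            assume "S = P"
            then have "inv\<^bsub>G\<^esub> g \<otimes>\<^bsub>G\<^esub> q \<otimes>\<^bsub>G\<^esub> g \<in> P" if q: "q \<in> P" for q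
              using q stab[OF P.mem_carrier[OF q]] unfolding S_def by blast
            then show False using False G.normalizerI[OF finite_P P.subset gG] by blast
          qed
          ultimately have SR: "S = R" by blast
          \<comment> \<open>As the stabiliser is exactly R, the cosets of R in P index the orbit
            without repetition.\<close>
          let ?r = "\<lambda>C'. rep C' <#\<^bsub>G\<^esub> C"
          have inj: "inj_on ?r PR"
          proof (rule inj_onI)
            fix A B assume A: "A \<in> PR" and B: "B \<in> PR" and eq: "?r A = ?r B"
            define a c where "a = rep A" and "c = rep B"
            have a: "a \<in> P" "A = a <#\<^bsub>G\<^esub> R" and c: "c \<in> P" "B = c <#\<^bsub>G\<^esub> R"
              using PR_rep[OF A] PR_rep[OF B] unfolding a_def c_def by auto
            have ac: "a \<in> carrier G" "c \<in> carrier G" using a(1) c(1) P.mem_carrier by auto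
            have "(inv\<^bsub>G\<^esub> c \<otimes>\<^bsub>G\<^esub> a) <#\<^bsub>G\<^esub> C = inv\<^bsub>G\<^esub> c <#\<^bsub>G\<^esub> (a <#\<^bsub>G\<^esub> C)"
              using assoc[OF _ ac(1) Cc] ac by simp
            also have "a <#\<^bsub>G\<^esub> C = c <#\<^bsub>G\<^esub> C" using eq unfolding a_def c_def .
            also have "inv\<^bsub>G\<^esub> c <#\<^bsub>G\<^esub> (c <#\<^bsub>G\<^esub> C) = C"
              using assoc[OF _ ac(2) Cc, of "inv\<^bsub>G\<^esub> c"] ac G.lcos_mult_one[OF cG[OF Cc]] by simp
            finally have "inv\<^bsub>G\<^esub> c \<otimes>\<^bsub>G\<^esub> a \<in> S"
              unfolding S_def using P.m_closed[OF P.m_inv_closed[OF c(1)] a(1)] by simp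
            then have "a \<in> c <#\<^bsub>G\<^esub> R"
              using R.lcos_module_rev[OF G.is_group ac(2,1)] SR by simp
            then show "A = B"
              unfolding a(2) c(2) using G.l_repr_independence[OF _ ac(2) R.subgroup_axioms] by simp
          qed
          have img: "?r ` PR = orb"
          proof (intro equalityI subsetI)
            fix C' assume "C' \<in> ?r ` PR"
            then show "C' \<in> orb" unfolding orb_def using PR_rep(2) by blast
          next
            fix C' assume "C' \<in> orb"
            then obtain q where q: "q \<in> P" "C' = q <#\<^bsub>G\<^esub> C" unfolding orb_def by blast
            have qG: "q \<in> carrier G" using q(1) by (rule P.mem_carrier)
            define A where "A = q <#\<^bsub>G\<^esub> R"
            have A: "A \<in> PR" unfolding A_def lcosets_carrier_update using q(1) by blast
            have "q \<in> A" unfolding A_def using G.lcos_self[OF qG R.subgroup_axioms] .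
            then obtain r where r: "r \<in> R" "(rep A) = q \<otimes>\<^bsub>G\<^esub> r"
              using PG.lcoset_memD[OF R_subgroup_P A _ PR_rep(1)[OF A]] by auto
            have rG: "r \<in> carrier G" using r(1) by (rule R.mem_carrier)
            have "r \<in> S" using SR r(1) by simp
            then have "r <#\<^bsub>G\<^esub> C = C" unfolding S_def by simp
            then have "?r A = C'" unfolding r(2) q(2) using assoc[OF qG rG Cc] by simp
            then show "C' \<in> ?r ` PR" using A by blast
          qed
          have "(\<Oplus>\<^bsub>M\<^esub>C\<in>orb. summand u x C) = (\<Oplus>\<^bsub>M\<^esub>A\<in>PR. summand u x (?r A))"
            unfolding img[symmetric]
          proof (rule M.finsum_reindex[OF _ inj])
            show "summand u x \<in> ?r ` PR \<rightarrow> carrier M"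
              unfolding img using orb\<Omega> psubset.prems(1) by auto
          qed
          \<comment> \<open>This uses that x is fixed by P: moving a term along the orbit then keeps
            x, so the orbit sum is the trace of a single term.\<close>
          also have "\<dots> = (\<Oplus>\<^bsub>M\<^esub>A\<in>PR. gact M (rep A) (summand u x C))"
          proof (rule M.finsum_cong')
            fix A assume "A \<in> PR"
            then have h: "(rep A) \<in> P" by (rule PR_rep(2))
            then show "summand u x (?r A) = gact M (rep A) (summand u x C)"
              using gact_summand[OF uF xc Cc P.mem_carrier[OF h]] x E_iff by simp
          qed (use tr_fun[of "summand u x C"] Cc in simp_all)
          also have "\<dots> = tr (summand u x C)" unfolding tr_eq ..
          also have "\<dots> \<in> T" unfolding T_def using Cc by simp
          finally show ?thesis using TD by blast
        qed
      qed
      have F: "summand u x \<in> \<Omega> \<rightarrow> carrier M" using psubset.prems(1) by auto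
      have "(\<Oplus>\<^bsub>M\<^esub>C\<in>orb \<union> (\<Omega> - orb). summand u x C)
          = (\<Oplus>\<^bsub>M\<^esub>C\<in>orb. summand u x C) \<oplus>\<^bsub>M\<^esub> (\<Oplus>\<^bsub>M\<^esub>C\<in>\<Omega> - orb. summand u x C)"
        by (rule M.finsum_Un_disjoint) (use F orb\<Omega> psubset.hyps finite_subset in auto)
      moreover have "orb \<union> (\<Omega> - orb) = \<Omega>" using orb\<Omega> by blast
      ultimately show ?thesis using submoduleE(5)[OF D] orbit rest by simp
    qed
  qed
qed

text \<open>Write y as \<open>extend u x\<close> with x fixed by P and sum over all cosets by
  \<open>sum_stable_in\<close>. D is only a subspace here; stability under the normaliser is
  demanded for the translates of u alone, which permits the choice of D made in the proof of
  \<open>centralizer_submodule_eq_E\<close>.\<close>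

lemma generate_E:
  assumes u: "u \<in> E" "f u \<noteq> \<zero>"
    and D: "submodule D k M" "T \<subseteq> D" "\<And>n. n \<in> normalizer G P \<Longrightarrow> gact M n u \<in> D"
  shows "E \<subseteq> D"
proof
  fix y assume "y \<in> E"
  then obtain x where x: "x \<in> E" "extend u x = y"
    using fixed_point_extend[of u y] u unfolding E_def by blast
  have "extend u x \<in> D"
    unfolding extend_def
  proof (rule sum_stable_in[OF u(1) x(1) D order_refl])
    fix q C assume "q \<in> P" "C \<in> cosets"
    then show "q <#\<^bsub>G\<^esub> C \<in> cosets"
      using G.lcoset_translate[OF P.subgroup_axioms] P.mem_carrier by simp
  qed
  then show "y \<in> D" using x by simp
qed

end

lemma (in abelian_group) minus_zero_right: "x \<in> carrier G \<Longrightarrow> x \<ominus> \<zero> = x"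
  unfolding a_minus_def by (metis a_inv_closed l_neg r_neg1 r_zero zero_closed)

lemma (in abelian_group) finsum_minus:
  assumes "F \<in> I \<rightarrow> carrier G" "H \<in> I \<rightarrow> carrier G"
  shows "(\<Oplus>i\<in>I. F i \<ominus> H i) = (\<Oplus>i\<in>I. F i) \<ominus> (\<Oplus>i\<in>I. H i)"
proof -
  have d: "(\<lambda>i. F i \<ominus> H i) \<in> I \<rightarrow> carrier G" using assms by auto
  have "(\<Oplus>i\<in>I. F i) = (\<Oplus>i\<in>I. (F i \<ominus> H i) \<oplus> H i)"
    by (rule finsum_cong') (use assms in \<open>auto simp: a_minus_def a_assoc l_neg Pi_def\<close>)
  also have "\<dots> = (\<Oplus>i\<in>I. F i \<ominus> H i) \<oplus> (\<Oplus>i\<in>I. H i)"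
    by (rule finsum_addf[OF d assms(2)])
  finally show ?thesis
    using finsum_closed[OF d] finsum_closed[OF assms(2)] finsum_closed[OF assms(1)]
    unfolding a_minus_def by (simp add: add.inv_solve_right)
qed

lemma (in group) centralizer_subgroup:
  assumes "H \<subseteq> carrier G"
  shows "subgroup (centralizer G H) G"
proof (rule subgroupI)
  show "centralizer G H \<subseteq> carrier G" unfolding centralizer_def by blast
  show "centralizer G H \<noteq> {}"
    unfolding centralizer_def using assms by (auto intro!: exI[of _ \<one>] simp: subset_iff)
next
  fix a assume "a \<in> centralizer G H"
  then have a: "a \<in> carrier G" "\<And>h. h \<in> H \<Longrightarrow> a \<otimes> h = h \<otimes> a" unfolding centralizer_def by auto
  have "inv a \<otimes> h = h \<otimes> inv a" if h: "h \<in> H" for h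
  proof -
    have hG: "h \<in> carrier G" using h assms by blast
    have "inv a \<otimes> h = inv a \<otimes> (h \<otimes> a) \<otimes> inv a" using a(1) hG by (simp add: m_assoc)
    also have "\<dots> = inv a \<otimes> (a \<otimes> h) \<otimes> inv a" using a(2)[OF h] by simp
    also have "\<dots> = h \<otimes> inv a" using a(1) hG by (simp add: m_assoc[symmetric])
    finally show ?thesis .
  qed
  then show "inv a \<in> centralizer G H" using a(1) unfolding centralizer_def by simp
next
  fix a c assume "a \<in> centralizer G H" "c \<in> centralizer G H"
  then have a: "a \<in> carrier G" "\<And>h. h \<in> H \<Longrightarrow> a \<otimes> h = h \<otimes> a"
    and c: "c \<in> carrier G" "\<And>h. h \<in> H \<Longrightarrow> c \<otimes> h = h \<otimes> c" unfolding centralizer_def by auto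
  have "a \<otimes> c \<otimes> h = h \<otimes> (a \<otimes> c)" if h: "h \<in> H" for h
  proof -
    have hG: "h \<in> carrier G" using h assms by blast
    have "a \<otimes> c \<otimes> h = a \<otimes> (h \<otimes> c)" using a(1) c hG h by (simp add: m_assoc)
    also have "\<dots> = a \<otimes> h \<otimes> c" using a(1) c(1) hG by (simp add: m_assoc)
    also have "\<dots> = h \<otimes> (a \<otimes> c)" using a c(1) hG h by (simp add: m_assoc)
    finally show ?thesis .
  qed
  then show "a \<otimes> c \<in> centralizer G H" using a(1) c(1) unfolding centralizer_def by simp
qed

lemma (in group) centralizer_subset_normalizer:
  assumes "finite H" "H \<subseteq> carrier G"
  shows "centralizer G H \<subseteq> normalizer G H"
proof
  fix c assume c: "c \<in> centralizer G H"
  then have cG: "c \<in> carrier G" unfolding centralizer_def by simp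
  show "c \<in> normalizer G H"
  proof (rule normalizerI[OF assms cG])
    fix h assume h: "h \<in> H"
    then have hG: "h \<in> carrier G" using assms(2) by blast
    have "inv c \<otimes> h \<otimes> c = inv c \<otimes> (c \<otimes> h)"
      using c cG h hG unfolding centralizer_def by (simp add: m_assoc)
    also have "\<dots> = h" using cG hG by (simp add: m_assoc[symmetric])
    finally show "inv c \<otimes> h \<otimes> c \<in> H" using h by simp
  qed
qed

text \<open>For h in H the element c commutes with the conjugate of h by the inverse of n, which
  again lies in H. Translates by the normaliser of centraliser-stable subspaces are therefore stable
  too.\<close>

lemma (in group) centralizer_conj:
  assumes "subgroup H G" "n \<in> normalizer G H" "c \<in> centralizer G H"
  shows "n \<otimes> c \<otimes> inv n \<in> centralizer G H"
proof -
  note nc = normalizer_conj[OF assms(1,2)]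
  have n: "n \<in> carrier G" by (rule nc(1))
  have c: "c \<in> carrier G" "\<And>h. h \<in> H \<Longrightarrow> c \<otimes> h = h \<otimes> c" using assms(3) unfolding centralizer_def by auto
  have "n \<otimes> c \<otimes> inv n \<otimes> h = h \<otimes> (n \<otimes> c \<otimes> inv n)" if h: "h \<in> H" for h
  proof -
    have hG: "h \<in> carrier G" using subgroup.mem_carrier[OF assms(1) h] .
    let ?d = "inv n \<otimes> h \<otimes> n"
    have d: "?d \<in> carrier G" using n hG by simp
    have dh: "inv n \<otimes> h = ?d \<otimes> inv n" using n hG by (simp add: m_assoc)
    have "n \<otimes> c \<otimes> inv n \<otimes> h = n \<otimes> c \<otimes> (?d \<otimes> inv n)"
      using n hG c(1) dh by (simp add: m_assoc)
    also have "\<dots> = n \<otimes> (c \<otimes> ?d) \<otimes> inv n" using n hG c(1) by (simp add: m_assoc)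
    also have "c \<otimes> ?d = ?d \<otimes> c" by (rule c(2)[OF nc(3)[OF h]])
    also have "n \<otimes> (?d \<otimes> c) \<otimes> inv n = h \<otimes> (n \<otimes> c \<otimes> inv n)"
    proof -
      have "n \<otimes> ?d = h \<otimes> n" using n hG by (simp add: m_assoc[symmetric])
      then have "n \<otimes> (?d \<otimes> c) = h \<otimes> n \<otimes> c" using n c(1) d by (simp add: m_assoc[symmetric])
      then show ?thesis using n c(1) hG by (simp add: m_assoc)
    qed
    finally show ?thesis .
  qed
  then show ?thesis using n c(1) unfolding centralizer_def by simp
qed

section \<open>From the normaliser of P down to its centraliser\<close>

context scott_trivial_normal
begin

lemma finsum_const_k:
  assumes "a \<in> carrier k"
  shows "(\<Oplus>i\<in>I. a) = ([card I] \<cdot> \<one>) \<otimes> a"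
  using assms K.add.finprod_const[OF assms, of I] K.add_pow_ldistr[of \<one> a "card I"]
  by (simp add: add_pow_def)

lemma finsum_const_zero:
  assumes "x \<in> carrier M" "p dvd card I"
  shows "(\<Oplus>\<^bsub>M\<^esub>i\<in>I. x) = \<zero>\<^bsub>M\<^esub>"
proof -
  have "(\<Oplus>\<^bsub>M\<^esub>i\<in>I. x) = (\<Oplus>\<^bsub>M\<^esub>i\<in>I. \<one> \<odot>\<^bsub>M\<^esub> x)" using assms(1) by simp
  also have "\<dots> = (\<Oplus>i\<in>I. \<one>) \<odot>\<^bsub>M\<^esub> x" using assms(1) by (intro finsum_smult_rdistr[symmetric]) auto
  also have "(\<Oplus>i\<in>I. \<one>) = \<zero>"
    using char_p assms(2) finsum_const_k[of \<one> I] unfolding has_characteristic_def by simp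
  finally show ?thesis using assms(1) by simp
qed

lemma submodule_E: "submodule E k M"
  by (rule submoduleI') (auto simp: E_iff gact_add gact_smult P.mem_carrier)

lemma E_carrier: "E \<subseteq> carrier M" using E_iff by blast

lemma E_normalizer:
  assumes "n \<in> normalizer G P" "x \<in> E"
  shows "gact M n x \<in> E"
proof -
  note nc = G.normalizer_conj[OF P.subgroup_axioms assms(1)]
  have n [simp]: "n \<in> carrier G" by (rule nc(1))
  have x [simp]: "x \<in> carrier M" using assms(2) E_iff by blast
  have "gact M h (gact M n x) = gact M n x" if h: "h \<in> P" for h
  proof -
    have hG [simp]: "h \<in> carrier G" using h by (rule P.mem_carrier)
    have "gact M n x = gact M n (gact M (inv\<^bsub>G\<^esub> n \<otimes>\<^bsub>G\<^esub> h \<otimes>\<^bsub>G\<^esub> n) x)"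
      using nc(3)[OF h] assms(2) E_iff by simp
    also have "\<dots> = gact M h (gact M n x)" by (simp add: gact_mult)
    finally show ?thesis by simp
  qed
  then show ?thesis by (simp add: E_iff)
qed

lemma T_subset_E: "T \<subseteq> E"
proof
  fix t assume "t \<in> T"
  then obtain x where x [simp]: "x \<in> carrier M" and t: "t = tr x" unfolding T_def by blast
  have "gact M q (tr x) = tr x" if q: "q \<in> P" for q
  proof -
    have qG [simp]: "q \<in> carrier G" using q by (rule P.mem_carrier)
    have bij: "bij_betw (\<lambda>C. q <#\<^bsub>G\<^esub> C) PR PR"
      using PG.bij_betw_lcoset_translate[OF R_subgroup_P, of q] q by simp
    have qPR: "q <#\<^bsub>G\<^esub> C \<in> PR" if "C \<in> PR" for C using bij that by (rule bij_betw_apply)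
    have "gact M q (tr x) = (\<Oplus>\<^bsub>M\<^esub>C\<in>PR. gact M q (gact M (rep C) x))"
      unfolding tr_eq by (rule gact_finsum[OF qG tr_fun[OF x]])
    also have "\<dots> = (\<Oplus>\<^bsub>M\<^esub>C\<in>PR. gact M (rep (q <#\<^bsub>G\<^esub> C)) x)"
    proof (rule M.finsum_cong')
      fix C assume C: "C \<in> PR"
      define h where "h = rep C"
      have h: "h \<in> C" and hP: "h \<in> P" using PR_rep[OF C] unfolding h_def by auto
      have "q \<otimes>\<^bsub>G\<^esub> h \<in> q <#\<^bsub>G\<^esub> C" using h unfolding l_coset_def by blast
      then have "gact M (rep (q <#\<^bsub>G\<^esub> C)) x = gact M q (gact M h x)"
        using PR_act[OF qPR[OF C] _ x] P.mem_carrier[OF hP] by (simp add: gact_mult)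
      then show "gact M q (gact M (rep C) x) = gact M (rep (q <#\<^bsub>G\<^esub> C)) x"
        unfolding h_def by simp
    qed (use tr_fun[OF x] qPR in auto)
    also have "\<dots> = (\<Oplus>\<^bsub>M\<^esub>C\<in>(\<lambda>C. q <#\<^bsub>G\<^esub> C) ` PR. gact M (rep C) x)"
      by (rule M.finsum_reindex[symmetric])
        (use bij tr_fun[OF x] in \<open>simp_all add: bij_betw_def\<close>)
    also have "(\<lambda>C. q <#\<^bsub>G\<^esub> C) ` PR = PR" using bij by (simp add: bij_betw_def)
    finally show ?thesis unfolding tr_eq .
  qed
  then show "t \<in> E" unfolding t by (simp add: E_iff)
qed

lemma card_PR: "card PR = p"
proof -
  have "card PR * card R = p * card R"
    using PG.l_lagrange[OF _ R_subgroup_P] finite_P card_P by (simp add: order_def)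
  moreover have "card R > 0"
    using subgroup.one_closed[OF R.subgroup_axioms] finite_subset[OF R_subset_P finite_P]
    by (metis card_gt_0_iff empty_iff)
  ultimately show ?thesis by simp
qed

text \<open>f takes the same value on the p translates of a vector, and p is zero in k. So f
  descends to E/T.\<close>

lemma f_T:
  assumes "t \<in> T"
  shows "f t = \<zero>"
proof -
  obtain x where x: "x \<in> carrier M" "t = tr x" using assms unfolding T_def by blast
  have "f t = (\<Oplus>C\<in>PR. f (gact M (rep C) x))"
    unfolding x(2) tr_eq by (rule f_finsum[OF tr_fun[OF x(1)]])
  also have "\<dots> = (\<Oplus>C\<in>PR. f x)"
    by (rule K.finsum_cong') (use x PR_rep(2) P.mem_carrier in \<open>simp_all add: f_gact\<close>)
  also have "\<dots> = ([p] \<cdot> \<one>) \<otimes> f x" using x card_PR by (simp add: finsum_const_k)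
  also have "[p] \<cdot> \<one> = \<zero>" using char_p unfolding has_characteristic_def by simp
  finally show ?thesis using x by simp
qed

text \<open>The kernel of f on E/T is the unique maximal submodule for the normaliser of P, by
  \<open>generate_E\<close>. For the centraliser, a maximal submodule A has finitely many conjugates, whose
  intersection D is stable under the normaliser; E/D is semisimple for the centraliser, so the
  quotient map f splits, and averaging the splitting over a group of order prime to p makes it
  equivariant for the normaliser. This forces D, hence A, to be the kernel of f.\<close>

lemma centralizer_submodule_eq_E:
  assumes index: "\<not> p dvd card (rcosets\<^bsub>G\<lparr>carrier := normalizer G P\<rparr>\<^esub> (P <#>\<^bsub>G\<^esub> centralizer G P))"
    and A: "submodule A k M" "A \<subseteq> E" "T \<subseteq> A"
      "\<And>c a. \<lbrakk>c \<in> centralizer G P; a \<in> A\<rbrakk> \<Longrightarrow> gact M c a \<in> A"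
    and fA: "\<exists>a\<in>A. f a \<noteq> \<zero>"
  shows "A = E"
proof (rule ccontr)
  assume "A \<noteq> E"
  define N where "N = normalizer G P"
  define C where "C = centralizer G P"
  have N_sub: "subgroup N G"
    unfolding N_def by (rule G.normalizer_imp_subgroup[OF P.subset])
  interpret N: subgroup N G by (rule N_sub)
  have C_sub: "subgroup C G" unfolding C_def by (rule G.centralizer_subgroup[OF P.subset])
  interpret C: subgroup C G by (rule C_sub)
  note Nc [simp] = N.mem_carrier and Cc [simp] = C.mem_carrier
  have finN: "finite N" using finite_subset[OF N.subset finite_G] .
  have Ec [simp]: "x \<in> carrier M" if "x \<in> E" for x using that E_carrier by blast
  note sE = submoduleE[OF submodule_E]

  define good where "good = (\<lambda>Z. submodule Z k M \<and> Z \<subseteq> E \<and> (\<forall>c\<in>C. \<forall>z\<in>Z. gact M c z \<in> Z))"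
  obtain rk :: "'m set \<Rightarrow> nat" and d where rk_le: "\<And>Z. rk Z \<le> d"
    and rk: "\<And>Y Z. \<lbrakk>submodule Y k M; submodule Z k M; Y \<subset> Z\<rbrakk> \<Longrightarrow> rk Y < rk Z"
    using rank_exists by blast
  \<comment> \<open>A proper C-stable subspace of greatest rank above A is maximal; it is called
    \<open>B\<close>.\<close>
  let ?proper = "\<lambda>Z. good Z \<and> Z \<noteq> E \<and> A \<subseteq> Z"
  have "?proper A" using A \<open>A \<noteq> E\<close> unfolding good_def C_def by simp
  then have "\<exists>B. ?proper B \<and> (\<forall>Z. ?proper Z \<longrightarrow> rk Z \<le> rk B)"
    by (rule ex_has_greatest_nat[of _ _ _ "Suc d"]) (simp add: rk_le le_imp_less_Suc)
  then obtain B where B: "good B" "B \<noteq> E" "A \<subseteq> B"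
    and Bmax: "\<And>Z. good Z \<Longrightarrow> Z \<noteq> E \<Longrightarrow> A \<subseteq> Z \<Longrightarrow> rk Z \<le> rk B"
    by auto
  have B_max: "Z = E" if "good Z" "B \<subset> Z" for Z
  proof (rule ccontr)
    assume "Z \<noteq> E"
    then have "rk Z \<le> rk B" using Bmax that B(3) by blast
    moreover have "rk B < rk Z" using rk that B(1) unfolding good_def by blast
    ultimately show False by simp
  qed
  have B_sub: "submodule B k M" and BE: "B \<subseteq> E"
    and B_C: "\<And>c z. \<lbrakk>c \<in> C; z \<in> B\<rbrakk> \<Longrightarrow> gact M c z \<in> B"
    using B(1) unfolding good_def by auto
  note sB = submoduleE[OF B_sub]
  have TB: "T \<subseteq> B" using A(3) B(3) by blast

  \<comment> \<open>The intersection of the translates of B by the inverses of the elements of I.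
    \<open>Y {}\<close> is E, and \<open>Y N\<close> is the largest N-stable subspace of B.\<close>
  define Y where "Y = (\<lambda>I. {e \<in> E. \<forall>n\<in>I. gact M n e \<in> B})"
  have conj: "gact M n (gact M c e) = gact M (n \<otimes>\<^bsub>G\<^esub> c \<otimes>\<^bsub>G\<^esub> inv\<^bsub>G\<^esub> n) (gact M n e)"
    if "n \<in> N" "c \<in> C" "e \<in> carrier M" for n c e
    using that by (simp add: gact_mult)
  have conjC: "n \<otimes>\<^bsub>G\<^esub> c \<otimes>\<^bsub>G\<^esub> inv\<^bsub>G\<^esub> n \<in> C" if "n \<in> N" "c \<in> C" for n c
    using G.centralizer_conj[OF P.subgroup_axioms] that unfolding N_def C_def by simp
  have CN: "c \<in> N" if "c \<in> C" for c
    using G.centralizer_subset_normalizer[OF finite_P P.subset] that unfolding N_def C_def by blast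
  have NE: "gact M n e \<in> E" if "n \<in> N" "e \<in> E" for n e
    using E_normalizer that unfolding N_def by blast
  have Y_good: "good (Y I)" if I: "I \<subseteq> N" for I
  proof -
    have "submodule (Y I) k M"
    proof (rule submoduleI')
      show "Y I \<subseteq> carrier M" unfolding Y_def using E_carrier by blast
      show "\<zero>\<^bsub>M\<^esub> \<in> Y I"
        unfolding Y_def using submodule_zero[OF submodule_E] submodule_zero[OF B_sub] I by auto
    next
      fix a b assume "a \<in> Y I" "b \<in> Y I"
      then show "a \<oplus>\<^bsub>M\<^esub> b \<in> Y I" unfolding Y_def using I sE(5) sB(5) by (auto simp: gact_add)
    next
      fix a x assume "a \<in> carrier k" "x \<in> Y I"
      then show "a \<odot>\<^bsub>M\<^esub> x \<in> Y I" unfolding Y_def using I sE(4) sB(4) by (auto simp: gact_smult)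
    qed
    moreover have "gact M c z \<in> Y I" if c: "c \<in> C" and z: "z \<in> Y I" for c z
    proof -
      have zE: "z \<in> E" using z unfolding Y_def by blast
      have "gact M n (gact M c z) \<in> B" if "n \<in> I" for n
        using conj[of n c z] conjC[of n c] B_C z that I c zE unfolding Y_def by auto
      then show ?thesis using NE[OF CN[OF c] zE] unfolding Y_def by blast
    qed
    moreover have "Y I \<subseteq> E" unfolding Y_def by blast
    ultimately show ?thesis unfolding good_def by blast
  qed
  obtain a0 where a0: "a0 \<in> B" "f a0 \<noteq> \<zero>" using fA B(3) by blast
  have a0E: "a0 \<in> E" using a0 BE by blast
  define D where "D = Y N"
  have D_good: "good D" unfolding D_def by (rule Y_good) simp
  then have D_sub: "submodule D k M" and DE: "D \<subseteq> E" unfolding good_def by auto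
  note sD = submoduleE[OF D_sub]
  have Dc [simp]: "x \<in> carrier M" if "x \<in> D" for x using that DE by auto
  have D_N: "gact M n x \<in> D" if n: "n \<in> N" and x: "x \<in> D" for n x
  proof -
    have xE: "x \<in> E" using x DE by blast
    have "gact M m (gact M n x) \<in> B" if "m \<in> N" for m
    proof -
      have "gact M (m \<otimes>\<^bsub>G\<^esub> n) x \<in> B" using x N.m_closed[OF that n] unfolding D_def Y_def by blast
      then show ?thesis using that n xE by (simp add: gact_mult)
    qed
    then show ?thesis unfolding D_def Y_def using NE[OF n xE] by blast
  qed
  have DB: "D \<subseteq> B"
  proof
    fix x assume x: "x \<in> D"
    then have "gact M \<one>\<^bsub>G\<^esub> x \<in> B" unfolding D_def Y_def using N.one_closed by blast
    then show "x \<in> B" using x by simp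
  qed
  have TD: "T \<subseteq> D"
  proof
    fix t assume t: "t \<in> T"
    then obtain x where x: "x \<in> carrier M" "t = tr x" unfolding T_def by blast
    have "gact M n t \<in> B" if n: "n \<in> N" for n
    proof -
      have "gact M n t = tr (gact M n x)" using gact_tr n x unfolding N_def by blast
      then have "gact M n t \<in> T" unfolding T_def using x n by simp
      then show ?thesis using TB by blast
    qed
    then show "t \<in> D" unfolding D_def Y_def using t T_subset_E by blast
  qed
  have "\<exists>y\<in>Y {}. f y \<noteq> \<zero>" using a0(2) a0E unfolding Y_def by blast
  \<comment> \<open>A largest I with f nonzero on \<open>Y I\<close> does the work of
    semisimplicity: \<open>Y I\<close> meets ker f inside D, so any y in \<open>Y I\<close> with
    f(y) nonzero is a splitting of f modulo D.\<close>
  let ?split = "\<lambda>I. I \<subseteq> N \<and> (\<exists>y\<in>Y I. f y \<noteq> \<zero>)"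
  have "?split {}" using \<open>\<exists>y\<in>Y {}. f y \<noteq> \<zero>\<close> by simp
  then have "\<exists>I. ?split I \<and> (\<forall>J. ?split J \<longrightarrow> card J \<le> card I)"
    by (rule ex_has_greatest_nat[of _ _ _ "Suc (card N)"])
      (simp add: card_mono[OF finN] le_imp_less_Suc)
  then obtain I where I: "I \<subseteq> N" "\<exists>y\<in>Y I. f y \<noteq> \<zero>"
    and Imax: "\<And>J. J \<subseteq> N \<Longrightarrow> (\<exists>y\<in>Y J. f y \<noteq> \<zero>) \<Longrightarrow> card J \<le> card I"
    by (elim exE conjE) simp
  have YI_good: "good (Y I)" by (rule Y_good[OF I(1)])
  then have YI_sub: "submodule (Y I) k M" and YI_E: "Y I \<subseteq> E"
    and YI_C: "\<And>c z. \<lbrakk>c \<in> C; z \<in> Y I\<rbrakk> \<Longrightarrow> gact M c z \<in> Y I"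
    unfolding good_def by auto
  note sY = submoduleE[OF YI_sub]
  have YI_D: "z \<in> D" if z: "z \<in> Y I" and fz: "f z = \<zero>" for z
  proof -
    have zE: "z \<in> E" using z YI_E by blast
    have "gact M j z \<in> B" if j: "j \<in> N" for j
    proof (rule ccontr)
      assume not: "gact M j z \<notin> B"
      then have jI: "j \<notin> I" using z unfolding Y_def by blast
      have "card (insert j I) > card I" using jI finite_subset[OF I(1) finN] by simp
      then have f0: "f y = \<zero>" if "y \<in> Y (insert j I)" for y
        using Imax[of "insert j I"] that I(1) j by fastforce
      \<comment> \<open>With W the part of \<open>Y I\<close> in ker f, the subspace Z is B + jW. It
        is C-stable because j normalises C, and it contains B properly because of jz, so maximality
        of B gives Z = E.\<close>
      define W where "W = {z \<in> Y I. f z = \<zero>}"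
      define Z where "Z = {e \<in> E. \<exists>w\<in>W. e \<ominus>\<^bsub>M\<^esub> gact M j w \<in> B}"
      have Wc: "w \<in> carrier M" "w \<in> E" if "w \<in> W" for w using that YI_E unfolding W_def by auto
      have W_add: "v \<oplus>\<^bsub>M\<^esub> w \<in> W" if "v \<in> W" "w \<in> W" for v w
        using that sY(5) Wc[OF that(1)] Wc[OF that(2)] unfolding W_def by (simp add: f_add)
      have W_smult: "a \<odot>\<^bsub>M\<^esub> w \<in> W" if "a \<in> carrier k" "w \<in> W" for a w
        using that sY(4) Wc[OF that(2)] unfolding W_def by (simp add: f_smult)
      have W_C: "gact M c w \<in> W" if "c \<in> C" "w \<in> W" for c w
        using that YI_C Wc[OF that(2)] unfolding W_def by (simp add: f_gact)
      have W_0: "\<zero>\<^bsub>M\<^esub> \<in> W" using submodule_zero[OF YI_sub] unfolding W_def by simp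
      have jG [simp]: "j \<in> carrier G" using j by simp
      have "submodule Z k M"
      proof (rule submoduleI')
        show "Z \<subseteq> carrier M" unfolding Z_def by auto
        show "\<zero>\<^bsub>M\<^esub> \<in> Z" unfolding Z_def
          using W_0 submodule_zero[OF submodule_E] submodule_zero[OF B_sub]
          by (auto intro!: bexI[of _ "\<zero>\<^bsub>M\<^esub>"] simp: M.minus_zero_right subset_iff)
      next
        fix a b assume "a \<in> Z" "b \<in> Z"
        then obtain v w where v: "v \<in> W" "a \<in> E" "a \<ominus>\<^bsub>M\<^esub> gact M j v \<in> B"
          and w: "w \<in> W" "b \<in> E" "b \<ominus>\<^bsub>M\<^esub> gact M j w \<in> B" unfolding Z_def by auto
        have "(a \<oplus>\<^bsub>M\<^esub> b) \<ominus>\<^bsub>M\<^esub> gact M j (v \<oplus>\<^bsub>M\<^esub> w)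
            = (a \<ominus>\<^bsub>M\<^esub> gact M j v) \<oplus>\<^bsub>M\<^esub> (b \<ominus>\<^bsub>M\<^esub> gact M j w)"
          using v(1,2) w(1,2) Wc unfolding a_minus_def by (simp add: gact_add M.minus_add M.a_ac)
        then have "(a \<oplus>\<^bsub>M\<^esub> b) \<ominus>\<^bsub>M\<^esub> gact M j (v \<oplus>\<^bsub>M\<^esub> w) \<in> B" using sB(5) v(3) w(3) by simp
        then show "a \<oplus>\<^bsub>M\<^esub> b \<in> Z" unfolding Z_def using W_add[OF v(1) w(1)] sE(5)[OF v(2) w(2)] by blast
      next
        fix a x assume a: "a \<in> carrier k" and "x \<in> Z"
        then obtain w where w: "w \<in> W" "x \<in> E" "x \<ominus>\<^bsub>M\<^esub> gact M j w \<in> B" unfolding Z_def by auto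
        have "a \<odot>\<^bsub>M\<^esub> x \<ominus>\<^bsub>M\<^esub> gact M j (a \<odot>\<^bsub>M\<^esub> w) = a \<odot>\<^bsub>M\<^esub> (x \<ominus>\<^bsub>M\<^esub> gact M j w)"
          using a w(1,2) Wc unfolding a_minus_def by (simp add: gact_smult smult_r_distr smult_r_minus)
        then have "a \<odot>\<^bsub>M\<^esub> x \<ominus>\<^bsub>M\<^esub> gact M j (a \<odot>\<^bsub>M\<^esub> w) \<in> B" using sB(4) a w(3) by simp
        then show "a \<odot>\<^bsub>M\<^esub> x \<in> Z" unfolding Z_def using W_smult[OF a w(1)] sE(4)[OF a w(2)] by blast
      qed
      moreover have "gact M c e \<in> Z" if c: "c \<in> C" and "e \<in> Z" for c e
      proof -
        obtain w where w: "w \<in> W" "e \<in> E" "e \<ominus>\<^bsub>M\<^esub> gact M j w \<in> B" using \<open>e \<in> Z\<close> unfolding Z_def by auto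
        let ?c = "inv\<^bsub>G\<^esub> j \<otimes>\<^bsub>G\<^esub> c \<otimes>\<^bsub>G\<^esub> j"
        have c': "?c \<in> C" using conjC[OF N.m_inv_closed[OF j] c] by simp
        have "gact M c (e \<ominus>\<^bsub>M\<^esub> gact M j w) = gact M c e \<ominus>\<^bsub>M\<^esub> gact M j (gact M ?c w)"
          using w c Wc by (simp add: gact_minus gact_mult)
        then have "gact M c e \<ominus>\<^bsub>M\<^esub> gact M j (gact M ?c w) \<in> B" using B_C[OF c w(3)] by simp
        then show ?thesis unfolding Z_def using W_C[OF c' w(1)] NE[OF CN[OF c] w(2)] by blast
      qed
      ultimately have Zgood: "good Z" unfolding good_def Z_def by blast
      have "B \<subseteq> Z" unfolding Z_def using W_0 BE by (auto intro!: bexI[of _ "\<zero>\<^bsub>M\<^esub>"] simp: M.minus_zero_right subset_iff)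
      moreover have "gact M j z \<in> Z"
      proof -
        have "gact M j z \<ominus>\<^bsub>M\<^esub> gact M j z = \<zero>\<^bsub>M\<^esub>" using zE by (simp add: M.minus_eq_zero_iff)
        then have "z \<in> W" "gact M j z \<ominus>\<^bsub>M\<^esub> gact M j z \<in> B"
          using z fz submodule_zero[OF B_sub] by (simp_all add: W_def)
        then show ?thesis unfolding Z_def using NE[OF j zE] by blast
      qed
      ultimately have ZE: "Z = E" using B_max[OF Zgood] not by blast
      \<comment> \<open>Writing jy as an element of B plus jw puts y - w into
        \<open>Y (insert j I)\<close>, where f vanishes by the choice of I; since f(w) = 0, f would
        vanish on \<open>Y I\<close>.\<close>
      have "f y = \<zero>" if y: "y \<in> Y I" for y
      proof -
        have yE: "y \<in> E" using y YI_E by blast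
        then have "gact M j y \<in> Z" using NE[OF j] ZE by blast
        then obtain w where w: "w \<in> W" "gact M j y \<ominus>\<^bsub>M\<^esub> gact M j w \<in> B" unfolding Z_def by blast
        have wY: "w \<in> Y I" using w(1) unfolding W_def by blast
        have "y \<ominus>\<^bsub>M\<^esub> w \<in> Y I" using submodule_minus[OF YI_sub y wY] .
        moreover have "gact M j (y \<ominus>\<^bsub>M\<^esub> w) \<in> B" using w yE Wc by (simp add: gact_minus)
        ultimately have "y \<ominus>\<^bsub>M\<^esub> w \<in> Y (insert j I)" unfolding Y_def by blast
        then have "f (y \<ominus>\<^bsub>M\<^esub> w) = \<zero>" by (rule f0)
        then show ?thesis using w(1) yE Wc[OF w(1)] unfolding W_def by (simp add: f_minus)
      qed
      then show False using I(2) by blast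
    qed
    then show ?thesis unfolding D_def Y_def using zE by blast
  qed

  obtain y where y: "y \<in> Y I" "f y \<noteq> \<zero>" using I(2) by blast
  have yE [simp]: "y \<in> E" using y YI_E by blast
  \<comment> \<open>The difference lies in \<open>Y I\<close>, and in ker f by invariance of f,
    hence in D.\<close>
  have y_C: "gact M c y \<ominus>\<^bsub>M\<^esub> y \<in> D" if "c \<in> C" for c
    using that YI_D[OF submodule_minus[OF YI_sub YI_C[OF that y(1)] y(1)]]
    by (simp add: f_minus f_gact)
  define NX where "NX = rcosets\<^bsub>G\<lparr>carrier := N\<rparr>\<^esub> (P <#>\<^bsub>G\<^esub> C)"
  have NX_eq: "NX = (\<lambda>n. (P <#>\<^bsub>G\<^esub> C) #>\<^bsub>G\<^esub> n) ` N" unfolding NX_def RCOSETS_def by auto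
  have PC_sub: "P <#>\<^bsub>G\<^esub> C \<subseteq> carrier G"
    using G.setmult_subset_G[OF P.subset C.subset] .
  have finNX: "finite NX" unfolding NX_eq using finN by simp
  have "\<one>\<^bsub>G\<^esub> \<otimes>\<^bsub>G\<^esub> \<one>\<^bsub>G\<^esub> \<in> P <#>\<^bsub>G\<^esub> C"
    unfolding set_mult_def by (intro UN_I[OF P.one_closed] UN_I[OF C.one_closed]) simp
  then have one: "\<one>\<^bsub>G\<^esub> \<in> P <#>\<^bsub>G\<^esub> C" by simp
  have n_in: "n \<in> (P <#>\<^bsub>G\<^esub> C) #>\<^bsub>G\<^esub> n" if "n \<in> N" for n
  proof -
    have "\<one>\<^bsub>G\<^esub> \<otimes>\<^bsub>G\<^esub> n \<in> (P <#>\<^bsub>G\<^esub> C) #>\<^bsub>G\<^esub> n"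
      unfolding r_coset_def by (intro UN_I[OF one]) simp
    then show ?thesis using that by simp
  qed
  have PN: "q \<in> N" if q: "q \<in> P" for q
    unfolding N_def
    by (rule G.normalizerI[OF finite_P P.subset P.mem_carrier[OF q]])
      (intro P.m_closed P.m_inv_closed q)
  \<comment> \<open>P fixes y and C fixes it modulo D, so the translate of y by the inverse of n
    depends, modulo D, only on the right coset of n under PC.\<close>
  have coset_mem: "h \<in> N \<and> gact M (inv\<^bsub>G\<^esub> h) y \<ominus>\<^bsub>M\<^esub> gact M (inv\<^bsub>G\<^esub> n) y \<in> D"
    if n: "n \<in> N" and hn: "h \<in> (P <#>\<^bsub>G\<^esub> C) #>\<^bsub>G\<^esub> n" for h n
  proof -
    obtain q c where q: "q \<in> P" and c: "c \<in> C" and h: "h = q \<otimes>\<^bsub>G\<^esub> c \<otimes>\<^bsub>G\<^esub> n"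
      using hn unfolding r_coset_def set_mult_def by auto
    have qG: "q \<in> carrier G" using q by (rule P.mem_carrier)
    have "gact M (inv\<^bsub>G\<^esub> h) y = gact M (inv\<^bsub>G\<^esub> n) (gact M (inv\<^bsub>G\<^esub> c) (gact M (inv\<^bsub>G\<^esub> q) y))"
      unfolding h using n c qG by (simp add: G.inv_mult_group gact_mult)
    also have "gact M (inv\<^bsub>G\<^esub> q) y = y" using yE P.m_inv_closed[OF q] unfolding E_iff by blast
    finally have "gact M (inv\<^bsub>G\<^esub> h) y \<ominus>\<^bsub>M\<^esub> gact M (inv\<^bsub>G\<^esub> n) y
        = gact M (inv\<^bsub>G\<^esub> n) (gact M (inv\<^bsub>G\<^esub> c) y \<ominus>\<^bsub>M\<^esub> y)"
      using n c by (simp add: gact_minus)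
    then show ?thesis
      using D_N[OF N.m_inv_closed[OF n] y_C[OF C.m_inv_closed[OF c]]]
        N.m_closed[OF N.m_closed[OF PN[OF q] CN[OF c]] n] h by simp
  qed
  have NX_D: "\<exists>n\<in>N. L = (P <#>\<^bsub>G\<^esub> C) #>\<^bsub>G\<^esub> n" if "L \<in> NX" for L
    using that unfolding NX_eq image_iff .
  have r_in: "rep L \<in> L" if L: "L \<in> NX" for L
  proof -
    obtain n where "n \<in> N" "L = (P <#>\<^bsub>G\<^esub> C) #>\<^bsub>G\<^esub> n" using NX_D[OF L] by (elim bexE)
    then have "n \<in> L" using n_in by simp
    then show ?thesis by (rule someI)
  qed
  have NX_N: "h \<in> N" if L: "L \<in> NX" and h: "h \<in> L" for L h
  proof -
    obtain n where n: "n \<in> N" "L = (P <#>\<^bsub>G\<^esub> C) #>\<^bsub>G\<^esub> n" using NX_D[OF L] by (elim bexE)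
    show ?thesis using coset_mem[OF n(1)] h unfolding n(2) by simp
  qed
  have same: "gact M (inv\<^bsub>G\<^esub> h) y \<ominus>\<^bsub>M\<^esub> gact M (inv\<^bsub>G\<^esub> h') y \<in> D"
    if L: "L \<in> NX" and h: "h \<in> L" and h': "h' \<in> L" for L h h'
  proof -
    obtain n where n: "n \<in> N" "L = (P <#>\<^bsub>G\<^esub> C) #>\<^bsub>G\<^esub> n" using NX_D[OF L] by (elim bexE)
    let ?a = "gact M (inv\<^bsub>G\<^esub> h) y" and ?b = "gact M (inv\<^bsub>G\<^esub> h') y" and ?n = "gact M (inv\<^bsub>G\<^esub> n) y"
    have c: "?a \<in> carrier M" "?b \<in> carrier M" "?n \<in> carrier M"
      using NX_N[OF L h] NX_N[OF L h'] n(1) by simp_all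
    have "(?a \<ominus>\<^bsub>M\<^esub> ?n) \<ominus>\<^bsub>M\<^esub> (?b \<ominus>\<^bsub>M\<^esub> ?n) \<in> D"
      using submodule_minus[OF D_sub] coset_mem[OF n(1)] h h' n(2) by blast
    moreover have "(?a \<ominus>\<^bsub>M\<^esub> ?n) \<ominus>\<^bsub>M\<^esub> (?b \<ominus>\<^bsub>M\<^esub> ?n) = ?a \<ominus>\<^bsub>M\<^esub> ?b"
    proof (rule M.minus_eq_minusI)
      show "?a \<ominus>\<^bsub>M\<^esub> ?n \<oplus>\<^bsub>M\<^esub> ?b = ?b \<ominus>\<^bsub>M\<^esub> ?n \<oplus>\<^bsub>M\<^esub> ?a"
        using c unfolding a_minus_def by (simp add: M.a_ac)
    qed (use c in simp_all)
    ultimately show ?thesis by simp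
  qed
  \<comment> \<open>The unnormalised average of y. Inverses occur because the cosets are right
    cosets; a change of representatives alters w only by an element of D.\<close>
  define w where "w = (\<Oplus>\<^bsub>M\<^esub>L\<in>NX. gact M (inv\<^bsub>G\<^esub> (rep L)) y)"
  have wF: "(\<lambda>L. gact M (inv\<^bsub>G\<^esub> (rep L)) y) \<in> NX \<rightarrow> carrier M" using NX_N r_in by auto
  have wE: "w \<in> E"
    unfolding w_def
    by (rule submodule_finsum[OF submodule_E], rule NE[OF N.m_inv_closed yE], rule NX_N, assumption, rule r_in)
  have wc [simp]: "w \<in> carrier M" using wE by simp
  have w_N: "gact M m w \<ominus>\<^bsub>M\<^esub> w \<in> D" if m: "m \<in> N" for m
  proof -
    \<comment> \<open>Right multiplication by the inverse of m permutes the cosets, and applying m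
      to the term at L gives, modulo D, the term at \<open>?t L\<close>.\<close>
    let ?t = "\<lambda>L. L #>\<^bsub>G\<^esub> inv\<^bsub>G\<^esub> m"
    have XG: "L \<subseteq> carrier G" if "L \<in> NX" for L using that NX_N Nc by blast
    have t_NX: "?t L \<in> NX" if L: "L \<in> NX" for L
    proof -
      obtain n where n: "n \<in> N" "L = (P <#>\<^bsub>G\<^esub> C) #>\<^bsub>G\<^esub> n" using NX_D[OF L] by (elim bexE)
      then have "?t L = (P <#>\<^bsub>G\<^esub> C) #>\<^bsub>G\<^esub> (n \<otimes>\<^bsub>G\<^esub> inv\<^bsub>G\<^esub> m)"
        using m PC_sub by (simp add: G.coset_mult_assoc)
      then show ?thesis unfolding NX_eq using N.m_closed[OF n(1) N.m_inv_closed[OF m]] by blast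
    qed
    have inj: "inj_on ?t NX"
    proof (rule inj_on_inverseI)
      fix L assume "L \<in> NX"
      then show "?t L #>\<^bsub>G\<^esub> m = L" using XG m by (simp add: G.coset_mult_assoc)
    qed
    have img: "?t ` NX = NX"
      by (rule endo_inj_surj[OF finNX _ inj]) (intro image_subsetI t_NX)
    have "w = (\<Oplus>\<^bsub>M\<^esub>L\<in>?t ` NX. gact M (inv\<^bsub>G\<^esub> (rep L)) y)" unfolding img w_def ..
    also have "\<dots> = (\<Oplus>\<^bsub>M\<^esub>L\<in>NX. gact M (inv\<^bsub>G\<^esub> (rep (?t L))) y)"
      by (rule M.finsum_reindex[OF _ inj]) (use img wF in simp)
    finally have w2: "w = (\<Oplus>\<^bsub>M\<^esub>L\<in>NX. gact M (inv\<^bsub>G\<^esub> (rep (?t L))) y)" .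
    have "gact M m w = (\<Oplus>\<^bsub>M\<^esub>L\<in>NX. gact M m (gact M (inv\<^bsub>G\<^esub> (rep L)) y))"
      unfolding w_def by (rule gact_finsum[OF Nc[OF m] wF])
    then have "gact M m w \<ominus>\<^bsub>M\<^esub> w
        = (\<Oplus>\<^bsub>M\<^esub>L\<in>NX. gact M m (gact M (inv\<^bsub>G\<^esub> (rep L)) y)) \<ominus>\<^bsub>M\<^esub> (\<Oplus>\<^bsub>M\<^esub>L\<in>NX. gact M (inv\<^bsub>G\<^esub> (rep (?t L))) y)"
      using w2 by simp
    also have "\<dots> = (\<Oplus>\<^bsub>M\<^esub>L\<in>NX. gact M m (gact M (inv\<^bsub>G\<^esub> (rep L)) y) \<ominus>\<^bsub>M\<^esub> gact M (inv\<^bsub>G\<^esub> (rep (?t L))) y)"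
    proof (rule M.finsum_minus[symmetric])
      show "(\<lambda>L. gact M m (gact M (inv\<^bsub>G\<^esub> (rep L)) y)) \<in> NX \<rightarrow> carrier M"
        by (rule funcsetI) (use funcset_mem[OF wF] Nc[OF m] in simp)
      show "(\<lambda>L. gact M (inv\<^bsub>G\<^esub> (rep (?t L))) y) \<in> NX \<rightarrow> carrier M"
        by (rule funcsetI) (rule funcset_mem[OF wF t_NX])
    qed
    also have "\<dots> \<in> D"
    proof (rule submodule_finsum[OF D_sub])
      fix L assume L: "L \<in> NX"
      have rN: "rep L \<in> N" using NX_N[OF L r_in[OF L]] .
      have "rep L \<otimes>\<^bsub>G\<^esub> inv\<^bsub>G\<^esub> m \<in> ?t L" using r_in[OF L] unfolding r_coset_def by blast
      then have "gact M (inv\<^bsub>G\<^esub> (rep L \<otimes>\<^bsub>G\<^esub> inv\<^bsub>G\<^esub> m)) y \<ominus>\<^bsub>M\<^esub> gact M (inv\<^bsub>G\<^esub> (rep (?t L))) y \<in> D"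
        using same[OF t_NX[OF L]] r_in[OF t_NX[OF L]] by blast
      then show "gact M m (gact M (inv\<^bsub>G\<^esub> (rep L)) y) \<ominus>\<^bsub>M\<^esub> gact M (inv\<^bsub>G\<^esub> (rep (?t L))) y \<in> D"
        using rN m by (simp add: G.inv_mult_group gact_mult)
    qed
    finally show ?thesis .
  qed
  \<comment> \<open>f(w) is the number of cosets times f(y); that number is nonzero in k as p does
    not divide it.\<close>
  have fw: "f w \<noteq> \<zero>"
  proof -
    have "f w = (\<Oplus>L\<in>NX. f (gact M (inv\<^bsub>G\<^esub> (rep L)) y))" unfolding w_def by (rule f_finsum[OF wF])
    also have "\<dots> = (\<Oplus>L\<in>NX. f y)"
      by (rule K.finsum_cong') (use NX_N r_in in \<open>simp_all add: f_gact\<close>)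
    also have "\<dots> = ([card NX] \<cdot> \<one>) \<otimes> f y" by (simp add: finsum_const_k)
    finally have "f w = ([card NX] \<cdot> \<one>) \<otimes> f y" .
    moreover have "[card NX] \<cdot> \<one> \<noteq> \<zero>"
      using char_p index unfolding has_characteristic_def NX_def N_def C_def by simp
    ultimately show ?thesis using y(2) K.integral_iff[of "[card NX] \<cdot> \<one>" "f y"] by simp
  qed
  define e where "e = inv (f w) \<odot>\<^bsub>M\<^esub> w"
  have "f w \<in> Units k" using fw K.field_Units by simp
  then have ifw [simp]: "inv (f w) \<in> carrier k" and "inv (f w) \<otimes> f w = \<one>" by auto
  then have fe: "f e = \<one>" unfolding e_def by (simp add: f_smult)
  have eE: "e \<in> E" unfolding e_def using sE(4)[OF ifw wE] .
  have ec [simp]: "e \<in> carrier M" using eE by simp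
  have e_N: "gact M m e \<ominus>\<^bsub>M\<^esub> e \<in> D" if m: "m \<in> N" for m
  proof -
    have "gact M m e \<ominus>\<^bsub>M\<^esub> e = inv (f w) \<odot>\<^bsub>M\<^esub> (gact M m w \<ominus>\<^bsub>M\<^esub> w)"
      unfolding e_def a_minus_def using m by (simp add: gact_smult smult_r_distr smult_r_minus)
    then show ?thesis using sD(4)[OF ifw w_N[OF m]] by simp
  qed
  \<comment> \<open>Inside ker f, membership in D' means membership in D. It contains the translates
    of e under N, since they agree with e modulo D and f takes the value one on them; so
    \<open>generate_E\<close> yields all of E.\<close>
  define D' where "D' = {x \<in> carrier M. x \<ominus>\<^bsub>M\<^esub> f x \<odot>\<^bsub>M\<^esub> e \<in> D}"
  have "E \<subseteq> D'"
  proof (rule generate_E[OF eE])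
    show "f e \<noteq> \<zero>" using fe by simp
    show "submodule D' k M"
    proof (rule submoduleI')
      show "\<zero>\<^bsub>M\<^esub> \<in> D'" unfolding D'_def using submodule_zero[OF D_sub] by (simp add: M.minus_zero_right)
    next
      fix a b assume "a \<in> D'" "b \<in> D'"
      then have a: "a \<in> carrier M" "a \<ominus>\<^bsub>M\<^esub> f a \<odot>\<^bsub>M\<^esub> e \<in> D"
        and b: "b \<in> carrier M" "b \<ominus>\<^bsub>M\<^esub> f b \<odot>\<^bsub>M\<^esub> e \<in> D" unfolding D'_def by auto
      have "(a \<oplus>\<^bsub>M\<^esub> b) \<ominus>\<^bsub>M\<^esub> f (a \<oplus>\<^bsub>M\<^esub> b) \<odot>\<^bsub>M\<^esub> e
          = (a \<ominus>\<^bsub>M\<^esub> f a \<odot>\<^bsub>M\<^esub> e) \<oplus>\<^bsub>M\<^esub> (b \<ominus>\<^bsub>M\<^esub> f b \<odot>\<^bsub>M\<^esub> e)"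
        using a(1) b(1) unfolding a_minus_def by (simp add: f_add smult_l_distr M.minus_add M.a_ac)
      then show "a \<oplus>\<^bsub>M\<^esub> b \<in> D'" unfolding D'_def using a b sD(5) by simp
    next
      fix a x assume a: "a \<in> carrier k" and "x \<in> D'"
      then have x: "x \<in> carrier M" "x \<ominus>\<^bsub>M\<^esub> f x \<odot>\<^bsub>M\<^esub> e \<in> D" unfolding D'_def by auto
      have "a \<odot>\<^bsub>M\<^esub> x \<ominus>\<^bsub>M\<^esub> f (a \<odot>\<^bsub>M\<^esub> x) \<odot>\<^bsub>M\<^esub> e = a \<odot>\<^bsub>M\<^esub> (x \<ominus>\<^bsub>M\<^esub> f x \<odot>\<^bsub>M\<^esub> e)"
        using a x(1) unfolding a_minus_def
        by (simp add: f_smult smult_r_distr smult_r_minus smult_assoc1)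
      then show "a \<odot>\<^bsub>M\<^esub> x \<in> D'" unfolding D'_def using a x sD(4) by simp
    qed (auto simp: D'_def)
    show "T \<subseteq> D'"
    proof
      fix t assume t: "t \<in> T"
      have "t \<in> D" using t TD by blast
      moreover have "t \<ominus>\<^bsub>M\<^esub> f t \<odot>\<^bsub>M\<^esub> e = t"
        using f_T[OF t] \<open>t \<in> D\<close> by (simp add: M.minus_zero_right)
      ultimately show "t \<in> D'" unfolding D'_def by simp
    qed
    fix n assume "n \<in> normalizer G P"
    then have n: "n \<in> N" unfolding N_def .
    then show "gact M n e \<in> D'" unfolding D'_def using e_N[OF n] fe by (simp add: f_gact)
  qed
  have ker: "x \<in> B" if x: "x \<in> E" and fx: "f x = \<zero>" for x
  proof -
    have "x \<ominus>\<^bsub>M\<^esub> f x \<odot>\<^bsub>M\<^esub> e \<in> D" using x \<open>E \<subseteq> D'\<close> unfolding D'_def by blast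
    then have "x \<in> D" using fx x by (simp add: M.minus_zero_right)
    then show ?thesis using DB by blast
  qed
  \<comment> \<open>B now contains every vector of E in ker f and also \<open>a0\<close> outside it.
    Subtracting a multiple of \<open>a0\<close> brings any x of E into ker f.\<close>
  have "E \<subseteq> B"
  proof
    fix x assume x: "x \<in> E"
    have u: "f a0 \<in> Units k" using a0 a0E K.field_Units by simp
    let ?c = "f x \<otimes> inv (f a0)"
    have c: "?c \<in> carrier k" using u x by simp
    have ca: "?c \<odot>\<^bsub>M\<^esub> a0 \<in> B" using sB(4)[OF c a0(1)] .
    have "f (?c \<odot>\<^bsub>M\<^esub> a0) = f x" using c u x a0E by (simp add: f_smult K.m_assoc)
    then have "f (x \<ominus>\<^bsub>M\<^esub> ?c \<odot>\<^bsub>M\<^esub> a0) = \<zero>" using c x a0E by (simp add: f_minus)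
    then have "x \<ominus>\<^bsub>M\<^esub> ?c \<odot>\<^bsub>M\<^esub> a0 \<in> B"
      using ker submodule_minus[OF submodule_E x sE(4)[OF c a0E]] by blast
    then have "(x \<ominus>\<^bsub>M\<^esub> ?c \<odot>\<^bsub>M\<^esub> a0) \<oplus>\<^bsub>M\<^esub> ?c \<odot>\<^bsub>M\<^esub> a0 \<in> B" using sB(5) ca by blast
    then show "x \<in> B" using x c a0E unfolding a_minus_def by (simp add: M.a_assoc M.l_neg)
  qed
  then show False using BE B(2) by blast
qed

end

section \<open>The Brauer construction\<close>

lemma indecomposable_iso:
  assumes "gmodule k G M" "gmodule k G N" "gmod_iso k G M N" "indecomposable k G N"
  shows "indecomposable k G M"
proof -
  interpret M: gmodule k G M by fact
  interpret N: gmodule k G N by fact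
  obtain h where h: "h \<in> gmod_hom k G M N" and bij: "bij_betw h (carrier M) (carrier N)"
    using assms(3) unfolding gmod_iso_def by blast
  have add: "h (x \<oplus>\<^bsub>M\<^esub> y) = h x \<oplus>\<^bsub>N\<^esub> h y" if "x \<in> carrier M" "y \<in> carrier M" for x y
    using h that unfolding gmod_hom_def by simp
  have smult: "h (a \<odot>\<^bsub>M\<^esub> x) = a \<odot>\<^bsub>N\<^esub> h x" if "a \<in> carrier k" "x \<in> carrier M" for a x
    using h that unfolding gmod_hom_def by simp
  have act: "h (gact M g x) = gact N g (h x)" if "g \<in> carrier G" "x \<in> carrier M" for g x
    using h that unfolding gmod_hom_def by simp
  have inj: "inj_on h (carrier M)" and img: "h ` carrier M = carrier N"
    using bij unfolding bij_betw_def by auto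
  have zero: "h \<zero>\<^bsub>M\<^esub> = \<zero>\<^bsub>N\<^esub>"
  proof -
    have "h \<zero>\<^bsub>M\<^esub> \<in> carrier N" using img by blast
    then show ?thesis using smult[of "\<zero>\<^bsub>k\<^esub>" "\<zero>\<^bsub>M\<^esub>"] by simp
  qed
  have sub: "gsubmodule k G N (h ` A)" if A: "gsubmodule k G M A" for A
  proof (rule N.gsubmoduleI)
    note D = M.gsubmoduleD[OF A]
    have c: "x \<in> carrier M" if "x \<in> A" for x using that D(2) by blast
    show "h ` A \<subseteq> carrier N" using D(2) img by blast
    show "\<zero>\<^bsub>N\<^esub> \<in> h ` A" using D(3) zero[symmetric] by (rule rev_image_eqI)
    show "\<And>x y. \<lbrakk>x \<in> h ` A; y \<in> h ` A\<rbrakk> \<Longrightarrow> x \<oplus>\<^bsub>N\<^esub> y \<in> h ` A"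
      using c D(4) by (auto simp: add[symmetric])
    show "\<And>a x. \<lbrakk>a \<in> carrier k; x \<in> h ` A\<rbrakk> \<Longrightarrow> a \<odot>\<^bsub>N\<^esub> x \<in> h ` A"
      using c D(6) by (auto simp: smult[symmetric])
    show "\<And>g x. \<lbrakk>g \<in> carrier G; x \<in> h ` A\<rbrakk> \<Longrightarrow> gact N g x \<in> h ` A"
      using c D(7) by (auto simp: act[symmetric])
  qed
  have trivial: "A = {\<zero>\<^bsub>M\<^esub>}" if "A \<subseteq> carrier M" "h ` A = {\<zero>\<^bsub>N\<^esub>}" for A
    using inj_on_image_eq_iff[OF inj that(1), of "{\<zero>\<^bsub>M\<^esub>}"] that(2) zero by simp
  show ?thesis
    unfolding indecomposable_def
  proof (intro conjI allI impI)
    show "carrier M \<noteq> {\<zero>\<^bsub>M\<^esub>}" using assms(4) img zero unfolding indecomposable_def by auto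
  next
    fix A B assume dec: "direct_decomposition k G M A B"
    then have A: "gsubmodule k G M A" and B: "gsubmodule k G M B"
      and sum: "A <+>\<^bsub>M\<^esub> B = carrier M" and int: "A \<inter> B = {\<zero>\<^bsub>M\<^esub>}"
      unfolding direct_decomposition_def by auto
    note AM = M.gsubmoduleD(2)[OF A] and BM = M.gsubmoduleD(2)[OF B]
    have "h (x \<oplus>\<^bsub>M\<^esub> y) = h x \<oplus>\<^bsub>N\<^esub> h y" if "x \<in> A" "y \<in> B" for x y
      using add AM BM that by blast
    then have "h ` A <+>\<^bsub>N\<^esub> h ` B = h ` (A <+>\<^bsub>M\<^esub> B)"
      unfolding set_add_def' by (simp add: image_UN)
    moreover have "h ` A \<inter> h ` B = h ` (A \<inter> B)" using inj_on_image_Int[OF inj AM BM] by simp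
    ultimately have "direct_decomposition k G N (h ` A) (h ` B)"
      unfolding direct_decomposition_def using sub[OF A] sub[OF B] sum int img zero by simp
    then have "h ` A = {\<zero>\<^bsub>N\<^esub>} \<or> h ` B = {\<zero>\<^bsub>N\<^esub>}"
      using assms(4) unfolding indecomposable_def by blast
    then show "A = {\<zero>\<^bsub>M\<^esub>} \<or> B = {\<zero>\<^bsub>M\<^esub>}" using trivial AM BM by blast
  qed
qed

text \<open>Cosets of zero are singletons. The lemma is for subgroups of R, where the Brauer
  construction is this quotient and only isomorphic to M.\<close>

lemma (in gmodule) indecomposable_quot_zero:
  "indecomposable k G (gmod_quot M {\<zero>\<^bsub>M\<^esub>}) \<longleftrightarrow> indecomposable k G M"
proof -
  let ?Q = "gmod_quot M {\<zero>\<^bsub>M\<^esub>}"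
  have "gsubmodule k G M {\<zero>\<^bsub>M\<^esub>}" by (rule gsubmoduleI) auto
  then interpret gmodule_quotient k G M "{\<zero>\<^bsub>M\<^esub>}"
    by (intro gmodule_quotient.intro gmodule_axioms gmodule_quotient_axioms.intro)
  have coset: "{\<zero>\<^bsub>M\<^esub>} +>\<^bsub>M\<^esub> x = {x}" if "x \<in> carrier M" for x
    using that unfolding a_r_coset_def' by simp
  have Q: "carrier ?Q = (\<lambda>x. {x}) ` carrier M" unfolding quot_carrier using coset by simp
  have ops: "\<And>x y. \<lbrakk>x \<in> carrier M; y \<in> carrier M\<rbrakk> \<Longrightarrow> {x} \<oplus>\<^bsub>?Q\<^esub> {y} = {x \<oplus>\<^bsub>M\<^esub> y}"
    "\<And>a x. \<lbrakk>a \<in> carrier k; x \<in> carrier M\<rbrakk> \<Longrightarrow> a \<odot>\<^bsub>?Q\<^esub> {x} = {a \<odot>\<^bsub>M\<^esub> x}"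
    "\<And>g x. \<lbrakk>g \<in> carrier G; x \<in> carrier M\<rbrakk> \<Longrightarrow> gact ?Q g {x} = {gact M g x}"
    using quot_add quot_smult quot_gact by (simp_all add: coset)
  have "gmod_iso k G M ?Q"
    unfolding gmod_iso_def gmod_hom_def
    by (intro bexI[of _ "\<lambda>x. {x}"]) (auto simp: bij_betw_def Q ops)
  moreover have "gmod_iso k G ?Q M"
    unfolding gmod_iso_def gmod_hom_def
    by (intro bexI[of _ the_elem]) (auto simp: bij_betw_def inj_on_def image_image Q ops)
  ultimately show ?thesis
    using indecomposable_iso[OF gmodule_axioms gmodule_quot]
      indecomposable_iso[OF gmodule_quot gmodule_axioms] by blast
qed

text \<open>The index divides a power of p, so it is itself a power of p, and it is not 1.\<close>

lemma prime_dvd_card_lcosets: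
  assumes "group G" "finite (carrier G)" "subgroup K G" "K \<noteq> carrier G"
    and "order G dvd p ^ n" "Factorial_Ring.prime p"
  shows "p dvd card (lcosets\<^bsub>G\<^esub> K)"
proof -
  interpret group G by fact
  have l: "card (lcosets\<^bsub>G\<^esub> K) * card K = order G" by (rule l_lagrange[OF assms(2,3)])
  then have "card (lcosets\<^bsub>G\<^esub> K) dvd order G" by (rule dvdI[OF sym, unfolded mult.commute])
  then have "card (lcosets\<^bsub>G\<^esub> K) dvd p ^ n" using assms(5) by (rule dvd_trans)
  then obtain i where i: "card (lcosets\<^bsub>G\<^esub> K) = p ^ i"
    using divides_primepow_nat[OF assms(6)] by blast
  have "i \<noteq> 0"
  proof
    assume "i = 0"
    then have "card K = card (carrier G)" using i l by (simp add: order_def)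
    then show False
      using card_subset_eq[OF assms(2) subgroup.subset[OF assms(3)]] assms(4) by simp
  qed
  then show ?thesis unfolding i by simp
qed

section \<open>Fixed points and traces for all subgroups of P\<close>

context scott_trivial_normal
begin

text \<open>The stabiliser in P of a Q-fixed vector contains both R and Q; as the index of R is
  prime and Q is not inside R, it is P.\<close>

lemma fixed_points_eq_E:
  assumes Q: "subgroup Q G" "Q \<subseteq> P" "\<not> Q \<subseteq> R"
  shows "fixed_points M Q = E"
proof
  show "E \<subseteq> fixed_points M Q" using Q(2) unfolding E_def fixed_points_def by auto
  show "fixed_points M Q \<subseteq> E"
  proof
    fix x assume x: "x \<in> fixed_points M Q"
    then have xc [simp]: "x \<in> carrier M" unfolding fixed_points_def by simp
    define S where "S = {h \<in> P. gact M h x = x}"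
    have "subgroup S (G\<lparr>carrier := P\<rparr>)"
    proof (rule PG.subgroupI)
      show "S \<subseteq> carrier (G\<lparr>carrier := P\<rparr>)" unfolding S_def by auto
      have "\<one>\<^bsub>G\<^esub> \<in> S" unfolding S_def using P.one_closed by simp
      then show "S \<noteq> {}" by blast
    next
      fix a assume "a \<in> S"
      then have a: "a \<in> P" "gact M a x = x" unfolding S_def by auto
      have "gact M (inv\<^bsub>G\<^esub> a) x = gact M (inv\<^bsub>G\<^esub> a) (gact M a x)" using a(2) by simp
      also have "\<dots> = x" using P.mem_carrier[OF a(1)] by simp
      finally show "inv\<^bsub>G\<lparr>carrier := P\<rparr>\<^esub> a \<in> S"
        unfolding S_def G.m_inv_consistent[OF P.subgroup_axioms a(1)] using P.m_inv_closed[OF a(1)] by simp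
    next
      fix a c assume "a \<in> S" "c \<in> S"
      then show "a \<otimes>\<^bsub>G\<lparr>carrier := P\<rparr>\<^esub> c \<in> S"
        unfolding S_def using P.m_closed by (simp add: gact_mult P.mem_carrier)
    qed
    moreover have "R \<subseteq> S" unfolding S_def using R_subset_P by auto
    ultimately have "S = R \<or> S = P"
      using PG.subgroup_between_prime_index[OF _ _ R_subgroup_P, of S p] finite_P card_P prime_p
      by (simp add: order_def)
    moreover have "Q \<subseteq> S" unfolding S_def using x Q(2) unfolding fixed_points_def by auto
    ultimately have "S = P" using Q(3) by blast
    then show "x \<in> E" unfolding E_iff using xc unfolding S_def by blast
  qed
qed

lemma relative_trace_eq:
  "relative_trace G M K Q x = (\<Oplus>\<^bsub>M\<^esub>C\<in>(\<lambda>a. a <#\<^bsub>G\<^esub> K) ` Q. gact M (rep C) x)"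
  unfolding relative_trace_def lcosets_carrier_update ..

text \<open>On a vector already fixed by Q the trace is multiplication by the index of K, a
  nontrivial power of p and hence zero in k.\<close>

lemma relative_trace_fixed:
  assumes Q: "subgroup Q G" "Q \<subseteq> P" and K: "subgroup K G" "K \<subset> Q"
    and x: "x \<in> fixed_points M Q"
  shows "relative_trace G M K Q x = \<zero>\<^bsub>M\<^esub>"
proof -
  interpret Q: group "G\<lparr>carrier := Q\<rparr>" by (rule G.subgroup_imp_group[OF Q(1)])
  have KQ: "subgroup K (G\<lparr>carrier := Q\<rparr>)" using G.subgroup_incl[OF K(1) Q(1)] K(2) by blast
  have xc: "x \<in> carrier M" using x unfolding fixed_points_def by simp
  obtain n where n: "card P = p ^ n" using p_group unfolding p_subgroup_def by blast
  have "card (rcosets\<^bsub>G\<lparr>carrier := P\<rparr>\<^esub> Q) * card Q = p ^ n"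
    using PG.lagrange[OF G.subgroup_incl[OF Q(1) P.subgroup_axioms Q(2)]] n by (simp add: order_def)
  then have "p ^ n = card (rcosets\<^bsub>G\<lparr>carrier := P\<rparr>\<^esub> Q) * order (G\<lparr>carrier := Q\<rparr>)"
    by (simp add: order_def)
  then have "order (G\<lparr>carrier := Q\<rparr>) dvd p ^ n" by (rule dvdI[OF trans[OF _ mult.commute]])
  then have "p dvd card (lcosets\<^bsub>G\<lparr>carrier := Q\<rparr>\<^esub> K)"
    using prime_dvd_card_lcosets[OF Q.is_group _ KQ _ _ prime_p] finite_subset[OF Q(2) finite_P] K(2)
    by simp
  then have z: "(\<Oplus>\<^bsub>M\<^esub>C\<in>lcosets\<^bsub>G\<lparr>carrier := Q\<rparr>\<^esub> K. x) = \<zero>\<^bsub>M\<^esub>" by (rule finsum_const_zero[OF xc])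
  have "relative_trace G M K Q x = (\<Oplus>\<^bsub>M\<^esub>C\<in>lcosets\<^bsub>G\<lparr>carrier := Q\<rparr>\<^esub> K. x)"
    unfolding relative_trace_def
  proof (rule M.finsum_cong')
    fix C assume C: "C \<in> lcosets\<^bsub>G\<lparr>carrier := Q\<rparr>\<^esub> K"
    have "rep C \<in> Q" using some_in_lcoset(2)[OF Q.is_group KQ C] by simp
    then show "gact M (rep C) x = x" using x unfolding fixed_points_def by simp
  qed (use xc in auto)
  then show ?thesis using z by simp
qed

text \<open>Each coset of R in P meets Q and, within Q, splits into as many cosets of K as K has in
  the intersection of Q and R. All of these act alike on x, so the trace from K to Q is that
  multiple of the trace from R to P.\<close>

lemma relative_trace_kernel:
  assumes Q: "subgroup Q G" "Q \<subseteq> P" "\<not> Q \<subseteq> R" and K: "subgroup K G" "K \<subseteq> Q \<inter> R"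
    and x [simp]: "x \<in> carrier M"
  shows "relative_trace G M K Q x
    = ([card ((\<lambda>a. a <#\<^bsub>G\<^esub> K) ` (Q \<inter> R))] \<cdot> \<one>) \<odot>\<^bsub>M\<^esub> tr x"
proof -
  interpret Q: subgroup Q G by (rule Q(1))
  define SK where "SK = (\<lambda>a. a <#\<^bsub>G\<^esub> K) ` (Q \<inter> R)"
  have QG [simp]: "q \<in> carrier G" if "q \<in> Q" for q using Q.mem_carrier that .
  have RG [simp]: "q \<in> carrier G" if "q \<in> R" for q using R.mem_carrier that .
  have fix_all: "P = S" if S: "subgroup S G" "S \<subseteq> P" "Q \<subseteq> S" "R \<subseteq> S" for S
    using PG.subgroup_between_prime_index[OF _ G.subgroup_incl[OF S(1) P.subgroup_axioms S(2)]
        R_subgroup_P S(4), of p] finite_P card_P prime_p Q(3) S(3)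
    by (auto simp: order_def)
  have RQ: "subgroup (R <#>\<^bsub>G\<^esub> Q) G" by (rule G.mult_norm_subgroup[OF R_normal Q(1)])
  \<comment> \<open>A subgroup between R and P that contains Q cannot be R.\<close>
  have "P = R <#>\<^bsub>G\<^esub> Q"
  proof (rule fix_all[OF RQ])
    show "R <#>\<^bsub>G\<^esub> Q \<subseteq> P" unfolding set_mult_def using R_subset_P Q(2) by auto
    show "Q \<subseteq> R <#>\<^bsub>G\<^esub> Q"
    proof
      fix q assume q: "q \<in> Q"
      have "\<one>\<^bsub>G\<^esub> \<otimes>\<^bsub>G\<^esub> q \<in> R <#>\<^bsub>G\<^esub> Q"
        unfolding set_mult_def by (intro UN_I[OF subgroup.one_closed[OF R.subgroup_axioms]] UN_I[OF q]) simp
      then show "q \<in> R <#>\<^bsub>G\<^esub> Q" using q by simp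
    qed
    show "R \<subseteq> R <#>\<^bsub>G\<^esub> Q"
    proof
      fix q assume q: "q \<in> R"
      have "q \<otimes>\<^bsub>G\<^esub> \<one>\<^bsub>G\<^esub> \<in> R <#>\<^bsub>G\<^esub> Q"
        unfolding set_mult_def by (intro UN_I[OF q] UN_I[OF Q.one_closed]) simp
      then show "q \<in> R <#>\<^bsub>G\<^esub> Q" using q by simp
    qed
  qed
  then have PRQ: "\<exists>r\<in>R. \<exists>q\<in>Q. h = r \<otimes>\<^bsub>G\<^esub> q" if "h \<in> P" for h
    using that unfolding set_mult_def by blast
  have ex: "\<exists>q\<in>Q. q \<in> A" if A: "A \<in> PR" for A
  proof -
    obtain r q where rq: "r \<in> R" "q \<in> Q" "(rep A) = r \<otimes>\<^bsub>G\<^esub> q"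
      using PRQ[OF PR_rep(2)[OF A]] by (elim bexE)
    have r': "inv\<^bsub>G\<^esub> q \<otimes>\<^bsub>G\<^esub> inv\<^bsub>G\<^esub> r \<otimes>\<^bsub>G\<^esub> q \<in> R"
      using R.inv_op_closed1[of q "inv\<^bsub>G\<^esub> r"] rq subgroup.m_inv_closed[OF R.subgroup_axioms rq(1)] by simp
    have "q = (r \<otimes>\<^bsub>G\<^esub> q) \<otimes>\<^bsub>G\<^esub> (inv\<^bsub>G\<^esub> q \<otimes>\<^bsub>G\<^esub> inv\<^bsub>G\<^esub> r \<otimes>\<^bsub>G\<^esub> q)"
    proof -
      have "q \<otimes>\<^bsub>G\<^esub> (inv\<^bsub>G\<^esub> q \<otimes>\<^bsub>G\<^esub> (inv\<^bsub>G\<^esub> r \<otimes>\<^bsub>G\<^esub> q)) = inv\<^bsub>G\<^esub> r \<otimes>\<^bsub>G\<^esub> q"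
        using rq by (simp add: G.m_assoc[symmetric])
      then show ?thesis using rq by (simp add: G.m_assoc) (simp add: G.m_assoc[symmetric])
    qed
    then have "q \<in> (r \<otimes>\<^bsub>G\<^esub> q) <#\<^bsub>G\<^esub> R" unfolding l_coset_image using r' by (rule image_eqI)
    then show ?thesis using PR_rep(3)[OF A] rq by auto
  qed
  \<comment> \<open>A representative inside Q for every coset of R in P, which exists because P =
    RQ.\<close>
  define t where "t = (\<lambda>A. SOME q. q \<in> Q \<and> q \<in> A)"
  have t: "t A \<in> Q" "t A \<in> A" if A: "A \<in> PR" for A
  proof -
    have "\<exists>q. q \<in> Q \<and> q \<in> A" using ex[OF A] by blast
    then have "t A \<in> Q \<and> t A \<in> A" unfolding t_def by (rule someI_ex)
    then show "t A \<in> Q" "t A \<in> A" by auto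
  qed
  have tA: "A = t A <#\<^bsub>G\<^esub> R" if A: "A \<in> PR" for A
    using G.l_repr_independence[OF _ _ R.subgroup_axioms, of "t A" "rep A"]
      PR_rep[OF A] t(2)[OF A] P.mem_carrier by metis
  have SK_sub: "D \<subseteq> R" if "D \<in> SK" for D
  proof -
    obtain s where s: "s \<in> Q \<inter> R" "D = s <#\<^bsub>G\<^esub> K" using \<open>D \<in> SK\<close> unfolding SK_def by auto
    show ?thesis
      unfolding s(2) l_coset_image using s(1) K(2) subgroup.m_closed[OF R.subgroup_axioms] by auto
  qed
  have SK_ne: "D \<noteq> {}" if "D \<in> SK" for D
    using that subgroup.one_closed[OF K(1)] unfolding SK_def l_coset_image by blast
  have SK_G: "D \<subseteq> carrier G" if "D \<in> SK" for D using SK_sub[OF that] R.subset by blast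
  \<comment> \<open>The cosets of K in Q that lie in A, obtained by translating those inside the
    intersection of Q and R.\<close>
  define fib where "fib = (\<lambda>A. (\<lambda>D. t A <#\<^bsub>G\<^esub> D) ` SK)"
  have inj: "inj_on (\<lambda>D. t A <#\<^bsub>G\<^esub> D) SK" if A: "A \<in> PR" for A
  proof (rule inj_on_inverseI)
    fix D assume "D \<in> SK"
    then show "inv\<^bsub>G\<^esub> (t A) <#\<^bsub>G\<^esub> (t A <#\<^bsub>G\<^esub> D) = D"
      using SK_G t(1)[OF A] by (simp add: G.lcos_m_assoc G.lcos_mult_one)
  qed
  have fib_sub: "C \<subseteq> A" "C \<noteq> {}" if A: "A \<in> PR" and C: "C \<in> fib A" for A C
  proof -
    obtain D where D: "D \<in> SK" "C = t A <#\<^bsub>G\<^esub> D" using C unfolding fib_def by auto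
    have "t A <#\<^bsub>G\<^esub> D \<subseteq> t A <#\<^bsub>G\<^esub> R" unfolding l_coset_image using SK_sub[OF D(1)] by (rule image_mono)
    then show "C \<subseteq> A" unfolding D(2) tA[OF A, symmetric] .
    show "C \<noteq> {}" unfolding D(2) l_coset_image using SK_ne[OF D(1)] by simp
  qed
  have finSK: "finite SK" unfolding SK_def using finite_subset[OF Q(2) finite_P] by simp
  have rep: "gact M (rep C) x = gact M (t A) x" if A: "A \<in> PR" and C: "C \<in> fib A" for A C
  proof -
    have "rep C \<in> C" using fib_sub(2)[OF A C] by (simp add: some_in_eq)
    then have "rep C \<in> t A <#\<^bsub>G\<^esub> R" using fib_sub(1)[OF A C] tA[OF A] by blast
    then obtain r where "r \<in> R" "(rep C) = t A \<otimes>\<^bsub>G\<^esub> r" unfolding l_coset_image by auto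
    then show ?thesis using t(1)[OF A] by (simp add: gact_mult)
  qed
  have cover: "(\<lambda>a. a <#\<^bsub>G\<^esub> K) ` Q = \<Union>(fib ` PR)"
  proof (intro equalityI subsetI)
    fix C assume "C \<in> (\<lambda>a. a <#\<^bsub>G\<^esub> K) ` Q"
    then obtain q where q: "q \<in> Q" "C = q <#\<^bsub>G\<^esub> K" by auto
    define A where "A = q <#\<^bsub>G\<^esub> R"
    have A: "A \<in> PR" unfolding A_def lcosets_carrier_update using q(1) Q(2) by blast
    have "q \<in> A" unfolding A_def using G.lcos_self[OF _ R.subgroup_axioms] q(1) by simp
    then have "q \<in> t A <#\<^bsub>G\<^esub> R" using tA[OF A] by simp
    then obtain r where r: "r \<in> R" "q = t A \<otimes>\<^bsub>G\<^esub> r" unfolding l_coset_image by auto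
    have tQ: "t A \<in> Q" by (rule t(1)[OF A])
    have "r = inv\<^bsub>G\<^esub> (t A) \<otimes>\<^bsub>G\<^esub> q" unfolding r(2) using r(1) tQ by (simp add: G.m_assoc[symmetric])
    then have "r \<in> Q \<inter> R" using r(1) Q.m_closed[OF Q.m_inv_closed[OF tQ] q(1)] by simp
    moreover have "C = t A <#\<^bsub>G\<^esub> (r <#\<^bsub>G\<^esub> K)"
      unfolding q(2) r(2) using r(1) tQ subgroup.subset[OF K(1)] by (simp add: G.lcos_m_assoc)
    ultimately have "C \<in> fib A" unfolding fib_def SK_def by blast
    then show "C \<in> \<Union>(fib ` PR)" using A by blast
  next
    fix C assume "C \<in> \<Union>(fib ` PR)"
    then obtain A where A: "A \<in> PR" and "C \<in> fib A" by auto
    then obtain s where s: "s \<in> Q \<inter> R" "C = t A <#\<^bsub>G\<^esub> (s <#\<^bsub>G\<^esub> K)" unfolding fib_def SK_def by auto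
    have "C = (t A \<otimes>\<^bsub>G\<^esub> s) <#\<^bsub>G\<^esub> K" unfolding s(2) using s(1) t(1)[OF A] subgroup.subset[OF K(1)] by (simp add: G.lcos_m_assoc)
    then show "C \<in> (\<lambda>a. a <#\<^bsub>G\<^esub> K) ` Q" using Q.m_closed[OF t(1)[OF A]] s(1) by blast
  qed
  have "relative_trace G M K Q x = (\<Oplus>\<^bsub>M\<^esub>A\<in>PR. \<Oplus>\<^bsub>M\<^esub>C\<in>fib A. gact M (rep C) x)"
    unfolding relative_trace_eq cover
  proof (rule M.add.finprod_UN_disjoint[OF finite_PR])
    show "finite (fib A)" for A unfolding fib_def using finSK by simp
    show "pairwise (\<lambda>A B. disjnt (fib A) (fib B)) PR"
    proof (rule pairwiseI)
      fix A B assume A: "A \<in> PR" and B: "B \<in> PR" and ne: "A \<noteq> B"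
      have "A \<inter> B = {}" using PG.lcos_disjoint[OF R_subgroup_P A B ne] .
      then have "C \<notin> fib B" if "C \<in> fib A" for C
        using fib_sub[OF A that] fib_sub(1)[OF B, of C] by blast
      then show "disjnt (fib A) (fib B)" unfolding disjnt_def by blast
    qed
    show "gact M (rep C) x \<in> carrier M" if "A \<in> PR" "C \<in> fib A" for A C
      unfolding rep[OF that] using t(1)[OF that(1)] by simp
  qed
  also have "\<dots> = (\<Oplus>\<^bsub>M\<^esub>A\<in>PR. ([card SK] \<cdot> \<one>) \<odot>\<^bsub>M\<^esub> gact M (rep A) x)"
  proof (rule M.finsum_cong')
    fix A assume A: "A \<in> PR"
    let ?y = "gact M (rep A) x"
    have y: "gact M (t A) x = ?y" using PR_act[OF A t(2)[OF A] x] by simp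
    have yc: "?y \<in> carrier M" using PR_rep(2)[OF A] P.mem_carrier by simp
    have "(\<Oplus>\<^bsub>M\<^esub>C\<in>fib A. gact M (rep C) x) = (\<Oplus>\<^bsub>M\<^esub>C\<in>fib A. \<one> \<odot>\<^bsub>M\<^esub> ?y)"
      by (rule M.finsum_cong') (use rep[OF A] y yc in auto)
    also have "\<dots> = (\<Oplus>C\<in>fib A. \<one>) \<odot>\<^bsub>M\<^esub> ?y" by (rule finsum_smult_rdistr[symmetric]) (use yc in auto)
    also have "(\<Oplus>C\<in>fib A. \<one>) = [card SK] \<cdot> \<one>"
      using finsum_const_k[of \<one> "fib A"] card_image[OF inj[OF A]] unfolding fib_def by simp
    finally show "(\<Oplus>\<^bsub>M\<^esub>C\<in>fib A. gact M (rep C) x) = ([card SK] \<cdot> \<one>) \<odot>\<^bsub>M\<^esub> ?y" .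
  qed (use PR_rep(2) P.mem_carrier in auto)
  also have "\<dots> = ([card SK] \<cdot> \<one>) \<odot>\<^bsub>M\<^esub> tr x"
    unfolding tr_eq by (rule finsum_smult_ldistr[symmetric, OF finite_PR _ tr_fun[OF x]]) simp
  finally show ?thesis unfolding SK_def .
qed

lemma proper_traces_subset:
  assumes "submodule U k M"
    and "\<And>K x. \<lbrakk>subgroup K G; K \<subset> Q; x \<in> fixed_points M K\<rbrakk> \<Longrightarrow> relative_trace G M K Q x \<in> U"
  shows "proper_traces G M Q \<subseteq> U"
proof
  fix y assume "y \<in> proper_traces G M Q"
  then obtain t where y: "y = (\<Oplus>\<^bsub>M\<^esub>K\<in>{K. subgroup K G \<and> K \<subset> Q}. t K)"
    and t: "t \<in> (\<Pi> K\<in>{K. subgroup K G \<and> K \<subset> Q}. relative_trace G M K Q ` fixed_points M K)"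
    unfolding proper_traces_def by auto
  show "y \<in> U" unfolding y
  proof (rule submodule_finsum[OF assms(1)])
    fix K assume K: "K \<in> {K. subgroup K G \<and> K \<subset> Q}"
    then have "t K \<in> relative_trace G M K Q ` fixed_points M K" using t by auto
    then obtain x where "x \<in> fixed_points M K" "t K = relative_trace G M K Q x" by (elim imageE)
    then show "t K \<in> U" using assms(2) K by simp
  qed
qed

text \<open>An element of \<open>proper_traces\<close> selects a trace value at every proper
  subgroup simultaneously, so zero must be available at each of them.\<close>

lemma relative_trace_zero:
  assumes Q: "subgroup Q G" and K: "subgroup K G" "K \<subseteq> Q"
  shows "\<zero>\<^bsub>M\<^esub> \<in> relative_trace G M K Q ` fixed_points M K"
proof (rule image_eqI)
  interpret Q: group "G\<lparr>carrier := Q\<rparr>" by (rule G.subgroup_imp_group[OF Q])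
  have KQ: "subgroup K (G\<lparr>carrier := Q\<rparr>)" using G.subgroup_incl[OF K(1) Q K(2)] .
  have "gact M (rep C) \<zero>\<^bsub>M\<^esub> = \<zero>\<^bsub>M\<^esub>" if C: "C \<in> lcosets\<^bsub>G\<lparr>carrier := Q\<rparr>\<^esub> K" for C
    using some_in_lcoset(2)[OF Q.is_group KQ C] subgroup.mem_carrier[OF Q] by simp
  then show "\<zero>\<^bsub>M\<^esub> = relative_trace G M K Q \<zero>\<^bsub>M\<^esub>"
    unfolding relative_trace_def by (intro M.add.finprod_one_eqI[symmetric])
  show "\<zero>\<^bsub>M\<^esub> \<in> fixed_points M K"
    unfolding fixed_points_def using subgroup.mem_carrier[OF K(1)] by simp
qed

text \<open>Q fixes all of M, so every trace from a proper subgroup multiplies by an index divisible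
  by p. For trivial Q the sum of traces is empty, which is zero as well.\<close>

lemma brauer_construction_kernel:
  assumes Q: "subgroup Q G" "Q \<subseteq> R"
  shows "brauer_construction G M Q = gmod_quot M {\<zero>\<^bsub>M\<^esub>}"
proof -
  have fixed: "fixed_points M K = carrier M" if "K \<subseteq> R" for K
    using that unfolding fixed_points_def by auto
  have "proper_traces G M Q \<subseteq> {\<zero>\<^bsub>M\<^esub>}"
  proof (rule proper_traces_subset)
    show "submodule {\<zero>\<^bsub>M\<^esub>} k M" by (rule submoduleI') auto
    fix K x assume K: "subgroup K G" "K \<subset> Q" and x: "x \<in> fixed_points M K"
    then have "x \<in> fixed_points M Q" using fixed Q(2) by auto
    then show "relative_trace G M K Q x \<in> {\<zero>\<^bsub>M\<^esub>}"
      using relative_trace_fixed[OF Q(1) _ K] Q(2) R_subset_P by blast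
  qed
  moreover have "\<zero>\<^bsub>M\<^esub> \<in> proper_traces G M Q"
    unfolding proper_traces_def
    using relative_trace_zero[OF Q(1)] by (auto intro!: exI[of _ "\<lambda>_. \<zero>\<^bsub>M\<^esub>"])
  ultimately have "proper_traces G M Q = {\<zero>\<^bsub>M\<^esub>}" by blast
  then show ?thesis unfolding brauer_construction_def fixed[OF Q(2)] by simp
qed

text \<open>Subgroups K of R contribute multiples of \<open>tr\<close>. If K is not inside R, its
  fixed points are those of Q and its trace vanishes. The multiple is one for the intersection of Q
  and R, which gives all of T.\<close>

lemma proper_traces_eq_T:
  assumes Q: "subgroup Q G" "Q \<subseteq> P" "\<not> Q \<subseteq> R"
  shows "proper_traces G M Q = T"
proof
  show "proper_traces G M Q \<subseteq> T"
  proof (rule proper_traces_subset[OF submodule_T])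
    fix K x assume K: "subgroup K G" "K \<subset> Q" and x: "x \<in> fixed_points M K"
    have xc: "x \<in> carrier M" using x unfolding fixed_points_def by simp
    show "relative_trace G M K Q x \<in> T"
    proof (cases "K \<subseteq> R")
      case True
      have "tr x \<in> T" unfolding T_def using xc by (rule imageI)
      then show ?thesis
        using relative_trace_kernel[OF Q K(1) _ xc] K(2) True submoduleE(4)[OF submodule_T] by auto
    next
      case False
      have "x \<in> fixed_points M Q"
        using x fixed_points_eq_E[OF K(1) _ False] fixed_points_eq_E[OF Q] K(2) Q(2) by auto
      then show ?thesis
        using relative_trace_fixed[OF Q(1,2) K] submodule_zero[OF submodule_T] by simp
    qed
  qed
  show "T \<subseteq> proper_traces G M Q"
  proof
    fix y assume "y \<in> T"
    then obtain x where x: "x \<in> carrier M" "y = tr x" unfolding T_def by auto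
    let ?Ks = "{K. subgroup K G \<and> K \<subset> Q}"
    let ?S = "Q \<inter> R"
    have S: "subgroup ?S G" by (rule G.subgroups_Inter_pair[OF Q(1) R.subgroup_axioms])
    have S_Ks: "?S \<in> ?Ks" using S Q(3) by blast
    have finQ: "finite Q" using finite_subset[OF Q(2) finite_P] .
    have fin: "finite ?Ks" by (rule finite_subset[of _ "Pow Q"]) (use finQ in auto)
    \<comment> \<open>The multiplicity in \<open>relative_trace_kernel\<close> counts the cosets of
      this subgroup in itself.\<close>
    have "(\<lambda>a. a <#\<^bsub>G\<^esub> ?S) ` ?S = {?S}"
    proof -
      have "a <#\<^bsub>G\<^esub> ?S = ?S" if a: "a \<in> ?S" for a
        using G.l_repr_independence[OF _ G.one_closed S, of a] G.lcos_mult_one[OF subgroup.subset[OF S]] a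
        by simp
      then show ?thesis using subgroup.one_closed[OF S] by auto
    qed
    then have "card ((\<lambda>a. a <#\<^bsub>G\<^esub> ?S) ` ?S) = 1" by simp
    then have tS: "relative_trace G M ?S Q x = tr x"
      using relative_trace_kernel[OF Q S order_refl x(1)] x(1) by simp
    have "x \<in> fixed_points M ?S" using x(1) unfolding fixed_points_def by auto
    then have yS: "y \<in> relative_trace G M ?S Q ` fixed_points M ?S" using x(2) tS by (metis image_eqI)
    \<comment> \<open>All the trace is placed at the intersection of Q and R; every other proper
      subgroup contributes zero.\<close>
    define t where "t = (\<lambda>K. if ?S = K then y else \<zero>\<^bsub>M\<^esub>)"
    have "t \<in> (\<Pi> K\<in>?Ks. relative_trace G M K Q ` fixed_points M K)"
    proof (rule Pi_I)
      fix K assume K: "K \<in> ?Ks"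
      then have "\<zero>\<^bsub>M\<^esub> \<in> relative_trace G M K Q ` fixed_points M K"
        by (intro relative_trace_zero[OF Q(1)]) auto
      then show "t K \<in> relative_trace G M K Q ` fixed_points M K"
        using yS by (cases "?S = K") (simp_all add: t_def)
    qed
    moreover have "(\<Oplus>\<^bsub>M\<^esub>K\<in>?Ks. t K) = y"
      unfolding t_def by (rule M.finsum_singleton[OF S_Ks fin]) (use x in simp)
    ultimately show "y \<in> proper_traces G M Q" unfolding proper_traces_def by blast
  qed
qed

text \<open>M(P) is nonzero because f kills T but not b. In a decomposition the components of b
  cannot both lie in ker f, and the summand holding one outside ker f is everything.\<close>

lemma indecomposable_at_P:
  assumes index: "\<not> p dvd card (rcosets\<^bsub>G\<lparr>carrier := normalizer G P\<rparr>\<^esub> (P <#>\<^bsub>G\<^esub> centralizer G P))"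
  shows "indecomposable k (G\<lparr>carrier := centralizer G P\<rparr>) (gmod_quot (M\<lparr>carrier := E\<rparr>) T)"
proof -
  let ?H = "G\<lparr>carrier := centralizer G P\<rparr>" and ?E = "M\<lparr>carrier := E\<rparr>"
  let ?W = "gmod_quot ?E T"
  have CN: "c \<in> normalizer G P" if "c \<in> centralizer G P" for c
    using G.centralizer_subset_normalizer[OF finite_P P.subset] that by blast
  have sub: "subgroup (centralizer G P) G" by (rule G.centralizer_subgroup[OF P.subset])
  interpret H: gmodule k ?H M by (rule gmodule_restrict_group[OF sub])
  have "gsubmodule k ?H M E"
    unfolding gsubmodule_def using submodule_E E_normalizer CN by simp
  then interpret E: gmodule k ?H ?E by (rule H.gmodule_restrict_carrier)
  have "gsubmodule k ?H ?E T"
  proof (rule E.gsubmoduleI)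
    fix g x assume g: "g \<in> carrier ?H" and "x \<in> T"
    then obtain x' where x': "x' \<in> carrier M" "x = tr x'" unfolding T_def by auto
    have "g \<in> normalizer G P" using g CN by simp
    then have "gact M g x = tr (gact M g x')" "gact M g x' \<in> carrier M"
      using gact_tr x' G.normalizer_conj(1)[OF P.subgroup_axioms] by simp_all
    then show "gact ?E g x \<in> T" unfolding T_def by simp
  qed (use T_subset_E submodule_zero[OF submodule_T] submoduleE[OF submodule_T] in simp_all)
  then interpret W: gmodule_quotient k ?H ?E T
    by (intro gmodule_quotient.intro E.gmodule_axioms gmodule_quotient_axioms.intro)
  interpret Q: gmodule k ?H ?W by (rule W.gmodule_quot)
  have bE: "b \<in> E" using b_fixed unfolding E_def .
  define c where "c = (\<lambda>x. T +>\<^bsub>?E\<^esub> x)"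
  \<comment> \<open>The preimage in E of such a submodule contains T and is not inside ker f, so
    \<open>centralizer_submodule_eq_E\<close> applies to it.\<close>
  have full: "carrier ?W \<subseteq> A"
    if A: "gsubmodule k ?H ?W A" and a: "a \<in> E" "c a \<in> A" "f a \<noteq> \<zero>" for A a
  proof -
    let ?A = "{x \<in> carrier ?E. c x \<in> A}"
    have gA: "gsubmodule k ?H ?E ?A" and TA: "T \<subseteq> ?A"
      unfolding c_def by (rule W.gsubmodule_preimage[OF A])+
    have "?A = E"
    proof (rule centralizer_submodule_eq_E[OF index])
      show "submodule ?A k M"
        by (rule submodule_subset_trans[OF submodule_E]) (use gA in \<open>simp add: gsubmodule_def\<close>)
      show "?A \<subseteq> E" by auto
      show "T \<subseteq> ?A" by (rule TA)
      show "gact M g x \<in> ?A" if "g \<in> centralizer G P" "x \<in> ?A" for g x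
        using gA that unfolding gsubmodule_def by simp
      show "\<exists>x\<in>?A. f x \<noteq> \<zero>" using a by auto
    qed
    then have "c x \<in> A" if "x \<in> E" for x using that by blast
    then show ?thesis unfolding W.quot_carrier c_def by auto
  qed
  show ?thesis unfolding indecomposable_def
  proof (intro conjI allI impI)
    show "carrier ?W \<noteq> {\<zero>\<^bsub>?W\<^esub>}"
    proof
      assume z: "carrier ?W = {\<zero>\<^bsub>?W\<^esub>}"
      have "T +>\<^bsub>?E\<^esub> b \<in> carrier ?W" using bE by simp
      then have "T +>\<^bsub>?E\<^esub> b = T" unfolding z by (simp add: gmod_quot_def)
      then have "b \<in> T" using W.A.a_rcos_self[of b] bE by simp
      then show False using f_T f_b by blast
    qed
  next
    fix A B assume dec: "direct_decomposition k ?H ?W A B"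
    then have A: "gsubmodule k ?H ?W A" and B: "gsubmodule k ?H ?W B" and int: "A \<inter> B = {\<zero>\<^bsub>?W\<^esub>}"
      unfolding direct_decomposition_def by auto
    obtain x y where x: "x \<in> E" "c x \<in> A" and y: "y \<in> E" "c y \<in> B" and bxy: "b = x \<oplus>\<^bsub>M\<^esub> y"
      using W.decomposition_preimage[OF dec, of b] bE unfolding c_def by auto
    \<comment> \<open>f is additive and f(b) is nonzero.\<close>
    have "f x \<noteq> \<zero> \<or> f y \<noteq> \<zero>"
      using f_b x(1) y(1) E_carrier unfolding bxy by (auto simp: f_add subset_iff)
    then show "A = {\<zero>\<^bsub>?W\<^esub>} \<or> B = {\<zero>\<^bsub>?W\<^esub>}"
    proof
      assume "f x \<noteq> \<zero>"
      then have "B \<subseteq> A" using full[OF A x] Q.gsubmoduleD(2)[OF B] by blast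
      then show ?thesis using int by blast
    next
      assume "f y \<noteq> \<zero>"
      then have "A \<subseteq> B" using full[OF B y] Q.gsubmoduleD(2)[OF A] by blast
      then show ?thesis using int by blast
    qed
  qed
qed

end

theorem corollary1p2:
  fixes k :: "('k, 's) ring_scheme" and p :: nat
    and G :: "('g, 'r) monoid_scheme" and P R :: "'g set"
    and M :: "('k, 'm, 'g) gmod"
  assumes "algebraically_closed k" and "Factorial_Ring.prime p" and "has_characteristic k p"
    and "group G" and "finite (carrier G)"
    and "p_subgroup p P G"
    and "is_scott_module k G P M"
    and "\<not> p dvd order (G\<lparr>carrier := normalizer G P\<rparr> Mod (P <#>\<^bsub>G\<^esub> centralizer G P))"
    and "R \<lhd> G" and "R \<subseteq> P \<inter> gmod_kernel G M"
    and "order (G\<lparr>carrier := P\<rparr> Mod R) = p"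
  shows "brauer_indecomposable k G P M \<longleftrightarrow>
         indecomposable k (G\<lparr>carrier := centralizer G R\<rparr>) M"
proof -
  have "field k" using assms(1) by (simp add: algebraically_closed_def)
  moreover have P: "subgroup P G" using assms(6) unfolding p_subgroup_def by blast
  ultimately obtain b l where "permutation_summand k G M P b l"
    using scott_module_presentation[OF _ assms(5) _ assms(7)] by blast
  then interpret permutation_summand k G M P b l .
  obtain f where f: "f \<in> gmod_hom k G M (trivial_gmod k)" "f ` carrier M = carrier k"
    using assms(7) unfolding is_scott_module_def by blast
  have "\<one>\<^bsub>k\<^esub> \<in> f ` carrier M" using f(2) by simp
  then obtain x where x: "\<one>\<^bsub>k\<^esub> = f x" "x \<in> carrier M" by (rule imageE)
  have "scott_summand_axioms k G M f"
  proof (rule scott_summand_axioms.intro)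
    show "indecomposable k G M" using assms(7) unfolding is_scott_module_def by blast
    show "\<exists>x\<in>carrier M. f x \<noteq> \<zero>\<^bsub>k\<^esub>" using x K.one_not_zero by (intro bexI[of _ x]) simp_all
  qed (use f(1) in \<open>auto simp: gmod_hom_def trivial_gmod_def\<close>)
  then interpret scott_trivial_normal k G M P b l f p R
    by (intro scott_trivial_normal.intro scott_summand.intro scott_trivial_normal_axioms.intro
        permutation_summand_axioms assms)
  have index: "\<not> p dvd card (rcosets\<^bsub>G\<lparr>carrier := normalizer G P\<rparr>\<^esub> (P <#>\<^bsub>G\<^esub> centralizer G P))"
    using assms(8) by (simp add: order_def FactGroup_def)
  have CR: "subgroup (centralizer G R) G" by (rule G.centralizer_subgroup[OF R.subset])
  \<comment> \<open>Centralisers reverse inclusion, and 1 lies in Q.\<close>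
  have centr: "centralizer G H \<subseteq> Q <#>\<^bsub>G\<^esub> centralizer G Q" if "subgroup Q G" "Q \<subseteq> H" for Q H
  proof
    fix c assume c: "c \<in> centralizer G H"
    then have cQ: "c \<in> centralizer G Q" and cG: "c \<in> carrier G" using that(2) unfolding centralizer_def by auto
    have "\<one>\<^bsub>G\<^esub> \<otimes>\<^bsub>G\<^esub> c \<in> Q <#>\<^bsub>G\<^esub> centralizer G Q"
      unfolding set_mult_def by (intro UN_I[OF subgroup.one_closed[OF that(1)]] UN_I[OF cQ]) simp
    then show "c \<in> Q <#>\<^bsub>G\<^esub> centralizer G Q" using cG by simp
  qed
  show ?thesis
  proof
    assume "brauer_indecomposable k G P M"
    let ?H = "G\<lparr>carrier := R <#>\<^bsub>G\<^esub> centralizer G R\<rparr>"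
    interpret H: gmodule k ?H M
      by (rule gmodule_restrict_group[OF G.mult_norm_subgroup[OF R_normal CR]])
    have nonzero: "carrier M \<noteq> {\<zero>\<^bsub>M\<^esub>}" using indecomposable unfolding indecomposable_def by blast
    \<comment> \<open>Excludes the alternative that M(R) is zero: M is indecomposable over G, hence
      nonzero.\<close>
    have "carrier (gmod_quot M {\<zero>\<^bsub>M\<^esub>}) \<noteq> {\<zero>\<^bsub>gmod_quot M {\<zero>\<^bsub>M\<^esub>}\<^esub>}"
      using indecomposable indecomposable_quot_zero unfolding indecomposable_def by blast
    then have "indecomposable k ?H (gmod_quot M {\<zero>\<^bsub>M\<^esub>})"
      using \<open>brauer_indecomposable k G P M\<close> R.subgroup_axioms R_subset_P
        brauer_construction_kernel[OF R.subgroup_axioms order_refl]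
      unfolding brauer_indecomposable_def by metis
    then have ind: "indecomposable k ?H M" by (simp add: H.indecomposable_quot_zero)
    \<comment> \<open>R acts trivially, so R C_G(R) and C_G(R) have the same stable
      subspaces.\<close>
    have up: "gsubmodule k ?H M U" if U: "gsubmodule k (G\<lparr>carrier := centralizer G R\<rparr>) M U" for U
    proof -
      have sub: "submodule U k M" using U unfolding gsubmodule_def by simp
      have "gact M g u \<in> U" if g: "g \<in> R <#>\<^bsub>G\<^esub> centralizer G R" and u: "u \<in> U" for g u
      proof -
        obtain r c where r: "r \<in> R" and c: "c \<in> centralizer G R" and g': "g = r \<otimes>\<^bsub>G\<^esub> c"
          using g unfolding set_mult_def by auto
        have uc: "u \<in> carrier M" using u submoduleE(1)[OF sub] by blast
        have cG: "c \<in> carrier G" using c unfolding centralizer_def by simp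
        have "gact M g u = gact M c u"
          unfolding g' using r cG uc R.mem_carrier[OF r] by (simp add: gact_mult)
        then show ?thesis using U c u unfolding gsubmodule_def by simp
      qed
      then show ?thesis using sub unfolding gsubmodule_def by simp
    qed
    show "indecomposable k (G\<lparr>carrier := centralizer G R\<rparr>) M"
      unfolding indecomposable_def
    proof (intro conjI allI impI nonzero)
      fix A B assume "direct_decomposition k (G\<lparr>carrier := centralizer G R\<rparr>) M A B"
      then have "direct_decomposition k ?H M A B" unfolding direct_decomposition_def using up by blast
      then show "A = {\<zero>\<^bsub>M\<^esub>} \<or> B = {\<zero>\<^bsub>M\<^esub>}" using ind unfolding indecomposable_def by blast
    qed
  next
    assume ind: "indecomposable k (G\<lparr>carrier := centralizer G R\<rparr>) M"
    interpret C: gmodule k "G\<lparr>carrier := centralizer G R\<rparr>" M by (rule gmodule_restrict_group[OF CR])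
    have "indecomposable k (G\<lparr>carrier := Q <#>\<^bsub>G\<^esub> centralizer G Q\<rparr>) (brauer_construction G M Q)"
      if Q: "subgroup Q G" "Q \<subseteq> P" for Q
    \<comment> \<open>In the first case C_G(R) lies in Q C_G(Q) and condition (2) is transferred
      upwards; in the second C_G(P) does, and \<open>indecomposable_at_P\<close> is transferred
      instead.\<close>
    proof (cases "Q \<subseteq> R")
      case True
      have "indecomposable k (G\<lparr>carrier := centralizer G R\<rparr>) (gmod_quot M {\<zero>\<^bsub>M\<^esub>})"
        using ind by (simp add: C.indecomposable_quot_zero)
      then show ?thesis
        unfolding brauer_construction_kernel[OF Q(1) True]
        by (rule indecomposable_mono) (simp add: centr[OF Q(1) True])
    next
      case False
      have eq: "brauer_construction G M Q = gmod_quot (M\<lparr>carrier := E\<rparr>) T"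
        unfolding brauer_construction_def fixed_points_eq_E[OF Q False] proper_traces_eq_T[OF Q False] ..
      show ?thesis
        unfolding eq
        by (rule indecomposable_mono[OF indecomposable_at_P[OF index]]) (simp add: centr[OF Q])
    qed
    then show "brauer_indecomposable k G P M" unfolding brauer_indecomposable_def by blast
  qed
qed

end
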